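(* Let $X\subseteq\mathbb{R}^n$ be a nonempty open set, with points written $x=(t,y)$, $t\in\mathbb{R}$, $y\in\mathbb{R}^{n-1}$, and let $m\geq 1$. Consider the analytic nonlinear partial differential equation $$T(x,D)U(x)=D_t^mU(t,y)-G\bigl(t,y,\dots,D_t^pD_y^qU(t,y),\dots\bigr)=0,\qquad x=(t,y)\in X,$$ where the arguments $D_t^pD_y^qU$ of $G$ run over all $p\in\mathbb{N}$, $q\in\mathbb{N}^{n-1}$ with $0\leq p<m$ and $p+|q|\leq m$, and $G$ is an arbitrary function, analytic in all of its variables (defined for all $(t,y)\in X$ and all complex values of the remaining arguments). Let $t_0\in\mathbb{R}$, let $S=\{(t,y)\in X\mid t=t_0\}$ be the corresponding non-characteristic analytic hypersurface, and consider the initial value problem $$D_t^pU(t_0,y)=g_p(y),\qquad 0\leq p<m,\quad (t_0,y)\in S,$$ with given analytic functions $g_p$ (complex-valued, on $\{y\mid (t_0,y)\in S\}$). Then this initial value problem has global generalized solutions, defined on the whole of $X$, in each of the following two algebras: (a) $U\in A_{\mathrm{Baire\,I}}(X)$; (b) $U\in B_{\mathrm{Baire\,I}}(X)$. In each of the two cases, there is a suitably chosen subset $\Sigma\subset X$, closed and nowhere dense in $X$, such that the solution $U$, when restricted to the open dense subset $X\setminus\Sigma$, is an analytic function $\psi:X\setminus\Sigma\to\mathbb{C}$. Furthermore, one can choose $\Sigma$ to have zero Lebesgue measure.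
   Context: Throughout, $X$ (and likewise $Y$ below) denotes an open subset of $\mathbb{R}^n$, $\mathcal{C}^\infty(Y)$ is the algebra of complex-valued smooth functions on $Y$, and $(\mathcal{C}^\infty(Y))^{\mathbb{N}}$ is the algebra of sequences of such functions with termwise operations. "Analytic" on a subset of a real Euclidean space means real-analytic. Let $\mathcal{S}_{\mathrm{Baire\,I}}$ be the family of all subsets $\Sigma'\subseteq Y$ of first Baire category in $Y$. The ideal $\mathcal{J}_{\mathrm{Baire\,I}}(Y)$. For $\Sigma'\subseteq Y$ let $\mathcal{J}_{\Sigma'}(Y)$ be the set of all sequences $w=(w_\nu\mid\nu\in\mathbb{N})\in(\mathcal{C}^\infty(Y))^{\mathbb{N}}$ such that for every $x\in Y\setminus\Sigma'$ there is $\lambda\in\mathbb{N}$ such that for all $\mu\geq\lambda$ and all $p\in\mathbb{N}^n$ one has $D^pw_\mu(x)=0$. Set $\mathcal{J}_{\mathrm{Baire\,I}}(Y)=\bigcup_{\Sigma'\in\mathcal{S}_{\mathrm{Baire\,I}}}\mathcal{J}_{\Sigma'}(Y)$; this is an ideal of $(\mathcal{C}^\infty(Y))^{\mathbb{N}}$. The ideal $\mathcal{I}_{\mathrm{Baire\,I}}(Y)$. Suppose $\Sigma'\in\mathcal{S}_{\mathrm{Baire\,I}}$ has a representation $\Sigma'=\bigcap_{\lambda\in\mathbb{N}}\bigcup_{\mu\geq\lambda}\Sigma'_\mu$ with $\Sigma'_\mu\subseteq Y$ and $Y\setminus\Sigma'_\mu$ open for all $\mu\in\mathbb{N}$. Let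 $\mathcal{I}_{\Sigma'}(Y)$ be the set of all $w=(w_\nu\mid\nu\in\mathbb{N})\in(\mathcal{C}^\infty(Y))^{\mathbb{N}}$ such that for every $x\in Y\setminus\Sigma'$ there is $\lambda\in\mathbb{N}$ such that for every $\mu\geq\lambda$ there is an open set $\Delta_\mu$ with $x\in\Delta_\mu\subseteq Y\setminus\Sigma'_\mu$ and $w_\mu=0$ on $\Delta_\mu$ (this set does not depend on the representation of $\Sigma'$). Let $\mathcal{I}_{\mathrm{Baire\,I}}(Y)$ be the union of the $\mathcal{I}_{\Sigma'}(Y)$ over all $\Sigma'\in\mathcal{S}_{\mathrm{Baire\,I}}$ admitting such a representation; this is an ideal of $(\mathcal{C}^\infty(Y))^{\mathbb{N}}$. The algebras are the quotients $$A_{\mathrm{Baire\,I}}(Y)=(\mathcal{C}^\infty(Y))^{\mathbb{N}}/\mathcal{I}_{\mathrm{Baire\,I}}(Y),\qquad B_{\mathrm{Baire\,I}}(Y)=(\mathcal{C}^\infty(Y))^{\mathbb{N}}/\mathcal{J}_{\mathrm{Baire\,I}}(Y).$$ Both ideals are stable under termwise partial derivatives. A smooth function $\psi\in\mathcal{C}^\infty(Y)$ is identified with the class of the constant sequence $(\psi,\psi,\psi,\dots)$. The operator $T(x,D)$ maps $\mathcal{C}^\infty(X)$ into itself, and it acts on each of the two quotient algebras on $X$ termwise on representatives: $T(x,D)$ sends the class of $(s_\nu)_\nu$ to the class of $(T(x,D)s_\nu)_\nu$ (this is well defined). For open $Y\subseteq X$ the restriction of the class of $(s_\nu)_\nu$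 to $Y$ is the class of $(s_\nu|_Y)_\nu$ in the corresponding algebra on $Y$. That $U$ is a global generalized solution of the initial value problem which is the analytic function $\psi:X\setminus\Sigma\to\mathbb{C}$ on $X\setminus\Sigma$ means: (i) $T(x,D)U=0$ in the respective algebra on $X$; (ii) $U|_{X\setminus\Sigma}$ equals the class of the constant sequence of $\psi$ in the respective algebra on $X\setminus\Sigma$; (iii) the initial conditions hold classically on $S$, i.e. $\Sigma\cap S=\emptyset$ and $D_t^p\psi(t_0,y)=g_p(y)$ for all $0\leq p<m$ and $(t_0,y)\in S$. *)

theory Defs
  imports "HOL-Analysis.Analysis" "HOL-Algebra.QuotRing"
begin

text \<open>
  Points of $\mathbb{R}^n$ are elements \<open>x :: real ^ 'n\<close>, with one distinguished coordinate \<open>k\<close>: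
  \<open>t = x $ k\<close>, and \<open>y\<close> consists of the remaining coordinates.  This covers every \<open>n \<ge> 1\<close>,
  including \<open>n = 1\<close>, where \<open>y\<close> ranges over a one-point space.  A multi-index is a function
  \<open>\<alpha> :: 'n \<Rightarrow> nat\<close>, with \<open>p = \<alpha> k\<close> and \<open>q\<close> the remaining entries.
\<close>

section \<open>Partial derivatives and smooth functions\<close>

definition partial_deriv :: "'n \<Rightarrow> (real ^ 'n \<Rightarrow> complex) \<Rightarrow> real ^ 'n \<Rightarrow> complex" where
  "partial_deriv i f x = vector_derivative (\<lambda>h. f (x + h *\<^sub>R axis i 1)) (at 0)"

text \<open>
  The coordinates are enumerated in an arbitrary fixed order; \<open>multi_deriv\<close> is only ever applied to
  smooth functions, for which the order of differentiation is irrelevant.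
\<close>

definition multi_deriv :: "('n::finite \<Rightarrow> nat) \<Rightarrow> (real ^ 'n \<Rightarrow> complex) \<Rightarrow> real ^ 'n \<Rightarrow> complex" where
  "multi_deriv \<alpha> f =
     foldr (\<lambda>i. partial_deriv i ^^ \<alpha> i) (SOME js. distinct js \<and> set js = (UNIV :: 'n set)) f"

text \<open>
  Functions on an open set \<open>Y\<close> are represented as extensional functions, so that equality of
  elements of \<open>smooth_functions Y\<close> is equality of functions on \<open>Y\<close>.  Differentiability of all
  iterated partial derivatives includes their continuity.
\<close>

definition smooth_functions :: "(real ^ 'n::finite) set \<Rightarrow> (real ^ 'n \<Rightarrow> complex) set" where
  "smooth_functions Y =
     {f \<in> extensional Y. \<forall>js. foldr partial_deriv js f differentiable_on Y}"

section \<open>Analytic functions\<close>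

text \<open>
  The expansion is required for the points of \<open>D\<close> only.  If \<open>D\<close> lies in a hyperplane
  \<open>x $ k = t0\<close> and is open in it, all monomials with \<open>\<beta> k > 0\<close> vanish on \<open>D\<close>, so that this is
  analyticity in the other coordinates.
\<close>

definition real_analytic_on :: "(real ^ 'n::finite \<Rightarrow> complex) \<Rightarrow> (real ^ 'n) set \<Rightarrow> bool"
    (infix "real'_analytic'_on" 50) where
  "f real_analytic_on D \<longleftrightarrow>
     (\<forall>a\<in>D. \<exists>r>0. \<exists>c :: ('n \<Rightarrow> nat) \<Rightarrow> complex. \<forall>x\<in>D. dist x a < r \<longrightarrow>
        ((\<lambda>\<beta>. c \<beta> * (\<Prod>i\<in>UNIV. of_real (x $ i - a $ i) ^ \<beta> i)) has_sum f x) UNIV)"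

text \<open>
  Joint analyticity of a function of the real variables \<open>x \<in> X\<close> and of finitely many complex
  variables \<open>\<xi> j\<close>, \<open>j \<in> J\<close>: locally a convergent power series in all of them.
\<close>

definition analytic_in_all_variables ::
    "(real ^ 'n::finite) set \<Rightarrow> 'j set \<Rightarrow> (real ^ 'n \<Rightarrow> ('j \<Rightarrow> complex) \<Rightarrow> complex) \<Rightarrow> bool" where
  "analytic_in_all_variables X J G \<longleftrightarrow>
     (\<forall>a\<in>X. \<forall>b\<in>J \<rightarrow>\<^sub>E UNIV. \<exists>r>0. \<exists>c :: ('n \<Rightarrow> nat) \<Rightarrow> ('j \<Rightarrow> nat) \<Rightarrow> complex.
        \<forall>x\<in>X. \<forall>\<xi>\<in>J \<rightarrow>\<^sub>E UNIV. dist x a < r \<and> (\<forall>j\<in>J. dist (\<xi> j) (b j) < r) \<longrightarrow>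
          ((\<lambda>(\<beta>, \<gamma>). c \<beta> \<gamma> * (\<Prod>i\<in>UNIV. of_real (x $ i - a $ i) ^ \<beta> i)
                           * (\<Prod>j\<in>J. (\<xi> j - b j) ^ \<gamma> j)) has_sum G x \<xi>)
            (UNIV \<times> (J \<rightarrow>\<^sub>E UNIV)))"

section \<open>Baire category\<close>

definition nowhere_dense_in :: "'a topology \<Rightarrow> 'a set \<Rightarrow> bool" where
  "nowhere_dense_in T N \<longleftrightarrow>
     N \<subseteq> topspace T \<and> T interior_of (T closure_of N) = {}"

definition first_category_in :: "'a topology \<Rightarrow> 'a set \<Rightarrow> bool" where
  "first_category_in T M \<longleftrightarrow>
     (\<exists>N :: nat \<Rightarrow> 'a set. (\<forall>i. nowhere_dense_in T (N i)) \<and> M = (\<Union>i. N i))"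

definition S_Baire_I :: "(real ^ 'n::finite) set \<Rightarrow> (real ^ 'n) set set" where
  "S_Baire_I Y = {\<Sigma>'. first_category_in (top_of_set Y) \<Sigma>'}"

section \<open>The sequence algebra, its ideals and the quotient algebras\<close>

definition smooth_seq_ring :: "(real ^ 'n::finite) set \<Rightarrow> (nat \<Rightarrow> real ^ 'n \<Rightarrow> complex) ring" where
  "smooth_seq_ring Y =
     \<lparr>carrier = {s. \<forall>\<nu>. s \<nu> \<in> smooth_functions Y},
      mult = (\<lambda>s s' \<nu>. \<lambda>x\<in>Y. s \<nu> x * s' \<nu> x),
      one = (\<lambda>\<nu>. \<lambda>x\<in>Y. 1),
      zero = (\<lambda>\<nu>. \<lambda>x\<in>Y. 0),
      add = (\<lambda>s s' \<nu>. \<lambda>x\<in>Y. s \<nu> x + s' \<nu> x)\<rparr>"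

definition J_ideal :: "(real ^ 'n::finite) set \<Rightarrow> (real ^ 'n) set \<Rightarrow> (nat \<Rightarrow> real ^ 'n \<Rightarrow> complex) set"
  where
  "J_ideal Y \<Sigma>' =
     {w \<in> carrier (smooth_seq_ring Y).
        \<forall>x\<in>Y - \<Sigma>'. \<exists>l. \<forall>\<mu>\<ge>l. \<forall>p. multi_deriv p (w \<mu>) x = 0}"

definition J_Baire_I :: "(real ^ 'n::finite) set \<Rightarrow> (nat \<Rightarrow> real ^ 'n \<Rightarrow> complex) set" where
  "J_Baire_I Y = (\<Union>\<Sigma>'\<in>S_Baire_I Y. J_ideal Y \<Sigma>')"

definition limsup_set :: "(nat \<Rightarrow> 'a set) \<Rightarrow> 'a set" where
  "limsup_set S = (\<Inter>l. \<Union>\<mu>\<in>{l..}. S \<mu>)"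

text \<open>\<open>I_ideal\<close> takes the representing sequence of \<open>\<Sigma>' = limsup_set S\<close> instead of \<open>\<Sigma>'\<close>.\<close>

definition I_ideal ::
    "(real ^ 'n::finite) set \<Rightarrow> (nat \<Rightarrow> (real ^ 'n) set) \<Rightarrow> (nat \<Rightarrow> real ^ 'n \<Rightarrow> complex) set"
  where
  "I_ideal Y S =
     {w \<in> carrier (smooth_seq_ring Y).
        \<forall>x\<in>Y - limsup_set S. \<exists>l. \<forall>\<mu>\<ge>l.
          \<exists>\<Delta>. open \<Delta> \<and> x \<in> \<Delta> \<and> \<Delta> \<subseteq> Y - S \<mu> \<and> (\<forall>z\<in>\<Delta>. w \<mu> z = 0)}"

definition I_Baire_I :: "(real ^ 'n::finite) set \<Rightarrow> (nat \<Rightarrow> real ^ 'n \<Rightarrow> complex) set" where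
  "I_Baire_I Y =
     \<Union> {I_ideal Y S | S. (\<forall>\<mu>. S \<mu> \<subseteq> Y \<and> open (Y - S \<mu>)) \<and> limsup_set S \<in> S_Baire_I Y}"

definition A_Baire_I :: "(real ^ 'n::finite) set \<Rightarrow> (nat \<Rightarrow> real ^ 'n \<Rightarrow> complex) set ring" where
  "A_Baire_I Y = smooth_seq_ring Y Quot I_Baire_I Y"

definition B_Baire_I :: "(real ^ 'n::finite) set \<Rightarrow> (nat \<Rightarrow> real ^ 'n \<Rightarrow> complex) set ring" where
  "B_Baire_I Y = smooth_seq_ring Y Quot J_Baire_I Y"

text \<open>
  In the following, \<open>\<I>\<close> assigns to each open set an ideal of sequences, that is, it is
  \<open>I_Baire_I\<close> or \<open>J_Baire_I\<close>.  The union in \<open>lift_class\<close> is over all representatives; it is a single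
  coset as soon as the coset of \<open>F s\<close> does not depend on the representative \<open>s\<close>.
\<close>

definition seq_class ::
    "((real ^ 'n::finite) set \<Rightarrow> (nat \<Rightarrow> real ^ 'n \<Rightarrow> complex) set) \<Rightarrow> (real ^ 'n) set
     \<Rightarrow> (nat \<Rightarrow> real ^ 'n \<Rightarrow> complex) \<Rightarrow> (nat \<Rightarrow> real ^ 'n \<Rightarrow> complex) set" where
  "seq_class \<I> Y s = \<I> Y +>\<^bsub>smooth_seq_ring Y\<^esub> s"

definition lift_class ::
    "((real ^ 'n::finite) set \<Rightarrow> (nat \<Rightarrow> real ^ 'n \<Rightarrow> complex) set) \<Rightarrow> (real ^ 'n) set
     \<Rightarrow> ((real ^ 'n \<Rightarrow> complex) \<Rightarrow> (real ^ 'n \<Rightarrow> complex))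
     \<Rightarrow> (nat \<Rightarrow> real ^ 'n \<Rightarrow> complex) set \<Rightarrow> (nat \<Rightarrow> real ^ 'n \<Rightarrow> complex) set" where
  "lift_class \<I> Y F U = (\<Union>s\<in>U. seq_class \<I> Y (\<lambda>\<nu>. F (s \<nu>)))"

definition restrict_class ::
    "((real ^ 'n::finite) set \<Rightarrow> (nat \<Rightarrow> real ^ 'n \<Rightarrow> complex) set) \<Rightarrow> (real ^ 'n) set
     \<Rightarrow> (nat \<Rightarrow> real ^ 'n \<Rightarrow> complex) set \<Rightarrow> (nat \<Rightarrow> real ^ 'n \<Rightarrow> complex) set" where
  "restrict_class \<I> Y U = lift_class \<I> Y (\<lambda>f. restrict f Y) U"

definition const_class ::
    "((real ^ 'n::finite) set \<Rightarrow> (nat \<Rightarrow> real ^ 'n \<Rightarrow> complex) set) \<Rightarrow> (real ^ 'n) set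
     \<Rightarrow> (real ^ 'n \<Rightarrow> complex) \<Rightarrow> (nat \<Rightarrow> real ^ 'n \<Rightarrow> complex) set" where
  "const_class \<I> Y \<psi> = seq_class \<I> Y (\<lambda>\<nu>. restrict \<psi> Y)"

section \<open>The differential operator and the initial value problem\<close>

text \<open>The multi-indices \<open>(p, q)\<close> with \<open>p < m\<close> and \<open>p + |q| \<le> m\<close>.\<close>

definition jet_indices :: "'n::finite \<Rightarrow> nat \<Rightarrow> ('n \<Rightarrow> nat) set" where
  "jet_indices k m = {\<alpha>. \<alpha> k < m \<and> (\<Sum>i\<in>UNIV. \<alpha> i) \<le> m}"

definition T_op ::
    "(real ^ 'n::finite) set \<Rightarrow> 'n \<Rightarrow> nat \<Rightarrow> (real ^ 'n \<Rightarrow> (('n \<Rightarrow> nat) \<Rightarrow> complex) \<Rightarrow> complex)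
     \<Rightarrow> (real ^ 'n \<Rightarrow> complex) \<Rightarrow> (real ^ 'n \<Rightarrow> complex)" where
  "T_op X k m G u =
     (\<lambda>x\<in>X. (partial_deriv k ^^ m) u x - G x (\<lambda>\<alpha>\<in>jet_indices k m. multi_deriv \<alpha> u x))"

definition initial_surface :: "(real ^ 'n::finite) set \<Rightarrow> 'n \<Rightarrow> real \<Rightarrow> (real ^ 'n) set" where
  "initial_surface X k t0 = {x \<in> X. x $ k = t0}"

text \<open>
  The initial data \<open>g p\<close> are functions of \<open>y\<close>, where \<open>y\<close> is identified with the point \<open>(t0, y)\<close> of
  the initial surface.
\<close>

definition is_generalized_solution ::
    "((real ^ 'n::finite) set \<Rightarrow> (nat \<Rightarrow> real ^ 'n \<Rightarrow> complex) set) \<Rightarrow> (real ^ 'n) set \<Rightarrow> 'n \<Rightarrow> nat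
     \<Rightarrow> (real ^ 'n \<Rightarrow> (('n \<Rightarrow> nat) \<Rightarrow> complex) \<Rightarrow> complex) \<Rightarrow> real \<Rightarrow> (nat \<Rightarrow> real ^ 'n \<Rightarrow> complex)
     \<Rightarrow> (real ^ 'n) set \<Rightarrow> (real ^ 'n \<Rightarrow> complex) \<Rightarrow> (nat \<Rightarrow> real ^ 'n \<Rightarrow> complex) set \<Rightarrow> bool" where
  "is_generalized_solution \<I> X k m G t0 g \<Sigma> \<psi> U \<longleftrightarrow>
     lift_class \<I> X (T_op X k m G) U = \<zero>\<^bsub>smooth_seq_ring X Quot \<I> X\<^esub> \<and>
     restrict_class \<I> (X - \<Sigma>) U = const_class \<I> (X - \<Sigma>) \<psi> \<and>
     \<Sigma> \<inter> initial_surface X k t0 = {} \<and>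
     (\<forall>p<m. \<forall>x\<in>initial_surface X k t0. (partial_deriv k ^^ p) \<psi> x = g p x)"

end

theory Submission
  imports Defs
begin

text \<open>
  Near a point, the Cauchy-Kovalevskaya theorem solves the equation for \<open>w = D\<^sub>t\<^sup>m u\<close> as
  a fixed point \<open>w = \<Phi> w\<close> in an algebra of power series with a weighted \<open>\<ell>\<^sup>1\<close> norm in which
  \<open>D\<^sub>y\<^sup>q D\<^sub>t\<^sup>-\<^sup>l\<close> is small for \<open>\<bar>q\<bar> \<le> l\<close>, \<open>l \<ge> 1\<close>.  Since \<open>\<Phi> w\<close> is determined up to
  order \<open>j + 1\<close> in \<open>t\<close> by \<open>w\<close> up to order \<open>j\<close>, the iterates stabilise coefficientwise, and since
  \<open>\<Phi>\<close> preserves a ball, the limit stays in it; no contraction estimate is needed.  The local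
  solutions on boxes centred on \<open>S\<close> agree by formal uniqueness on \<open>S\<close> and give a solution on a
  neighbourhood \<open>N\<close> of \<open>S\<close>.  A function separating \<open>S\<close> from \<open>X - N\<close> has a null level set; beyond
  it, Vitali's theorem gives disjoint balls carrying local solutions and covering almost everything.
  What is left over is \<open>\<Sigma>\<close>.  Finally \<open>U\<close> is the class of \<open>\<chi>\<^sub>\<nu> \<psi>\<close> with smooth cutoffs \<open>\<chi>\<^sub>\<nu>\<close>
  vanishing near \<open>\<Sigma>\<close> and equal to \<open>1\<close> on sets exhausting \<open>X - \<Sigma>\<close>.  By Baire's theorem the two
  ideals coincide: both consist of the sequences that vanish eventually near every point of an open
  dense set.
\<close>

section \<open>Power series in finitely many variables\<close>

text \<open>Write w for the highest t-derivative. Every argument of \<open>G\<close> is then a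
  derivative of the given data plus a term D_y^q D_t^(-l) w with l = m - p \<ge> 1, and the order
  condition p + |q| \<le> m says |q| \<le> l. The obstacle is that D_y is unbounded for geometric
  weights; each D_y must be paid for by one integration in t, and the order condition supplies just
  enough of them. Two scales are chosen in turn: r makes the data, up to their values at the centre,
  small; then \<tau>, with \<tau> / r small, controls the integrated terms. The bound for
  \<open>G\<close> is fixed before both. Away from S nothing ties the pieces together: the solution
  on one ball is chosen without regard to its neighbours, and the resulting \<psi> may be singular
  at \<Sigma>. This is why disjoint balls that fill the space up to a null set suffice and why
  cutoffs are needed. A relatively closed null set has no interior, so \<Sigma> is nowhere
  dense.\<close>

abbreviation multi_indices :: "'v set \<Rightarrow> ('v \<Rightarrow> nat) set" where
  "multi_indices I \<equiv> I \<rightarrow>\<^sub>E UNIV"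

definition mpow :: "'v set \<Rightarrow> ('v \<Rightarrow> 'a::comm_semiring_1) \<Rightarrow> ('v \<Rightarrow> nat) \<Rightarrow> 'a" where
  "mpow I z \<beta> = (\<Prod>i\<in>I. z i ^ \<beta> i)"

text \<open>Absolute convergence at the corner \<open>\<rho>\<close>, hence on the closed polydisc
  of polyradius \<open>\<rho>\<close>. Indices are extensional functions, so each monomial in the
  variables \<open>I\<close> occurs once, and unconditional summation avoids enumerating
  them.\<close>

definition ps_conv :: "'v set \<Rightarrow> (('v \<Rightarrow> nat) \<Rightarrow> complex) \<Rightarrow> ('v \<Rightarrow> real) \<Rightarrow> bool" where
  "ps_conv I c \<rho> \<longleftrightarrow> (\<lambda>\<beta>. norm (c \<beta>) * mpow I \<rho> \<beta>) summable_on multi_indices I"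

definition ps :: "'v set \<Rightarrow> (('v \<Rightarrow> nat) \<Rightarrow> complex) \<Rightarrow> ('v \<Rightarrow> complex) \<Rightarrow> complex" where
  "ps I c z = infsum (\<lambda>\<beta>. c \<beta> * mpow I z \<beta>) (multi_indices I)"

definition ps_deriv :: "'v \<Rightarrow> (('v \<Rightarrow> nat) \<Rightarrow> complex) \<Rightarrow> ('v \<Rightarrow> nat) \<Rightarrow> complex" where
  "ps_deriv i c \<beta> = of_nat (Suc (\<beta> i)) * c (\<beta>(i := Suc (\<beta> i)))"

lemma norm_mpow: "norm (mpow I z \<beta>) = mpow I (\<lambda>i. norm (z i)) \<beta>"
  for z :: "'v \<Rightarrow> 'a::real_normed_field"
  by (simp add: mpow_def norm_power flip: prod_norm)

lemma mpow_nonneg: "(\<And>i. i \<in> I \<Longrightarrow> 0 \<le> \<rho> i) \<Longrightarrow> 0 \<le> mpow I \<rho> \<beta>"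
  for \<rho> :: "'v \<Rightarrow> real"
  by (auto simp: mpow_def intro!: prod_nonneg)

lemma mpow_mono: "(\<And>i. i \<in> I \<Longrightarrow> 0 \<le> a i \<and> a i \<le> b i) \<Longrightarrow> mpow I a \<beta> \<le> mpow I b \<beta>"
  for a b :: "'v \<Rightarrow> real"
  by (auto simp: mpow_def intro!: prod_mono power_mono)

lemma mpow_const: "mpow I (\<lambda>_. s) \<beta> = s ^ (\<Sum>i\<in>I. \<beta> i)"
  by (simp add: mpow_def power_sum)

lemma mpow_cong: "(\<And>i. i \<in> I \<Longrightarrow> a i = b i) \<Longrightarrow> mpow I a \<beta> = mpow I b \<beta>"
  by (simp add: mpow_def)

lemma summable_on_le:
  fixes f g :: "'a \<Rightarrow> real"
  assumes "g summable_on A" "\<And>x. x \<in> A \<Longrightarrow> 0 \<le> f x \<and> f x \<le> g x"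
  shows "f summable_on A"
proof -
  have "(\<lambda>x. norm (f x)) summable_on A"
  proof (rule Infinite_Sum.abs_summable_on_comparison_test)
    show "(\<lambda>x. norm (g x)) summable_on A"
      by (rule summable_on_iff_abs_summable_on_real[THEN iffD1, OF assms(1)])
    show "norm (f x) \<le> norm (g x)" if "x \<in> A" for x
      using assms(2)[OF that] by simp
  qed
  then show ?thesis by (rule abs_summable_summable)
qed

lemma ps_conv_mono:
  assumes "ps_conv I c \<rho>" "\<And>i. i \<in> I \<Longrightarrow> 0 \<le> \<rho>' i \<and> \<rho>' i \<le> \<rho> i"
  shows "ps_conv I c \<rho>'"
  using assms(1) unfolding ps_conv_def
  by (rule summable_on_le) (use assms(2) in \<open>auto intro!: mult_left_mono mpow_mono mpow_nonneg mult_nonneg_nonneg\<close>)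

lemma ps_abs_summable:
  assumes "ps_conv I c \<rho>" "\<And>i. i \<in> I \<Longrightarrow> norm (z i) \<le> \<rho> i"
  shows "(\<lambda>\<beta>. norm (c \<beta> * mpow I z \<beta>)) summable_on multi_indices I"
  using ps_conv_mono[OF assms(1), of "\<lambda>i. norm (z i)"] assms(2)
  by (simp add: ps_conv_def norm_mult norm_mpow)

lemma ps_has_sum:
  assumes "ps_conv I c \<rho>" "\<And>i. i \<in> I \<Longrightarrow> norm (z i) \<le> \<rho> i"
  shows "((\<lambda>\<beta>. c \<beta> * mpow I z \<beta>) has_sum ps I c z) (multi_indices I)"
  unfolding ps_def using abs_summable_summable[OF ps_abs_summable[OF assms]] by simp

text \<open>The binomial theorem in each variable, written as a sum over all multi-indices: terms
  with \<open>\<gamma> i > \<beta> i\<close> vanish through the binomial coefficient. A summation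
  range that does not depend on \<open>\<beta>\<close> turns the expansion of a whole series into a
  sum over a product set.\<close>

lemma mpow_add_has_sum:
  fixes a b :: "'v \<Rightarrow> 'a::real_normed_field"
  assumes "finite I"
  shows "((\<lambda>\<gamma>. \<Prod>i\<in>I. of_nat (\<beta> i choose \<gamma> i) * a i ^ (\<beta> i - \<gamma> i) * b i ^ \<gamma> i)
            has_sum mpow I (\<lambda>i. a i + b i) \<beta>) (multi_indices I)"
proof -
  let ?f = "\<lambda>\<gamma>. \<Prod>i\<in>I. of_nat (\<beta> i choose \<gamma> i) * a i ^ (\<beta> i - \<gamma> i) * b i ^ \<gamma> i"
  have "mpow I (\<lambda>i. a i + b i) \<beta> = (\<Prod>i\<in>I. \<Sum>l\<in>{..\<beta> i}. of_nat (\<beta> i choose l) * a i ^ (\<beta> i - l) * b i ^ l)"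
    unfolding mpow_def
    by (intro prod.cong refl) (subst add.commute, subst binomial_ring, simp add: mult_ac)
  also have "\<dots> = sum ?f (PiE I (\<lambda>i. {..\<beta> i}))"
    using assms by (subst prod_sum_PiE) auto
  finally have eq: "mpow I (\<lambda>i. a i + b i) \<beta> = sum ?f (PiE I (\<lambda>i. {..\<beta> i}))" .
  have "(?f has_sum sum ?f (PiE I (\<lambda>i. {..\<beta> i}))) (PiE I (\<lambda>i. {..\<beta> i}))"
    using assms by (intro has_sum_finite finite_PiE) auto
  moreover have "?f \<gamma> = 0" if "\<gamma> \<in> multi_indices I - PiE I (\<lambda>i. {..\<beta> i})" for \<gamma>
  proof -
    from that obtain i where "i \<in> I" "\<beta> i < \<gamma> i" by (auto simp: PiE_iff not_le)
    then show ?thesis using assms by (intro prod_zero) (auto intro!: bexI[of _ i])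
  qed
  ultimately show ?thesis unfolding eq
    by (subst has_sum_cong_neutral[where T = "PiE I (\<lambda>i. {..\<beta> i})" and g = ?f]) auto
qed

section \<open>Expansion about another point\<close>

text \<open>The Taylor coefficient of order \<open>\<gamma>\<close> at \<open>z\<close>, that is,
  the derivative of order \<open>\<gamma>\<close> divided by \<gamma>!.\<close>

definition recenter_coeff :: "'v set \<Rightarrow> (('v \<Rightarrow> nat) \<Rightarrow> complex) \<Rightarrow> ('v \<Rightarrow> complex) \<Rightarrow> ('v \<Rightarrow> nat) \<Rightarrow> complex" where
  "recenter_coeff I c z \<gamma> =
     infsum (\<lambda>\<beta>. c \<beta> * (\<Prod>i\<in>I. of_nat (\<beta> i choose \<gamma> i) * z i ^ (\<beta> i - \<gamma> i))) (multi_indices I)"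

text \<open>Summing absolute values over \<open>\<gamma>\<close> first gives
  \<open>norm (c \<beta>)\<close> times the monomial at \<open>norm (z i) + norm (h i)\<close>, and
  the hypothesis keeps these radii within \<open>\<rho>\<close>, equality included.\<close>

lemma recenter_abs_summable:
  assumes I: "finite I" and c: "ps_conv I c \<rho>" and z: "\<And>i. i \<in> I \<Longrightarrow> norm (z i) + norm (h i) \<le> \<rho> i"
  shows "(\<lambda>p. norm ((\<lambda>(\<beta>, \<gamma>). c \<beta> * (\<Prod>i\<in>I. of_nat (\<beta> i choose \<gamma> i) * z i ^ (\<beta> i - \<gamma> i) * h i ^ \<gamma> i)) p))
           summable_on (multi_indices I \<times> multi_indices I)"
proof -
  let ?P = "\<lambda>\<beta> \<gamma>. (\<Prod>i\<in>I. of_nat (\<beta> i choose \<gamma> i) * norm (z i) ^ (\<beta> i - \<gamma> i) * norm (h i) ^ \<gamma> i) :: real"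
  have hs: "((\<lambda>\<gamma>. norm (c \<beta>) * ?P \<beta> \<gamma>) has_sum norm (c \<beta>) * mpow I (\<lambda>i. norm (z i) + norm (h i)) \<beta>)
          (multi_indices I)" for \<beta>
    by (intro has_sum_cmult_right mpow_add_has_sum I)
  have n: "norm (c \<beta> * (\<Prod>i\<in>I. of_nat (\<beta> i choose \<gamma> i) * z i ^ (\<beta> i - \<gamma> i) * h i ^ \<gamma> i)) = norm (c \<beta>) * ?P \<beta> \<gamma>" for \<beta> \<gamma>
    by (simp add: norm_mult norm_power flip: prod_norm)
  have "ps_conv I c (\<lambda>i. norm (z i) + norm (h i))"
    by (rule ps_conv_mono[OF c]) (use z in auto)
  then have "(\<lambda>\<beta>. norm (c \<beta>) * mpow I (\<lambda>i. norm (z i) + norm (h i)) \<beta>) summable_on multi_indices I"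
    by (simp add: ps_conv_def)
  then have "(\<lambda>\<beta>. norm (norm (c \<beta>) * mpow I (\<lambda>i. norm (z i) + norm (h i)) \<beta>)) summable_on multi_indices I"
    by (rule summable_on_iff_abs_summable_on_real[THEN iffD1])
  moreover have "(\<lambda>\<gamma>. norm (c \<beta>) * ?P \<beta> \<gamma>) summable_on multi_indices I" for \<beta>
    using hs has_sum_imp_summable by blast
  moreover have "infsum (\<lambda>\<gamma>. norm (c \<beta>) * ?P \<beta> \<gamma>) (multi_indices I) = norm (c \<beta>) * mpow I (\<lambda>i. norm (z i) + norm (h i)) \<beta>" for \<beta>
    using hs by (rule infsumI)
  ultimately show ?thesis
    by (subst Infinite_Sum.abs_summable_on_Sigma_iff) (simp add: n)
qed

lemma recenter_coeff_mult:
  "c * (\<Prod>i\<in>I. of_nat (\<beta> i choose \<gamma> i) * z i ^ (\<beta> i - \<gamma> i) * h i ^ \<gamma> i)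
   = c * (\<Prod>i\<in>I. of_nat (\<beta> i choose \<gamma> i) * z i ^ (\<beta> i - \<gamma> i)) * mpow I h \<gamma>" for c :: complex
  by (simp add: prod.distrib mpow_def mult.assoc)

text \<open>Both orders of summation of the absolutely summable double series: over
  \<open>\<gamma>\<close> first it is the series at z + h, over \<open>\<beta>\<close> first the
  series in h with the new coefficients.\<close>

lemma recenter:
  assumes I: "finite I" and c: "ps_conv I c \<rho>" and z: "\<And>i. i \<in> I \<Longrightarrow> norm (z i) + norm (h i) \<le> \<rho> i"
  shows "((\<lambda>\<gamma>. recenter_coeff I c z \<gamma> * mpow I h \<gamma>) has_sum ps I c (\<lambda>i. z i + h i)) (multi_indices I)"
    and "(\<lambda>\<gamma>. norm (recenter_coeff I c z \<gamma>) * mpow I (\<lambda>i. norm (h i)) \<gamma>) summable_on (multi_indices I)"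
proof -
  define T where "T = (\<lambda>(\<beta>, \<gamma>). c \<beta> * (\<Prod>i\<in>I. of_nat (\<beta> i choose \<gamma> i) * z i ^ (\<beta> i - \<gamma> i) * h i ^ \<gamma> i))"
  have ab: "(\<lambda>p. norm (T p)) summable_on (multi_indices I \<times> multi_indices I)"
    unfolding T_def by (rule recenter_abs_summable[OF I c z])
  define T' where "T' = (\<lambda>(\<gamma>, \<beta>). T (\<beta>, \<gamma>))"
  have bij: "bij_betw (\<lambda>(\<gamma>, \<beta>). (\<beta>, \<gamma>)) (multi_indices I \<times> multi_indices I) (multi_indices I \<times> multi_indices I)"
    by (rule bij_betwI[where g = "\<lambda>(\<gamma>, \<beta>). (\<beta>, \<gamma>)"]) auto
  have T'T: "T' = (\<lambda>p. T ((\<lambda>(\<gamma>, \<beta>). (\<beta>, \<gamma>)) p))"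
    by (auto simp: T'_def)
  have ab': "(\<lambda>p. norm (T' p)) summable_on (multi_indices I \<times> multi_indices I)"
    using ab unfolding T'T
    by (subst summable_on_reindex_bij_betw[OF bij, of "\<lambda>p. norm (T p)"])
  have inf_eq: "infsum T' (multi_indices I \<times> multi_indices I) = infsum T (multi_indices I \<times> multi_indices I)"
    unfolding T'T by (rule infsum_reindex_bij_betw[OF bij])
  have "infsum T (multi_indices I \<times> multi_indices I)
      = infsum (\<lambda>\<beta>. infsum (\<lambda>\<gamma>. T (\<beta>, \<gamma>)) (multi_indices I)) (multi_indices I)"
    by (rule infsum_Sigma_banach[symmetric]) (rule abs_summable_summable[OF ab])
  also have "\<dots> = ps I c (\<lambda>i. z i + h i)"
  proof -
    have "infsum (\<lambda>\<gamma>. T (\<beta>, \<gamma>)) (multi_indices I) = c \<beta> * mpow I (\<lambda>i. z i + h i) \<beta>" for \<beta>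
      unfolding T_def prod.case by (intro infsumI has_sum_cmult_right mpow_add_has_sum I)
    then show ?thesis by (simp add: ps_def)
  qed
  finally have hs: "(T' has_sum ps I c (\<lambda>i. z i + h i)) (multi_indices I \<times> multi_indices I)"
    using has_sum_infsum[OF abs_summable_summable[OF ab']] inf_eq by simp
  have *: "\<forall>\<gamma>\<in>multi_indices I. (\<lambda>\<beta>. norm (T' (\<gamma>, \<beta>))) summable_on multi_indices I"
    and **: "(\<lambda>\<gamma>. norm (infsum (\<lambda>\<beta>. norm (T' (\<gamma>, \<beta>))) (multi_indices I))) summable_on multi_indices I"
    using ab' unfolding Infinite_Sum.abs_summable_on_Sigma_iff by auto
  have inn: "infsum (\<lambda>\<beta>. T' (\<gamma>, \<beta>)) (multi_indices I) = recenter_coeff I c z \<gamma> * mpow I h \<gamma>" for \<gamma>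
    unfolding T'_def T_def prod.case recenter_coeff_mult recenter_coeff_def
    by (rule infsum_cmult_left')
  show "((\<lambda>\<gamma>. recenter_coeff I c z \<gamma> * mpow I h \<gamma>) has_sum ps I c (\<lambda>i. z i + h i)) (multi_indices I)"
  proof -
    have "((\<lambda>\<beta>. T' (\<gamma>, \<beta>)) has_sum recenter_coeff I c z \<gamma> * mpow I h \<gamma>) (multi_indices I)"
      if "\<gamma> \<in> multi_indices I" for \<gamma>
      using has_sum_infsum[OF abs_summable_summable[OF bspec[OF * that]]] by (simp only: inn)
    with hs show ?thesis by (rule has_sum_Sigma[OF isUCont_plus])
  qed
  show "(\<lambda>\<gamma>. norm (recenter_coeff I c z \<gamma>) * mpow I (\<lambda>i. norm (h i)) \<gamma>) summable_on (multi_indices I)"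
  proof (rule summable_on_le)
    show "(\<lambda>\<gamma>. infsum (\<lambda>\<beta>. norm (T' (\<gamma>, \<beta>))) (multi_indices I)) summable_on multi_indices I"
      by (rule summable_on_iff_abs_summable_on_real[THEN iffD2, OF **])
    fix \<gamma> assume g: "\<gamma> \<in> multi_indices I"
    have "norm (recenter_coeff I c z \<gamma>) * mpow I (\<lambda>i. norm (h i)) \<gamma> = norm (infsum (\<lambda>\<beta>. T' (\<gamma>, \<beta>)) (multi_indices I))"
      unfolding inn by (simp add: norm_mult norm_mpow)
    also have "\<dots> \<le> infsum (\<lambda>\<beta>. norm (T' (\<gamma>, \<beta>))) (multi_indices I)"
      using * g by (intro norm_infsum_bound) auto
    finally show "0 \<le> norm (recenter_coeff I c z \<gamma>) * mpow I (\<lambda>i. norm (h i)) \<gamma> \<and>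
       norm (recenter_coeff I c z \<gamma>) * mpow I (\<lambda>i. norm (h i)) \<gamma> \<le> infsum (\<lambda>\<beta>. norm (T' (\<gamma>, \<beta>))) (multi_indices I)"
      by (simp add: mpow_nonneg)
  qed
qed

text \<open>Taking for \<open>h i\<close> the real number \<open>\<rho> i - norm (z i)\<close> meets
  the hypothesis of \<open>recenter\<close> with equality, so the new polydisc reaches the boundary
  of the old one.\<close>

corollary ps_conv_recenter:
  assumes "finite I" "ps_conv I c \<rho>" "\<And>i. i \<in> I \<Longrightarrow> norm (z i) \<le> \<rho> i"
  shows "ps_conv I (recenter_coeff I c z) (\<lambda>i. \<rho> i - norm (z i))"
proof -
  have n: "norm (complex_of_real (\<rho> i - norm (z i))) = \<rho> i - norm (z i)" if "i \<in> I" for i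
    unfolding norm_of_real using assms(3)[OF that] by simp
  have "(\<lambda>\<gamma>. norm (recenter_coeff I c z \<gamma>) * mpow I (\<lambda>i. norm (complex_of_real (\<rho> i - norm (z i)))) \<gamma>)
          summable_on (multi_indices I)"
    by (rule recenter(2)[OF assms(1,2)]) (use n in force)
  then show ?thesis unfolding ps_conv_def using n by (simp cong: mpow_cong)
qed

corollary ps_recenter:
  assumes "finite I" "ps_conv I c \<rho>" "\<And>i. i \<in> I \<Longrightarrow> norm (z i) + norm (h i) \<le> \<rho> i"
  shows "ps I (recenter_coeff I c z) h = ps I c (\<lambda>i. z i + h i)"
  using recenter(1)[OF assms] by (simp add: ps_def infsumI)

lemma recenter_coeff_0: "recenter_coeff I c z (\<lambda>i\<in>I. 0) = ps I c z"
  by (simp add: recenter_coeff_def ps_def mpow_def)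

section \<open>Termwise differentiation\<close>

abbreviation unit_index :: "'v set \<Rightarrow> 'v \<Rightarrow> 'v \<Rightarrow> nat" where
  "unit_index I i \<equiv> (\<lambda>j\<in>I. if j = i then 1 else 0)"

lemma prod_unit_index:
  fixes z :: "'v \<Rightarrow> 'a::real_normed_field"
  assumes "finite I" "i \<in> I"
  shows "(\<Prod>j\<in>I. of_nat (\<beta> j choose unit_index I i j) * z j ^ (\<beta> j - unit_index I i j))
        = of_nat (\<beta> i) * mpow I z (\<beta>(i := \<beta> i - 1))"
proof -
  have "(\<Prod>j\<in>I. of_nat (\<beta> j choose unit_index I i j) * z j ^ (\<beta> j - unit_index I i j))
      = (of_nat (\<beta> i) * z i ^ (\<beta> i - 1)) * (\<Prod>j\<in>I - {i}. z j ^ \<beta> j)"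
    using assms by (subst prod.remove[where x = i]) auto
  moreover have "mpow I z (\<beta>(i := \<beta> i - 1)) = z i ^ (\<beta> i - 1) * (\<Prod>j\<in>I - {i}. z j ^ \<beta> j)"
    using assms unfolding mpow_def by (subst prod.remove[where x = i]) auto
  ultimately show ?thesis by simp
qed

lemma inj_on_Suc_index: "inj_on (\<lambda>\<beta>. \<beta>(i := Suc (\<beta> i))) (multi_indices I)"
  by (rule inj_on_inverseI[where g = "\<lambda>\<beta>. \<beta>(i := \<beta> i - 1)"]) auto

lemma Suc_index_image:
  assumes "i \<in> I"
  shows "(\<lambda>\<beta>. \<beta>(i := Suc (\<beta> i))) ` multi_indices I = {\<beta> \<in> multi_indices I. \<beta> i > 0}" (is "?l = ?r")
proof
  show "?l \<subseteq> ?r" using assms by (auto simp: PiE_iff extensional_def)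
  show "?r \<subseteq> ?l"
  proof
    fix \<beta> assume "\<beta> \<in> ?r"
    then show "\<beta> \<in> ?l" using assms
      by (intro image_eqI[of _ _ "\<beta>(i := \<beta> i - 1)"]) (auto simp: PiE_iff extensional_def)
  qed
qed

text \<open>The linear Taylor coefficients are first derivatives: indices with
  \<open>\<beta> i = 0\<close> drop out through the factor \<open>\<beta> i\<close>, and lowering
  \<open>\<beta> i\<close> by one in the others yields the formal derivative.\<close>

lemma recenter_coeff_unit:
  assumes "finite I" "i \<in> I"
  shows "recenter_coeff I c z (unit_index I i) = ps I (ps_deriv i c) z"
proof -
  have "recenter_coeff I c z (unit_index I i)
      = infsum (\<lambda>\<beta>. c \<beta> * (of_nat (\<beta> i) * mpow I z (\<beta>(i := \<beta> i - 1)))) (multi_indices I)"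
    unfolding recenter_coeff_def using prod_unit_index[OF assms, of _ z] by simp
  also have "\<dots> = infsum (\<lambda>\<beta>. c \<beta> * (of_nat (\<beta> i) * mpow I z (\<beta>(i := \<beta> i - 1))))
        ((\<lambda>\<beta>. \<beta>(i := Suc (\<beta> i))) ` multi_indices I)"
    unfolding Suc_index_image[OF assms(2)] by (rule infsum_cong_neutral) auto
  also have "\<dots> = ps I (ps_deriv i c) z"
    unfolding ps_def by (subst infsum_reindex[OF inj_on_Suc_index]) (simp add: o_def ps_deriv_def mult_ac)
  finally show ?thesis .
qed

text \<open>The coefficients of the derivative sit in the double series for z = \<rho>', h = \<rho>
  - \<rho>' as the terms whose \<open>\<gamma>\<close> is a unit index. A subfamily of an absolutely
  summable family is summable, and the common factor \<open>s = \<rho> i - \<rho>' i\<close> is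
  divided out; this is where the loss of radius must be strict.\<close>

lemma ps_conv_deriv:
  assumes I: "finite I" and c: "ps_conv I c \<rho>" and "i \<in> I" and r: "\<And>j. j \<in> I \<Longrightarrow> 0 \<le> \<rho>' j \<and> \<rho>' j < \<rho> j"
  shows "ps_conv I (ps_deriv i c) \<rho>'"
proof -
  define s where "s = \<rho> i - \<rho>' i"
  have s: "s > 0" using r[OF \<open>i \<in> I\<close>] by (simp add: s_def)
  let ?z = "\<lambda>j. complex_of_real (\<rho>' j)" and ?h = "\<lambda>j. complex_of_real (\<rho> j - \<rho>' j)"
  let ?T = "\<lambda>(\<beta>, \<gamma>). c \<beta> * (\<Prod>i\<in>I. of_nat (\<beta> i choose \<gamma> i) * ?z i ^ (\<beta> i - \<gamma> i) * ?h i ^ \<gamma> i)"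
  have ab: "(\<lambda>p. norm (?T p)) summable_on (multi_indices I \<times> multi_indices I)"
  proof (rule recenter_abs_summable[OF I c])
    show "cmod (?z j) + cmod (?h j) \<le> \<rho> j" if "j \<in> I" for j
      using r[OF that] by (simp flip: of_real_diff)
  qed
  have "(\<lambda>p. norm (?T p)) summable_on ((\<lambda>\<beta>. (\<beta>, unit_index I i)) ` {\<beta> \<in> multi_indices I. \<beta> i > 0})"
    by (rule summable_on_subset_banach[OF ab]) auto
  then have "(\<lambda>\<beta>. norm (?T (\<beta>, unit_index I i))) summable_on {\<beta> \<in> multi_indices I. \<beta> i > 0}"
    by (subst (asm) summable_on_reindex) (auto simp: o_def inj_on_def)
  then have "(\<lambda>\<beta>. norm (?T (\<beta>(i := Suc (\<beta> i)), unit_index I i))) summable_on multi_indices I"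
    unfolding Suc_index_image[OF \<open>i \<in> I\<close>, symmetric]
    by (subst (asm) summable_on_reindex[OF inj_on_Suc_index]) (auto simp: o_def)
  moreover have "norm (?T (\<beta>(i := Suc (\<beta> i)), unit_index I i)) = norm (ps_deriv i c \<beta>) * mpow I \<rho>' \<beta> * s" for \<beta>
  proof -
    have "mpow I ?h (unit_index I i) = (\<Prod>j\<in>I. if j = i then of_real s else 1)"
      unfolding mpow_def by (intro prod.cong) (auto simp: s_def)
    also have "\<dots> = of_real s" using I \<open>i \<in> I\<close> by simp
    finally have h: "mpow I ?h (unit_index I i) = of_real s" .
    have m: "norm (mpow I ?z \<beta>) = mpow I \<rho>' \<beta>"
      unfolding norm_mpow by (rule mpow_cong) (use r in auto)
    have u: "(\<beta>(i := Suc (\<beta> i)))(i := (\<beta>(i := Suc (\<beta> i))) i - 1) = \<beta>"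
      by auto
    show ?thesis
      unfolding prod.case recenter_coeff_mult h prod_unit_index[OF I \<open>i \<in> I\<close>]
      unfolding u norm_mult m using s by (simp add: ps_deriv_def norm_mult del: of_nat_Suc)
  qed
  ultimately have "(\<lambda>\<beta>. norm (ps_deriv i c \<beta>) * mpow I \<rho>' \<beta> * s) summable_on multi_indices I"
    by simp
  then show ?thesis using s by (simp add: ps_conv_def summable_on_cmult_left')
qed

lemma finite_lower_bound:
  fixes f :: "'v \<Rightarrow> real"
  assumes "finite I" "\<And>i. i \<in> I \<Longrightarrow> 0 < f i"
  shows "\<exists>s>0. \<forall>i\<in>I. s \<le> f i"
  using assms
proof (induction I rule: finite_induct)
  case empty
  show ?case by (intro exI[of _ 1]) auto
next
  case (insert i I)
  then obtain s where "s > 0" "\<forall>i\<in>I. s \<le> f i" by auto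
  then show ?case using insert.prems[of i] by (intro exI[of _ "min s (f i)"]) auto
qed

lemma finite_upper_bound:
  fixes f :: "'v \<Rightarrow> real"
  assumes "finite I"
  shows "\<exists>s>0. \<forall>i\<in>I. f i \<le> s"
proof -
  have "f i \<le> 1 + (\<Sum>i\<in>I. \<bar>f i\<bar>)" if "i \<in> I" for i
    using member_le_sum[OF that, of "\<lambda>i. \<bar>f i\<bar>"] assms by force
  moreover have "0 < 1 + (\<Sum>i\<in>I. \<bar>f i\<bar>)" by (simp add: add_pos_nonneg sum_nonneg)
  ultimately show ?thesis by blast
qed

lemma multi_index_degree_ge_2:
  assumes "finite I" "\<gamma> \<in> multi_indices I" "\<gamma> \<noteq> (\<lambda>i\<in>I. 0)" "\<And>i. i \<in> I \<Longrightarrow> \<gamma> \<noteq> unit_index I i"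
  shows "2 \<le> (\<Sum>i\<in>I. \<gamma> i)"
proof (rule ccontr)
  assume "\<not> ?thesis"
  then consider "(\<Sum>i\<in>I. \<gamma> i) = 0" | "(\<Sum>i\<in>I. \<gamma> i) = 1" by linarith
  then show False
  proof cases
    case 1
    then have "\<gamma> = (\<lambda>i\<in>I. 0)"
      using assms by (intro PiE_ext[of _ I "\<lambda>_. UNIV"]) auto
    with assms show False by simp
  next
    case 2
    then obtain i where "i \<in> I" "\<gamma> i = 1" "\<forall>j\<in>I. i \<noteq> j \<longrightarrow> \<gamma> j = 0"
      unfolding sum_eq_1_iff[OF assms(1)] by auto
    then have "\<gamma> = unit_index I i"
      using assms by (intro PiE_ext[of _ I "\<lambda>_. UNIV"]) auto
    with assms(4)[OF \<open>i \<in> I\<close>] show False by simp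
  qed
qed

text \<open>After recentring at \<open>z\<close>, the indices of degree 0 and 1 give exactly the
  affine part. All others have degree at least 2, so shrinking the radius from \<open>s\<close> to
  \<open>t\<close> gains the factor \<open>(t / s)\<^sup>2\<close>; \<open>K\<close> depends neither
  on \<open>h\<close> nor on \<open>t\<close>.\<close>

lemma ps_linear_approx:
  assumes I: "finite I" and c: "ps_conv I c \<rho>" and "s > 0" and s: "\<And>i. i \<in> I \<Longrightarrow> norm (z i) + s \<le> \<rho> i"
  shows "\<exists>K\<ge>0. \<forall>h t. 0 \<le> t \<and> t \<le> s \<and> (\<forall>i\<in>I. norm (h i) \<le> t) \<longrightarrow>
     norm (ps I c (\<lambda>i. z i + h i) - ps I c z - (\<Sum>i\<in>I. ps I (ps_deriv i c) z * h i)) \<le> K * t\<^sup>2"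
proof -
  let ?d = "recenter_coeff I c z"
  define M where "M = infsum (\<lambda>\<gamma>. norm (?d \<gamma>) * s ^ (\<Sum>i\<in>I. \<gamma> i)) (multi_indices I)"
  have "ps_conv I ?d (\<lambda>i. \<rho> i - norm (z i))"
    using \<open>s > 0\<close> by (intro ps_conv_recenter[OF I c]) (use s in force)
  then have "ps_conv I ?d (\<lambda>i. s)"
    by (rule ps_conv_mono) (use s \<open>s > 0\<close> in force)
  then have sumM: "(\<lambda>\<gamma>. norm (?d \<gamma>) * s ^ (\<Sum>i\<in>I. \<gamma> i)) summable_on multi_indices I"
    by (simp add: ps_conv_def mpow_const)
  have "M \<ge> 0" unfolding M_def using \<open>s > 0\<close> by (intro infsum_nonneg) auto
  define F where "F = insert (\<lambda>i\<in>I. 0) (unit_index I ` I)"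
  have F: "finite F" "F \<subseteq> multi_indices I" using I by (auto simp: F_def)
  have inj: "inj_on (unit_index I) I"
  proof (rule inj_onI)
    fix i j assume ij: "i \<in> I" "j \<in> I" "unit_index I i = unit_index I j"
    show "i = j" using fun_cong[OF ij(3), of i] ij(1,2) by (auto split: if_splits)
  qed
  have notin: "(\<lambda>i\<in>I. 0) \<notin> unit_index I ` I"
  proof
    assume "(\<lambda>i\<in>I. 0) \<in> unit_index I ` I"
    then obtain i where i: "i \<in> I" "(\<lambda>i\<in>I. 0 :: nat) = unit_index I i" by (rule imageE)
    show False using fun_cong[OF i(2), of i] i(1) by simp
  qed
  have bound: "norm (ps I c (\<lambda>i. z i + h i) - ps I c z - (\<Sum>i\<in>I. ps I (ps_deriv i c) z * h i)) \<le> M / s\<^sup>2 * t\<^sup>2"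
    if t: "0 \<le> t" "t \<le> s" and h: "\<forall>i\<in>I. norm (h i) \<le> t" for h t
  proof -
    have zh: "norm (z i) + norm (h i) \<le> \<rho> i" if "i \<in> I" for i
      using s[OF that] h t that by force
    note hs = recenter(1)[OF I c zh]
    have mu: "mpow I h (unit_index I i) = h i" if "i \<in> I" for i
    proof -
      have "mpow I h (unit_index I i) = (\<Prod>j\<in>I. if j = i then h j else 1)"
        unfolding mpow_def by (intro prod.cong) auto
      then show ?thesis using I that by simp
    qed
    have "sum (\<lambda>\<gamma>. ?d \<gamma> * mpow I h \<gamma>) F = ps I c z + (\<Sum>i\<in>I. ?d (unit_index I i) * mpow I h (unit_index I i))"
      unfolding F_def using I notin
      by (subst sum.insert) (auto simp: sum.reindex[OF inj] recenter_coeff_0 mpow_def)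
    also have "(\<Sum>i\<in>I. ?d (unit_index I i) * mpow I h (unit_index I i)) = (\<Sum>i\<in>I. ps I (ps_deriv i c) z * h i)"
      by (intro sum.cong refl) (simp only: mu recenter_coeff_unit[OF I])
    finally have "((\<lambda>\<gamma>. ?d \<gamma> * mpow I h \<gamma>) has_sum
         (ps I c (\<lambda>i. z i + h i) - (ps I c z + (\<Sum>i\<in>I. ps I (ps_deriv i c) z * h i)))) (multi_indices I - F)"
      using has_sum_Diff[OF hs has_sum_finite[OF F(1)] F(2)] by simp
    moreover have "norm (?d \<gamma> * mpow I h \<gamma>) \<le> norm (?d \<gamma>) * s ^ (\<Sum>i\<in>I. \<gamma> i) * (t/s)\<^sup>2" if "\<gamma> \<in> multi_indices I - F" for \<gamma>
    proof -
      have deg: "2 \<le> (\<Sum>i\<in>I. \<gamma> i)"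
        using that by (intro multi_index_degree_ge_2 I) (auto simp: F_def)
      have "norm (mpow I h \<gamma>) \<le> mpow I (\<lambda>_. t) \<gamma>"
        unfolding norm_mpow by (intro mpow_mono) (use h in auto)
      also have "\<dots> = s ^ (\<Sum>i\<in>I. \<gamma> i) * (t/s) ^ (\<Sum>i\<in>I. \<gamma> i)"
        using \<open>s > 0\<close> by (simp add: mpow_const power_divide)
      also have "\<dots> \<le> s ^ (\<Sum>i\<in>I. \<gamma> i) * (t/s)\<^sup>2"
        using t \<open>s > 0\<close> deg by (intro mult_left_mono power_decreasing) auto
      finally show ?thesis by (simp add: norm_mult mult.assoc mult_left_mono)
    qed
    ultimately have "norm (ps I c (\<lambda>i. z i + h i) - (ps I c z + (\<Sum>i\<in>I. ps I (ps_deriv i c) z * h i)))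
        \<le> infsum (\<lambda>\<gamma>. norm (?d \<gamma>) * s ^ (\<Sum>i\<in>I. \<gamma> i) * (t/s)\<^sup>2) (multi_indices I - F)"
    proof -
      assume hs': "((\<lambda>\<gamma>. ?d \<gamma> * mpow I h \<gamma>) has_sum
         (ps I c (\<lambda>i. z i + h i) - (ps I c z + (\<Sum>i\<in>I. ps I (ps_deriv i c) z * h i)))) (multi_indices I - F)"
        and le: "\<And>\<gamma>. \<gamma> \<in> multi_indices I - F \<Longrightarrow> norm (?d \<gamma> * mpow I h \<gamma>) \<le> norm (?d \<gamma>) * s ^ (\<Sum>i\<in>I. \<gamma> i) * (t/s)\<^sup>2"
      have s1: "(\<lambda>\<gamma>. norm (?d \<gamma>) * s ^ (\<Sum>i\<in>I. \<gamma> i) * (t/s)\<^sup>2) summable_on (multi_indices I - F)"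
        by (intro summable_on_cmult_left summable_on_subset_banach[OF sumM]) auto
      have s2: "(\<lambda>\<gamma>. norm (?d \<gamma> * mpow I h \<gamma>)) summable_on (multi_indices I - F)"
        by (rule summable_on_le[OF s1]) (use le in auto)
      have "norm (ps I c (\<lambda>i. z i + h i) - (ps I c z + (\<Sum>i\<in>I. ps I (ps_deriv i c) z * h i)))
          \<le> infsum (\<lambda>\<gamma>. norm (?d \<gamma> * mpow I h \<gamma>)) (multi_indices I - F)"
        by (rule norm_has_sum_bound[OF has_sum_infsum[OF s2] hs'])
      also have "\<dots> \<le> infsum (\<lambda>\<gamma>. norm (?d \<gamma>) * s ^ (\<Sum>i\<in>I. \<gamma> i) * (t/s)\<^sup>2) (multi_indices I - F)"
        by (rule infsum_mono[OF s2 s1 le])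
      finally show ?thesis .
    qed
    also have "\<dots> = infsum (\<lambda>\<gamma>. norm (?d \<gamma>) * s ^ (\<Sum>i\<in>I. \<gamma> i)) (multi_indices I - F) * (t/s)\<^sup>2"
      by (rule infsum_cmult_left')
    also have "\<dots> \<le> M * (t/s)\<^sup>2"
      unfolding M_def using \<open>s > 0\<close>
      by (intro mult_right_mono infsum_mono2 sumM summable_on_subset_banach[OF sumM]) auto
    finally show ?thesis by (simp add: power_divide diff_diff_add)
  qed
  show ?thesis
    by (rule exI[of _ "M / s\<^sup>2"]) (use bound \<open>M \<ge> 0\<close> in auto)
qed

lemma has_derivative_local_bound:
  fixes f :: "'a::real_normed_vector \<Rightarrow> 'b::real_normed_vector"
  assumes "(f has_derivative f') (at x)"
  shows "\<exists>C>0. \<exists>d>0. \<forall>y. norm (y - x) < d \<longrightarrow> norm (f y - f x) \<le> C * norm (y - x)"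
proof -
  from assms have bl: "bounded_linear f'"
    and "\<forall>e>0. \<exists>d>0. \<forall>y. norm (y - x) < d \<longrightarrow> norm (f y - f x - f' (y - x)) \<le> e * norm (y - x)"
    unfolding has_derivative_at_alt by auto
  then obtain d where d: "d > 0" "\<And>y. norm (y - x) < d \<Longrightarrow> norm (f y - f x - f' (y - x)) \<le> 1 * norm (y - x)"
    by (metis zero_less_one)
  obtain K where K: "K > 0" "\<And>v. norm (f' v) \<le> norm v * K"
    using bounded_linear.pos_bounded[OF bl] by auto
  have "norm (f y - f x) \<le> (1 + K) * norm (y - x)" if "norm (y - x) < d" for y
  proof -
    have "norm (f y - f x) \<le> norm (f y - f x - f' (y - x)) + norm (f' (y - x))"
      by (metis diff_add_cancel norm_triangle_ineq)
    also have "\<dots> \<le> 1 * norm (y - x) + norm (y - x) * K"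
      using d(2)[OF that] K(2) by (intro add_mono) auto
    finally show ?thesis by (simp add: algebra_simps)
  qed
  then show ?thesis using d(1) K(1) by (intro exI[of _ "1 + K"] conjI exI[of _ d]) auto
qed

text \<open>Chain rule: differentiable inner functions are Lipschitz at \<open>x0\<close>, so the
  remainder of \<open>ps_linear_approx\<close> is quadratic in the distance to \<open>x0\<close>.
  The inner functions are general because the rule serves both coordinates and jets inserted into
  \<open>G\<close>.\<close>

theorem ps_has_derivative:
  fixes z :: "'a::real_normed_vector \<Rightarrow> 'v \<Rightarrow> complex"
  assumes I: "finite I" and c: "ps_conv I c \<rho>" and lt: "\<And>i. i \<in> I \<Longrightarrow> norm (z x0 i) < \<rho> i"
    and z': "\<And>i. i \<in> I \<Longrightarrow> ((\<lambda>x. z x i) has_derivative z' i) (at x0)"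
  shows "((\<lambda>x. ps I c (z x)) has_derivative (\<lambda>v. \<Sum>i\<in>I. ps I (ps_deriv i c) (z x0) * z' i v)) (at x0)"
proof -
  obtain s where s: "s > 0" "\<forall>i\<in>I. s \<le> \<rho> i - norm (z x0 i)"
    using finite_lower_bound[OF I, of "\<lambda>i. \<rho> i - norm (z x0 i)"] lt by auto
  have "\<And>i. i \<in> I \<Longrightarrow> norm (z x0 i) + s \<le> \<rho> i" using s by force
  from ps_linear_approx[OF I c s(1) this] obtain K where K: "K \<ge> 0" and
    K2: "\<And>h t. 0 \<le> t \<Longrightarrow> t \<le> s \<Longrightarrow> \<forall>i\<in>I. norm (h i) \<le> t \<Longrightarrow>
     norm (ps I c (\<lambda>i. z x0 i + h i) - ps I c (z x0) - (\<Sum>i\<in>I. ps I (ps_deriv i c) (z x0) * h i)) \<le> K * t\<^sup>2"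
    by blast
  let ?P = "\<lambda>i C d. C > 0 \<and> d > 0 \<and> (\<forall>y. norm (y - x0) < d \<longrightarrow> norm (z y i - z x0 i) \<le> C * norm (y - x0))"
  have "\<forall>i\<in>I. \<exists>C. \<exists>d. ?P i C d"
    using has_derivative_local_bound[OF z'] by blast
  then obtain Cf where "\<forall>i\<in>I. \<exists>d. ?P i (Cf i) d" by (rule bchoice[THEN exE])
  then obtain df where "\<forall>i\<in>I. ?P i (Cf i) (df i)" by (rule bchoice[THEN exE])
  then have Cd: "Cf i > 0" "df i > 0" "norm (y - x0) < df i \<Longrightarrow> norm (z y i - z x0 i) \<le> Cf i * norm (y - x0)"
    if "i \<in> I" for i y using that by auto
  obtain C where C: "C > 0" "\<forall>i\<in>I. Cf i \<le> C" using finite_upper_bound[OF I] by blast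
  obtain d where d: "d > 0" "\<forall>i\<in>I. d \<le> df i" using finite_lower_bound[OF I, of df] Cd by blast
  have lip: "norm (z y i - z x0 i) \<le> C * norm (y - x0)" if "i \<in> I" "norm (y - x0) < d" for i y
  proof -
    have "norm (z y i - z x0 i) \<le> Cf i * norm (y - x0)"
      using d that by (intro Cd) force+
    also have "\<dots> \<le> C * norm (y - x0)" using C that by (intro mult_right_mono) auto
    finally show ?thesis .
  qed
  define R where "R = (\<lambda>x. ps I c (z x) - ps I c (z x0) - (\<Sum>i\<in>I. ps I (ps_deriv i c) (z x0) * (z x i - z x0 i)))"
  have Rb: "norm (R y) \<le> (K * C\<^sup>2) * (norm (y - x0))\<^sup>2" if "norm (y - x0) < d" "norm (y - x0) \<le> s / C" for y
  proof -
    have "norm (ps I c (\<lambda>i. z x0 i + (z y i - z x0 i)) - ps I c (z x0) -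
       (\<Sum>i\<in>I. ps I (ps_deriv i c) (z x0) * (z y i - z x0 i))) \<le> K * (C * norm (y - x0))\<^sup>2"
    proof (rule K2)
      show "C * norm (y - x0) \<le> s" using that(2) C(1) by (simp add: field_simps)
    qed (use lip that C(1) in auto)
    then show ?thesis by (simp add: R_def power_mult_distrib mult.assoc)
  qed
  have "(R has_derivative (\<lambda>v. 0)) (at x0)"
    unfolding has_derivative_at_alt
  proof (intro conjI allI impI)
    fix e :: real assume "e > 0"
    \<comment> \<open>The three bounds keep \<open>y\<close> in the Lipschitz neighbourhood, keep
      the increments within \<open>s\<close>, and make the quadratic bound at most \<open>e\<close>
      times the distance. Adding 1 keeps the denominator positive when \<open>K = 0\<close>.\<close>
    define d' where "d' = min d (min (s / C) (e / (K * C\<^sup>2 + 1)))"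
    have K1: "K * C\<^sup>2 + 1 > 0" using K by (simp add: add_nonneg_pos)
    have "d' > 0" using d s C \<open>e > 0\<close> K1 by (simp add: d'_def)
    moreover have "norm (R y - R x0 - 0) \<le> e * norm (y - x0)" if "norm (y - x0) < d'" for y
    proof -
      have "norm (R y) \<le> (K * C\<^sup>2) * (norm (y - x0))\<^sup>2" using that by (intro Rb) (auto simp: d'_def)
      also have "\<dots> \<le> (K * C\<^sup>2 + 1) * (norm (y - x0) * norm (y - x0))"
        unfolding power2_eq_square[of "norm (y - x0)"] by (intro mult_right_mono) auto
      also have "\<dots> \<le> (K * C\<^sup>2 + 1) * ((e / (K * C\<^sup>2 + 1)) * norm (y - x0))"
        using that K1 by (intro mult_left_mono mult_right_mono) (auto simp: d'_def)
      also have "\<dots> = e * norm (y - x0)" using K1 by simp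
      finally show ?thesis by (simp add: R_def)
    qed
    ultimately show "\<exists>d>0. \<forall>y. norm (y - x0) < d \<longrightarrow> norm (R y - R x0 - 0) \<le> e * norm (y - x0)"
      by blast
  qed simp
  then have "((\<lambda>x. R x + ps I c (z x0) + (\<Sum>i\<in>I. ps I (ps_deriv i c) (z x0) * (z x i - z x0 i)))
     has_derivative (\<lambda>v. 0 + 0 + (\<Sum>i\<in>I. ps I (ps_deriv i c) (z x0) * (z' i v - 0)))) (at x0)"
    by (intro has_derivative_add has_derivative_sum has_derivative_mult_right has_derivative_diff
        has_derivative_const z')
  then show ?thesis by (simp add: R_def)
qed

section \<open>Convergence on open polydiscs\<close>

text \<open>Differentiation costs an arbitrarily small part of the radius, so \<open>ps_conv\<close>
  need not persist at the same \<open>\<rho>\<close>. Convergence at all smaller polyradii is a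
  condition stable under \<open>ps_deriv\<close>.\<close>

definition ps_conv_in :: "'v set \<Rightarrow> (('v \<Rightarrow> nat) \<Rightarrow> complex) \<Rightarrow> ('v \<Rightarrow> real) \<Rightarrow> bool" where
  "ps_conv_in I c \<rho> \<longleftrightarrow> (\<forall>\<rho>'. (\<forall>i\<in>I. 0 \<le> \<rho>' i \<and> \<rho>' i < \<rho> i) \<longrightarrow> ps_conv I c \<rho>')"

lemma ps_conv_imp_in: "ps_conv I c \<rho> \<Longrightarrow> ps_conv_in I c \<rho>"
  unfolding ps_conv_in_def by (intro allI impI, erule ps_conv_mono) force

lemma ps_conv_inD:
  "ps_conv_in I c \<rho> \<Longrightarrow> (\<And>i. i \<in> I \<Longrightarrow> 0 \<le> \<rho>' i \<and> \<rho>' i < \<rho> i) \<Longrightarrow> ps_conv I c \<rho>'"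
  by (simp add: ps_conv_in_def)

lemma ps_conv_in_mid:
  assumes "ps_conv_in I c \<rho>" "\<And>i. i \<in> I \<Longrightarrow> 0 \<le> \<rho>' i \<and> \<rho>' i < \<rho> i"
  obtains \<rho>'' where "ps_conv I c \<rho>''" "\<And>i. i \<in> I \<Longrightarrow> \<rho>' i < \<rho>'' i"
proof (rule that[of "\<lambda>i. (\<rho>' i + \<rho> i) / 2"])
  have "\<forall>i\<in>I. 0 \<le> (\<rho>' i + \<rho> i) / 2 \<and> (\<rho>' i + \<rho> i) / 2 < \<rho> i"
  proof
    fix i assume "i \<in> I"
    then show "0 \<le> (\<rho>' i + \<rho> i) / 2 \<and> (\<rho>' i + \<rho> i) / 2 < \<rho> i" using assms(2)[of i] by simp
  qed
  then show "ps_conv I c (\<lambda>i. (\<rho>' i + \<rho> i) / 2)" by (intro ps_conv_inD[OF assms(1)]) simp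
  show "\<rho>' i < (\<rho>' i + \<rho> i) / 2" if "i \<in> I" for i using assms(2)[OF that] by simp
qed

lemma ps_conv_in_deriv:
  assumes "finite I" "i \<in> I" "ps_conv_in I c \<rho>"
  shows "ps_conv_in I (ps_deriv i c) \<rho>"
  unfolding ps_conv_in_def
proof (intro allI impI)
  fix \<rho>' assume *: "\<forall>i\<in>I. 0 \<le> \<rho>' i \<and> \<rho>' i < \<rho> i"
  then obtain \<rho>'' where r: "ps_conv I c \<rho>''" "\<And>i. i \<in> I \<Longrightarrow> \<rho>' i < \<rho>'' i"
    using ps_conv_in_mid[OF assms(3), of \<rho>'] by blast
  show "ps_conv I (ps_deriv i c) \<rho>'"
    by (rule ps_conv_deriv[OF assms(1) r(1) assms(2)]) (use * r(2) in auto)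
qed

lemma ps_conv_in_mono:
  assumes "ps_conv_in I c \<rho>" "\<And>i. i \<in> I \<Longrightarrow> \<rho>' i \<le> \<rho> i"
  shows "ps_conv_in I c \<rho>'"
  unfolding ps_conv_in_def
proof (intro allI impI)
  fix r assume "\<forall>i\<in>I. 0 \<le> r i \<and> r i < \<rho>' i"
  then have "\<forall>i\<in>I. 0 \<le> r i \<and> r i < \<rho> i" using assms(2) by force
  then show "ps_conv I c r" by (intro ps_conv_inD[OF assms(1)]) simp
qed

lemma ps_has_derivative_in:
  fixes z :: "'a::real_normed_vector \<Rightarrow> 'v \<Rightarrow> complex"
  assumes "finite I" "ps_conv_in I c \<rho>" and lt: "\<And>i. i \<in> I \<Longrightarrow> norm (z x0 i) < \<rho> i"
    and "\<And>i. i \<in> I \<Longrightarrow> ((\<lambda>x. z x i) has_derivative z' i) (at x0)"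
  shows "((\<lambda>x. ps I c (z x)) has_derivative (\<lambda>v. \<Sum>i\<in>I. ps I (ps_deriv i c) (z x0) * z' i v)) (at x0)"
proof -
  obtain \<rho>'' where "ps_conv I c \<rho>''" "\<And>i. i \<in> I \<Longrightarrow> norm (z x0 i) < \<rho>'' i"
    using ps_conv_in_mid[OF assms(2), of "\<lambda>i. norm (z x0 i)"] lt by auto
  then show ?thesis by (intro ps_has_derivative assms(1,4))
qed

section \<open>Iterated partial derivatives and smooth functions\<close>

lemma partial_deriv_has_derivative:
  assumes "(f has_derivative f') (at x)"
  shows "partial_deriv i f x = f' (axis i 1)"
proof -
  have "((\<lambda>h. x + h *\<^sub>R axis i 1) has_derivative (\<lambda>h. h *\<^sub>R axis i (1::real))) (at 0)"
    by (auto intro!: derivative_eq_intros)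
  moreover have "(f has_derivative f') (at (x + 0 *\<^sub>R axis i 1))" using assms by simp
  ultimately have "((\<lambda>h. f (x + h *\<^sub>R axis i 1)) has_derivative (\<lambda>h. f' (h *\<^sub>R axis i 1))) (at 0)"
    by (rule has_derivative_compose)
  then have "((\<lambda>h. f (x + h *\<^sub>R axis i 1)) has_derivative (\<lambda>h. h *\<^sub>R f' (axis i 1))) (at 0)"
    using linear_cmul[OF has_derivative_linear[OF assms]] by simp
  then show ?thesis
    unfolding partial_deriv_def by (intro vector_derivative_at) (simp add: has_vector_derivative_def)
qed

lemma partial_deriv_cong:
  assumes "open Y" "x \<in> Y" "\<And>y. y \<in> Y \<Longrightarrow> f y = g y"
  shows "partial_deriv i f x = partial_deriv i g x"
proof -
  have "((\<lambda>h::real. x + h *\<^sub>R axis i 1) \<longlongrightarrow> x + 0 *\<^sub>R axis i 1) (nhds 0)"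
    by (intro tendsto_intros filterlim_ident)
  then have "\<forall>\<^sub>F h in nhds (0::real). x + h *\<^sub>R axis i 1 \<in> Y"
    using assms by (intro topological_tendstoD) auto
  then have "\<forall>\<^sub>F h in nhds (0::real). h \<in> UNIV \<longrightarrow> f (x + h *\<^sub>R axis i 1) = g (x + h *\<^sub>R axis i 1)"
    by eventually_elim (use assms in auto)
  then show ?thesis
    unfolding partial_deriv_def by (intro vector_derivative_cong_eq) auto
qed

lemma foldr_partial_deriv_cong:
  assumes "open Y" "x \<in> Y" "\<And>y. y \<in> Y \<Longrightarrow> f y = g y"
  shows "foldr partial_deriv js f x = foldr partial_deriv js g x"
  using assms(2)
proof (induction js arbitrary: x)
  case Nil
  then show ?case using assms by simp
next
  case (Cons j js)
  show ?case by (simp, rule partial_deriv_cong[OF assms(1) Cons.prems Cons.IH])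
qed

text \<open>Unfolds a multi-index into one list of directions, so that facts about
  \<open>foldr partial_deriv\<close> apply to \<open>multi_deriv\<close> and to powers of a single
  \<open>partial_deriv\<close> alike.\<close>

definition deriv_list :: "('n::finite \<Rightarrow> nat) \<Rightarrow> 'n list" where
  "deriv_list \<alpha> = concat (map (\<lambda>i. replicate (\<alpha> i) i) (SOME js. distinct js \<and> set js = UNIV))"

lemma foldr_replicate: "foldr f (replicate n i) = (f i ^^ n)"
  by (induction n) (simp_all add: fun_eq_iff)

lemma multi_deriv_eq_foldr: "multi_deriv \<alpha> f = foldr partial_deriv (deriv_list \<alpha>) f"
proof -
  have "foldr (\<lambda>i. partial_deriv i ^^ \<alpha> i) js f = foldr partial_deriv (concat (map (\<lambda>i. replicate (\<alpha> i) i) js)) f" for js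
    by (induction js) (simp_all add: foldr_replicate)
  then show ?thesis by (simp add: multi_deriv_def deriv_list_def)
qed

lemma count_deriv_list:
  fixes \<alpha> :: "'n::finite \<Rightarrow> nat"
  shows "count_list (deriv_list \<alpha>) i = \<alpha> i"
proof -
  have r: "count_list (replicate n a) i = (if a = i then n else 0)" for n and a :: 'n
    by (induction n) auto
  have *: "distinct js \<Longrightarrow> count_list (concat (map (\<lambda>i. replicate (\<alpha> i) i) js)) i = (if i \<in> set js then \<alpha> i else 0)" for js
    by (induction js) (auto simp: r)
  have "\<exists>js. distinct js \<and> set js = (UNIV :: 'n set)" using finite_distinct_list[OF finite[of "UNIV :: 'n set"]] by blast
  then have "distinct (SOME js. distinct js \<and> set js = (UNIV :: 'n set)) \<and> set (SOME js. distinct js \<and> set js = (UNIV :: 'n set)) = UNIV"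
    by (rule someI_ex)
  then show ?thesis using * by (simp add: deriv_list_def)
qed

lemma funpow_partial_deriv: "(partial_deriv k ^^ m) f = foldr partial_deriv (replicate m k) f"
  by (simp add: foldr_replicate)

lemma multi_deriv_cong:
  assumes "open Y" "x \<in> Y" "\<And>y. y \<in> Y \<Longrightarrow> f y = g y"
  shows "multi_deriv \<alpha> f x = multi_deriv \<alpha> g x"
  unfolding multi_deriv_eq_foldr by (rule foldr_partial_deriv_cong[OF assms])

lemma multi_deriv_0: "multi_deriv (\<lambda>_. 0) f = f"
proof -
  have "foldr (\<lambda>i. partial_deriv i ^^ 0) js f = f" for js :: "'a list" by (induction js) auto
  then show ?thesis by (simp add: multi_deriv_def)
qed

section \<open>Smoothness of finite order and its closure properties\<close>

text \<open>Derivatives up to order \<open>N\<close> are still differentiable, so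
  \<open>N = 0\<close> already means differentiable. The grading allows induction over the order, in
  which a first derivative counts one less.\<close>

definition smooth_upto :: "nat \<Rightarrow> (real ^ 'n::finite) set \<Rightarrow> (real ^ 'n \<Rightarrow> complex) \<Rightarrow> bool" where
  "smooth_upto N Y f \<longleftrightarrow> (\<forall>js. length js \<le> N \<longrightarrow> foldr partial_deriv js f differentiable_on Y)"

definition smooth_on :: "(real ^ 'n::finite) set \<Rightarrow> (real ^ 'n \<Rightarrow> complex) \<Rightarrow> bool" where
  "smooth_on Y f \<longleftrightarrow> (\<forall>js. foldr partial_deriv js f differentiable_on Y)"

lemma smooth_functions_iff: "f \<in> smooth_functions Y \<longleftrightarrow> f \<in> extensional Y \<and> smooth_on Y f"
  by (simp add: smooth_functions_def smooth_on_def)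

lemma smooth_on_iff_upto: "smooth_on Y f \<longleftrightarrow> (\<forall>N. smooth_upto N Y f)"
  by (auto simp: smooth_on_def smooth_upto_def)

lemma smooth_on_imp_upto: "smooth_on Y f \<Longrightarrow> smooth_upto N Y f"
  by (auto simp: smooth_on_iff_upto)

lemma smooth_upto_mono: "smooth_upto N Y f \<Longrightarrow> M \<le> N \<Longrightarrow> smooth_upto M Y f"
  by (auto simp: smooth_upto_def)

lemma smooth_upto_differentiable: "smooth_upto N Y f \<Longrightarrow> f differentiable_on Y"
  unfolding smooth_upto_def by (metis foldr_Nil id_apply le0 list.size(3))

lemma smooth_on_differentiable: "smooth_on Y f \<Longrightarrow> f differentiable_on Y"
  by (rule smooth_upto_differentiable[OF smooth_on_imp_upto])

lemma smooth_upto_partial: "smooth_upto (Suc N) Y f \<Longrightarrow> smooth_upto N Y (partial_deriv i f)"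
  unfolding smooth_upto_def
proof (intro allI impI)
  fix js :: "'a list"
  assume *: "\<forall>js. length js \<le> Suc N \<longrightarrow> foldr partial_deriv js f differentiable_on Y" "length js \<le> N"
  from *(1)[rule_format, of "js @ [i]"] *(2)
  show "foldr partial_deriv js (partial_deriv i f) differentiable_on Y" by simp
qed

lemma smooth_on_foldr: "smooth_on Y f \<Longrightarrow> smooth_on Y (foldr partial_deriv js f)"
  unfolding smooth_on_def by (metis foldr_append)

lemma smooth_on_partial: "smooth_on Y f \<Longrightarrow> smooth_on Y (partial_deriv i f)"
  using smooth_on_foldr[of Y f "[i]"] by simp

lemma differentiable_on_cong:
  assumes "f differentiable_on Y" "\<And>y. y \<in> Y \<Longrightarrow> f y = g y"
  shows "g differentiable_on Y"
  unfolding differentiable_on_def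
proof
  fix x assume "x \<in> Y"
  with assms(1) obtain f' where "(f has_derivative f') (at x within Y)"
    unfolding differentiable_on_def differentiable_def by blast
  then have "(g has_derivative f') (at x within Y)"
    by (rule has_derivative_transform_within[where d = 1]) (use assms \<open>x \<in> Y\<close> in auto)
  then show "g differentiable (at x within Y)" unfolding differentiable_def by blast
qed

lemma smooth_upto_cong:
  assumes "open Y" "\<And>y. y \<in> Y \<Longrightarrow> f y = g y" "smooth_upto N Y f"
  shows "smooth_upto N Y g"
  unfolding smooth_upto_def
proof (intro allI impI)
  fix js :: "'a list" assume "length js \<le> N"
  then have "foldr partial_deriv js f differentiable_on Y" using assms(3) by (auto simp: smooth_upto_def)
  then show "foldr partial_deriv js g differentiable_on Y"
    by (rule differentiable_on_cong) (rule foldr_partial_deriv_cong[OF assms(1)], use assms(2) in auto)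
qed

lemma smooth_on_cong:
  assumes "open Y" "\<And>y. y \<in> Y \<Longrightarrow> f y = g y" "smooth_on Y f"
  shows "smooth_on Y g"
  using assms smooth_upto_cong unfolding smooth_on_iff_upto by blast

lemma smooth_upto_0:
  assumes "\<And>x. x \<in> Y \<Longrightarrow> (f has_derivative f' x) (at x)"
  shows "smooth_upto 0 Y f"
  using assms by (auto simp: smooth_upto_def differentiable_on_def differentiable_def intro: has_derivative_at_withinI)

text \<open>Lists of directions act from the right, so the last entry is the first derivative taken.
  Splitting it off reduces the claim to the partial derivatives, read off from the total derivative
  along the axes.\<close>

lemma smooth_upto_SucI:
  assumes Y: "open Y" and f': "\<And>x. x \<in> Y \<Longrightarrow> (f has_derivative f' x) (at x)"
    and "\<And>i. smooth_upto N Y (\<lambda>x. f' x (axis i 1))"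
  shows "smooth_upto (Suc N) Y f"
  unfolding smooth_upto_def
proof (intro allI impI)
  fix js :: "'a list" assume js: "length js \<le> Suc N"
  show "foldr partial_deriv js f differentiable_on Y"
  proof (cases js rule: rev_cases)
    case Nil
    then show ?thesis using smooth_upto_differentiable[OF smooth_upto_0[of Y f f']] f' by simp
  next
    case (snoc js' i)
    have "smooth_upto N Y (partial_deriv i f)"
      by (rule smooth_upto_cong[OF Y _ assms(3)[of i]]) (simp add: partial_deriv_has_derivative[OF f'])
    then show ?thesis using js snoc by (simp add: smooth_upto_def)
  qed
qed

lemma smooth_upto_has_derivative:
  assumes "open Y" "smooth_upto N Y f" "x \<in> Y"
  obtains f' where "(f has_derivative f') (at x)" "\<And>i. partial_deriv i f x = f' (axis i 1)"
proof -
  have "f differentiable (at x)"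
    using smooth_upto_differentiable[OF assms(2)] assms by (simp add: differentiable_on_eq_differentiable_at)
  then obtain f' where "(f has_derivative f') (at x)" unfolding differentiable_def by blast
  then show ?thesis using partial_deriv_has_derivative that by blast
qed

lemma smooth_upto_choose_derivative:
  assumes "open Y" "smooth_upto N Y f"
  obtains f' where "\<And>x. x \<in> Y \<Longrightarrow> (f has_derivative f' x) (at x)"
    "\<And>x i. x \<in> Y \<Longrightarrow> partial_deriv i f x = f' x (axis i 1)"
proof -
  have "\<forall>x\<in>Y. \<exists>f'. (f has_derivative f') (at x) \<and> (\<forall>i. partial_deriv i f x = f' (axis i 1))"
    using smooth_upto_has_derivative[OF assms] by metis
  then obtain f' where "\<forall>x\<in>Y. (f has_derivative f' x) (at x) \<and> (\<forall>i. partial_deriv i f x = f' x (axis i 1))"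
    by (rule bchoice[THEN exE])
  then show ?thesis using that by blast
qed

lemma smooth_upto_const: "open Y \<Longrightarrow> smooth_upto N Y (\<lambda>_. c)"
proof (induction N arbitrary: c)
  case 0
  show ?case by (rule smooth_upto_0[where f' = "\<lambda>_ _. 0"]) auto
next
  case (Suc N)
  show ?case by (rule smooth_upto_SucI[where f' = "\<lambda>_ _. 0"]) (use Suc in auto)
qed

lemma smooth_upto_add:
  assumes "open Y"
  shows "smooth_upto N Y f \<Longrightarrow> smooth_upto N Y g \<Longrightarrow> smooth_upto N Y (\<lambda>x. f x + g x)"
proof (induction N arbitrary: f g)
  case (0 f g)
  obtain f' where f': "\<And>x. x \<in> Y \<Longrightarrow> (f has_derivative f' x) (at x)"
    using smooth_upto_choose_derivative[OF assms 0(1)] by metis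
  obtain g' where g': "\<And>x. x \<in> Y \<Longrightarrow> (g has_derivative g' x) (at x)"
    using smooth_upto_choose_derivative[OF assms 0(2)] by metis
  show ?case by (rule smooth_upto_0[where f' = "\<lambda>x v. f' x v + g' x v"]) (intro has_derivative_add f' g')
next
  case (Suc N f g)
  obtain f' where f': "\<And>x. x \<in> Y \<Longrightarrow> (f has_derivative f' x) (at x)" "\<And>x i. x \<in> Y \<Longrightarrow> partial_deriv i f x = f' x (axis i 1)"
    using smooth_upto_choose_derivative[OF assms Suc.prems(1)] by metis
  obtain g' where g': "\<And>x. x \<in> Y \<Longrightarrow> (g has_derivative g' x) (at x)" "\<And>x i. x \<in> Y \<Longrightarrow> partial_deriv i g x = g' x (axis i 1)"
    using smooth_upto_choose_derivative[OF assms Suc.prems(2)] by metis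
  show ?case
  proof (rule smooth_upto_SucI[OF assms, where f' = "\<lambda>x v. f' x v + g' x v"])
    show "smooth_upto N Y (\<lambda>x. f' x (axis i 1) + g' x (axis i 1))" for i
      by (rule smooth_upto_cong[OF assms _ Suc.IH[OF smooth_upto_partial[OF Suc.prems(1), of i] smooth_upto_partial[OF Suc.prems(2), of i]]])
        (use f' g' Suc.prems in auto)
  qed (intro has_derivative_add f' g')
qed

lemma smooth_upto_mult:
  assumes "open Y"
  shows "smooth_upto N Y f \<Longrightarrow> smooth_upto N Y g \<Longrightarrow> smooth_upto N Y (\<lambda>x. f x * g x)"
proof (induction N arbitrary: f g)
  case (0 f g)
  obtain f' where f': "\<And>x. x \<in> Y \<Longrightarrow> (f has_derivative f' x) (at x)"
    using smooth_upto_choose_derivative[OF assms 0(1)] by metis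
  obtain g' where g': "\<And>x. x \<in> Y \<Longrightarrow> (g has_derivative g' x) (at x)"
    using smooth_upto_choose_derivative[OF assms 0(2)] by metis
  show ?case by (rule smooth_upto_0[where f' = "\<lambda>x v. f x * g' x v + f' x v * g x"]) (intro has_derivative_mult f' g')
next
  case (Suc N f g)
  obtain f' where f': "\<And>x. x \<in> Y \<Longrightarrow> (f has_derivative f' x) (at x)" "\<And>x i. x \<in> Y \<Longrightarrow> partial_deriv i f x = f' x (axis i 1)"
    using smooth_upto_choose_derivative[OF assms Suc.prems(1)] by metis
  obtain g' where g': "\<And>x. x \<in> Y \<Longrightarrow> (g has_derivative g' x) (at x)" "\<And>x i. x \<in> Y \<Longrightarrow> partial_deriv i g x = g' x (axis i 1)"
    using smooth_upto_choose_derivative[OF assms Suc.prems(2)] by metis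
  have fN: "smooth_upto N Y f" and gN: "smooth_upto N Y g" using Suc.prems by (auto elim: smooth_upto_mono)
  show ?case
  proof (rule smooth_upto_SucI[OF assms, where f' = "\<lambda>x v. f x * g' x v + f' x v * g x"])
    show "smooth_upto N Y (\<lambda>x. f x * g' x (axis i 1) + f' x (axis i 1) * g x)" for i
      by (rule smooth_upto_cong[OF assms _ smooth_upto_add[OF assms Suc.IH[OF fN smooth_upto_partial[OF Suc.prems(2), of i]] Suc.IH[OF smooth_upto_partial[OF Suc.prems(1), of i] gN]]])
        (use f' g' Suc.prems in auto)
  qed (intro has_derivative_mult f' g')
qed

lemma smooth_upto_sum:
  assumes "open Y" "\<And>a. a \<in> A \<Longrightarrow> smooth_upto N Y (f a)"
  shows "smooth_upto N Y (\<lambda>x. \<Sum>a\<in>A. f a x)"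
  using assms(2) by (induction A rule: infinite_finite_induct) (auto intro: smooth_upto_const smooth_upto_add assms(1))

lemma smooth_upto_prod:
  assumes "open Y" "\<And>a. a \<in> A \<Longrightarrow> smooth_upto N Y (f a)"
  shows "smooth_upto N Y (\<lambda>x. \<Prod>a\<in>A. f a x)"
  using assms(2) by (induction A rule: infinite_finite_induct) (auto intro: smooth_upto_const smooth_upto_mult assms(1))

lemma smooth_upto_inverse:
  assumes "open Y" "\<And>x. x \<in> Y \<Longrightarrow> g x \<noteq> 0"
  shows "smooth_upto N Y g \<Longrightarrow> smooth_upto N Y (\<lambda>x. inverse (g x))"
proof (induction N)
  case 0
  obtain g' where g': "\<And>x. x \<in> Y \<Longrightarrow> (g has_derivative g' x) (at x)"
    using smooth_upto_choose_derivative[OF assms(1) 0] by metis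
  show ?case by (rule smooth_upto_0[where f' = "\<lambda>x v. - (inverse (g x) * g' x v * inverse (g x))"])
     (intro Deriv.has_derivative_inverse g' assms)
next
  case (Suc N)
  obtain g' where g': "\<And>x. x \<in> Y \<Longrightarrow> (g has_derivative g' x) (at x)" "\<And>x i. x \<in> Y \<Longrightarrow> partial_deriv i g x = g' x (axis i 1)"
    using smooth_upto_choose_derivative[OF assms(1) Suc.prems] by metis
  have IH: "smooth_upto N Y (\<lambda>x. inverse (g x))" using Suc.IH Suc.prems smooth_upto_mono by (metis le_add2 plus_1_eq_Suc)
  show ?case
  proof (rule smooth_upto_SucI[OF assms(1), where f' = "\<lambda>x v. - (inverse (g x) * g' x v * inverse (g x))"])
    fix i
    have "smooth_upto N Y (\<lambda>x. (-1) * (inverse (g x) * partial_deriv i g x * inverse (g x)))"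
      by (intro smooth_upto_mult smooth_upto_const assms(1) IH smooth_upto_partial Suc.prems)
    then show "smooth_upto N Y (\<lambda>x. - (inverse (g x) * g' x (axis i 1) * inverse (g x)))"
      by (rule smooth_upto_cong[OF assms(1), rotated]) (use g' in simp)
  qed (intro Deriv.has_derivative_inverse g' assms)
qed

lemma smooth_on_const: "open Y \<Longrightarrow> smooth_on Y (\<lambda>_. c)"
  by (simp add: smooth_on_iff_upto smooth_upto_const)

lemma smooth_on_add: "open Y \<Longrightarrow> smooth_on Y f \<Longrightarrow> smooth_on Y g \<Longrightarrow> smooth_on Y (\<lambda>x. f x + g x)"
  by (simp add: smooth_on_iff_upto smooth_upto_add)

lemma smooth_on_mult: "open Y \<Longrightarrow> smooth_on Y f \<Longrightarrow> smooth_on Y g \<Longrightarrow> smooth_on Y (\<lambda>x. f x * g x)"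
  by (simp add: smooth_on_iff_upto smooth_upto_mult)

lemma smooth_on_minus: "open Y \<Longrightarrow> smooth_on Y f \<Longrightarrow> smooth_on Y (\<lambda>x. - f x)"
  using smooth_on_mult[OF _ smooth_on_const[of Y "-1"], of f] by simp

lemma smooth_on_diff: "open Y \<Longrightarrow> smooth_on Y f \<Longrightarrow> smooth_on Y g \<Longrightarrow> smooth_on Y (\<lambda>x. f x - g x)"
  using smooth_on_add[OF _ _ smooth_on_minus, of Y f g] by simp

lemma smooth_on_prod:
  "open Y \<Longrightarrow> (\<And>a. a \<in> A \<Longrightarrow> smooth_on Y (f a)) \<Longrightarrow> smooth_on Y (\<lambda>x. \<Prod>a\<in>A. f a x)"
  by (simp add: smooth_on_iff_upto smooth_upto_prod)

lemma smooth_on_inverse: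
  "open Y \<Longrightarrow> (\<And>x. x \<in> Y \<Longrightarrow> g x \<noteq> 0) \<Longrightarrow> smooth_on Y g \<Longrightarrow> smooth_on Y (\<lambda>x. inverse (g x))"
  by (simp add: smooth_on_iff_upto smooth_upto_inverse)

lemma smooth_on_subset: "smooth_on Y f \<Longrightarrow> Z \<subseteq> Y \<Longrightarrow> smooth_on Z f"
  unfolding smooth_on_def by (blast intro: differentiable_on_subset)

lemma smooth_on_local:
  assumes "\<And>x. x \<in> Y \<Longrightarrow> \<exists>V. open V \<and> x \<in> V \<and> smooth_on V f"
  shows "smooth_on Y f"
  unfolding smooth_on_def differentiable_on_def
proof (intro allI ballI)
  fix js x assume "x \<in> Y"
  then obtain V where V: "open V" "x \<in> V" "smooth_on V f" using assms by blast
  then have "foldr partial_deriv js f differentiable (at x)"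
    by (auto simp: smooth_on_def differentiable_on_eq_differentiable_at)
  then show "foldr partial_deriv js f differentiable (at x within Y)"
    by (rule differentiable_at_withinI)
qed

lemma smooth_on_restrict: "open Y \<Longrightarrow> smooth_on Y f \<Longrightarrow> restrict f Y \<in> smooth_functions Y"
  by (simp add: smooth_functions_iff) (rule smooth_on_cong[of Y f], auto)

lemma smooth_on_coordinate: "open Y \<Longrightarrow> smooth_on Y (\<lambda>x. of_real (x $ i) :: complex)"
  unfolding smooth_on_iff_upto
proof
  fix N assume Y: "open Y"
  have d: "((\<lambda>x. of_real (x $ i) :: complex) has_derivative (\<lambda>v. of_real (v $ i))) (at x)" for x :: "real ^ 'a"
    by (intro bounded_linear_imp_has_derivative bounded_linear_compose[OF bounded_linear_of_real bounded_linear_vec_nth])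
  show "smooth_upto N Y (\<lambda>x. of_real (x $ i) :: complex)"
  proof (cases N)
    case 0
    then show ?thesis using smooth_upto_0[OF d] by simp
  next
    case (Suc N')
    then show ?thesis using smooth_upto_SucI[OF Y d] smooth_upto_const[OF Y] by simp
  qed
qed

lemma smooth_on_derivative_family:
  assumes V: "open V" and z: "\<And>l. l \<in> I \<Longrightarrow> smooth_on V (\<lambda>x. z x l)"
  obtains z' where "\<And>x l. l \<in> I \<Longrightarrow> x \<in> V \<Longrightarrow> ((\<lambda>x. z x l) has_derivative z' l x) (at x)"
     "\<And>x l i. l \<in> I \<Longrightarrow> x \<in> V \<Longrightarrow> partial_deriv i (\<lambda>x. z x l) x = z' l x (axis i 1)"
proof -
  let ?P = "\<lambda>l z'. \<forall>x\<in>V. ((\<lambda>x. z x l) has_derivative z' x) (at x) \<and> (\<forall>i. partial_deriv i (\<lambda>x. z x l) x = z' x (axis i 1))"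
  have "\<forall>l\<in>I. \<exists>z'. ?P l z'"
  proof
    fix l assume "l \<in> I"
    then obtain z' where "\<And>x. x \<in> V \<Longrightarrow> ((\<lambda>x. z x l) has_derivative z' x) (at x)"
      "\<And>x i. x \<in> V \<Longrightarrow> partial_deriv i (\<lambda>x. z x l) x = z' x (axis i 1)"
      using smooth_upto_choose_derivative[OF V smooth_on_imp_upto[OF z]] by blast
    then show "\<exists>z'. ?P l z'" by (intro exI[of _ z']) blast
  qed
  then obtain z' where "\<forall>l\<in>I. ?P l (z' l)" by (rule bchoice[THEN exE])
  then show ?thesis by (intro that[of z']) blast+
qed

text \<open>By the chain rule a partial derivative of the composition is a finite sum of products of
  derived series, convergent in the same open polydisc, with derivatives of the inner functions. The
  coefficients \<open>C\<close> therefore vary in the induction.\<close>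

lemma smooth_upto_ps:
  assumes V: "open V" and I: "finite I"
    and z: "\<And>l. l \<in> I \<Longrightarrow> smooth_on V (\<lambda>x. z x l)" and lt: "\<And>x l. x \<in> V \<Longrightarrow> l \<in> I \<Longrightarrow> norm (z x l) < \<rho> l"
  shows "ps_conv_in I C \<rho> \<Longrightarrow> smooth_upto N V (\<lambda>x. ps I C (z x))"
proof (induction N arbitrary: C)
  case 0
  obtain z' where z': "\<And>x l. l \<in> I \<Longrightarrow> x \<in> V \<Longrightarrow> ((\<lambda>x. z x l) has_derivative z' l x) (at x)"
     "\<And>x l i. l \<in> I \<Longrightarrow> x \<in> V \<Longrightarrow> partial_deriv i (\<lambda>x. z x l) x = z' l x (axis i 1)"
    using smooth_on_derivative_family[where I = I and z = z, OF V z] by blast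
  show ?case
    by (rule smooth_upto_0[OF ps_has_derivative_in[OF I 0 lt z'(1)]])
next
  case (Suc N)
  obtain z' where z': "\<And>x l. l \<in> I \<Longrightarrow> x \<in> V \<Longrightarrow> ((\<lambda>x. z x l) has_derivative z' l x) (at x)"
     "\<And>x l i. l \<in> I \<Longrightarrow> x \<in> V \<Longrightarrow> partial_deriv i (\<lambda>x. z x l) x = z' l x (axis i 1)"
    using smooth_on_derivative_family[where I = I and z = z, OF V z] by blast
  show ?case
  proof (rule smooth_upto_SucI[OF V ps_has_derivative_in[OF I Suc.prems lt z'(1)]])
    fix i
    have "smooth_upto N V (\<lambda>x. \<Sum>l\<in>I. ps I (ps_deriv l C) (z x) * partial_deriv i (\<lambda>x. z x l) x)"
      by (intro smooth_upto_sum V smooth_upto_mult Suc.IH ps_conv_in_deriv I Suc.prems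
          smooth_on_imp_upto smooth_on_partial z)
    then show "smooth_upto N V (\<lambda>x. \<Sum>l\<in>I. ps I (ps_deriv l C) (z x) * z' l x (axis i 1))"
      by (rule smooth_upto_cong[OF V, rotated]) (auto simp: z'(2) intro!: sum.cong)
  qed
qed

lemma smooth_on_ps:
  assumes "open V" "finite I" "\<And>l. l \<in> I \<Longrightarrow> smooth_on V (\<lambda>x. z x l)"
    "\<And>x l. x \<in> V \<Longrightarrow> l \<in> I \<Longrightarrow> norm (z x l) < \<rho> l" "ps_conv_in I C \<rho>"
  shows "smooth_on V (\<lambda>x. ps I C (z x))"
  unfolding smooth_on_iff_upto by (intro allI smooth_upto_ps[where \<rho> = \<rho>] assms)

section \<open>Power series of real variables\<close>

definition rps :: "real ^ 'n::finite \<Rightarrow> (('n \<Rightarrow> nat) \<Rightarrow> complex) \<Rightarrow> real ^ 'n \<Rightarrow> complex" where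
  "rps a c x = ps UNIV c (\<lambda>i. of_real (x $ i - a $ i))"

definition obox :: "real ^ 'n::finite \<Rightarrow> ('n \<Rightarrow> real) \<Rightarrow> (real ^ 'n) set" where
  "obox a \<rho> = {x. \<forall>i. \<bar>x $ i - a $ i\<bar> < \<rho> i}"

lemma open_obox: "open (obox a \<rho>)"
proof -
  have "obox a \<rho> = (\<Inter>i. {x. \<bar>x $ i - a $ i\<bar> < \<rho> i})" by (auto simp: obox_def)
  also have "open \<dots>" by (intro open_INT ballI finite open_Collect_less continuous_intros)
  finally show ?thesis .
qed

lemma rps_has_derivative:
  assumes "ps_conv_in UNIV c \<rho>" "x \<in> obox a \<rho>"
  shows "(rps a c has_derivative (\<lambda>v. \<Sum>i\<in>UNIV. rps a (ps_deriv i c) x * of_real (v $ i))) (at x)"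
  unfolding rps_def
proof (rule ps_has_derivative_in[OF finite assms(1)])
  show "((\<lambda>x. complex_of_real (x $ i - a $ i)) has_derivative (\<lambda>v. complex_of_real (v $ i))) (at x)" for i
  proof -
    have "((\<lambda>x. x $ i - a $ i) has_derivative (\<lambda>v. v $ i - 0)) (at x)"
      by (intro has_derivative_diff has_derivative_const bounded_linear_imp_has_derivative bounded_linear_vec_nth)
    then show ?thesis using has_derivative_of_real by fastforce
  qed
qed (use assms(2) in \<open>auto simp: obox_def simp flip: of_real_diff\<close>)

lemma partial_deriv_rps:
  assumes "ps_conv_in UNIV c \<rho>" "x \<in> obox a \<rho>"
  shows "partial_deriv i (rps a c) x = rps a (ps_deriv i c) x"
proof -
  have "partial_deriv i (rps a c) x = (\<Sum>j\<in>UNIV. rps a (ps_deriv j c) x * of_real (axis i (1::real) $ j))"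
    by (rule partial_deriv_has_derivative[OF rps_has_derivative[OF assms]])
  also have "\<dots> = (\<Sum>j\<in>UNIV. if j = i then rps a (ps_deriv j c) x else 0)"
    by (intro sum.cong) (auto simp: axis_def)
  finally show ?thesis by simp
qed

lemma foldr_ps_deriv_conv_in:
  fixes c :: "('n::finite \<Rightarrow> nat) \<Rightarrow> complex"
  shows "ps_conv_in UNIV c \<rho> \<Longrightarrow> ps_conv_in UNIV (foldr ps_deriv js c) \<rho>"
  by (induction js) (auto intro: ps_conv_in_deriv)

lemma foldr_partial_deriv_rps:
  assumes "ps_conv_in UNIV c \<rho>" "x \<in> obox a \<rho>"
  shows "foldr partial_deriv js (rps a c) x = rps a (foldr ps_deriv js c) x"
  using assms(2)
proof (induction js arbitrary: x)
  case Nil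
  then show ?case by simp
next
  case (Cons j js)
  have "partial_deriv j (foldr partial_deriv js (rps a c)) x = partial_deriv j (rps a (foldr ps_deriv js c)) x"
    by (rule partial_deriv_cong[OF open_obox Cons.prems Cons.IH])
  then show ?case
    by (simp add: partial_deriv_rps[OF foldr_ps_deriv_conv_in[OF assms(1)] Cons.prems])
qed

lemma smooth_on_rps:
  assumes "ps_conv_in UNIV c \<rho>"
  shows "smooth_on (obox a \<rho>) (rps a c)"
  unfolding rps_def
proof (rule smooth_on_ps[OF open_obox finite _ _ assms])
  have "smooth_on (obox a \<rho>) (\<lambda>x. of_real (x $ i) - of_real (a $ i))" for i
    by (intro smooth_on_diff smooth_on_coordinate smooth_on_const open_obox)
  then show "smooth_on (obox a \<rho>) (\<lambda>x. complex_of_real (x $ i - a $ i))" for i by simp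
qed (auto simp: obox_def simp flip: of_real_diff)

section \<open>Derivatives of all orders and the identity theorem\<close>

definition ps_derivs :: "('n::finite \<Rightarrow> nat) \<Rightarrow> (('n \<Rightarrow> nat) \<Rightarrow> complex) \<Rightarrow> ('n \<Rightarrow> nat) \<Rightarrow> complex" where
  "ps_derivs \<alpha> c \<gamma> = (\<Prod>i\<in>UNIV. fact (\<gamma> i + \<alpha> i) / fact (\<gamma> i)) * c (\<lambda>i. \<gamma> i + \<alpha> i)"

lemma ps_deriv_ps_derivs: "ps_deriv i (ps_derivs \<alpha> c) = ps_derivs (\<alpha>(i := Suc (\<alpha> i))) c"
proof
  fix \<gamma> :: "'a \<Rightarrow> nat"
  let ?\<gamma> = "\<gamma>(i := Suc (\<gamma> i))" and ?\<alpha> = "\<alpha>(i := Suc (\<alpha> i))"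
  have "(\<Prod>j\<in>UNIV. fact (?\<gamma> j + \<alpha> j) / fact (?\<gamma> j) :: complex)
      = fact (Suc (\<gamma> i) + \<alpha> i) / fact (Suc (\<gamma> i)) * (\<Prod>j\<in>UNIV - {i}. fact (\<gamma> j + \<alpha> j) / fact (\<gamma> j))"
    by (subst prod.remove[of _ i]) auto
  moreover have "(\<Prod>j\<in>UNIV. fact (\<gamma> j + ?\<alpha> j) / fact (\<gamma> j) :: complex)
      = fact (\<gamma> i + Suc (\<alpha> i)) / fact (\<gamma> i) * (\<Prod>j\<in>UNIV - {i}. fact (\<gamma> j + \<alpha> j) / fact (\<gamma> j))"
    by (subst prod.remove[of _ i]) auto
  moreover have "of_nat (Suc (\<gamma> i)) * (fact (Suc (\<gamma> i) + \<alpha> i) / fact (Suc (\<gamma> i))) = (fact (\<gamma> i + Suc (\<alpha> i)) / fact (\<gamma> i) :: complex)"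
  proof -
    have "fact (Suc (\<gamma> i)) = (of_nat (Suc (\<gamma> i)) * fact (\<gamma> i) :: complex)" by (rule fact_Suc)
    then show ?thesis using of_nat_neq_0[of "\<gamma> i", where 'a = complex] by (simp del: of_nat_Suc fact_Suc)
  qed
  moreover have "(\<lambda>j. ?\<gamma> j + \<alpha> j) = (\<lambda>j. \<gamma> j + ?\<alpha> j)" by auto
  ultimately show "ps_deriv i (ps_derivs \<alpha> c) \<gamma> = ps_derivs ?\<alpha> c \<gamma>"
    unfolding ps_deriv_def ps_derivs_def by (simp only: mult.assoc[symmetric])
qed

text \<open>The formal derivative depends on the list only through the number of occurrences of each
  direction. Hence the unspecified enumeration inside \<open>multi_deriv\<close> has no influence on
  power series.\<close>

lemma foldr_ps_deriv: "foldr ps_deriv js c = ps_derivs (count_list js) c"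
proof (induction js)
  case Nil
  show ?case by (simp add: ps_derivs_def fun_eq_iff)
next
  case (Cons j js)
  have "(count_list js)(j := Suc (count_list js j)) = count_list (j # js)" by auto
  then show ?case by (simp add: Cons ps_deriv_ps_derivs del: count_list.simps)
qed

lemma multi_deriv_rps:
  assumes "ps_conv_in UNIV c \<rho>" "x \<in> obox a \<rho>"
  shows "multi_deriv \<alpha> (rps a c) x = rps a (ps_derivs \<alpha> c) x"
proof -
  have "count_list (deriv_list \<alpha>) = \<alpha>" by (auto simp: count_deriv_list)
  then show ?thesis
    by (simp add: multi_deriv_eq_foldr foldr_partial_deriv_rps[OF assms] foldr_ps_deriv)
qed

lemma funpow_partial_deriv_rps:
  assumes "ps_conv_in UNIV c \<rho>" "x \<in> obox a \<rho>"
  shows "(partial_deriv k ^^ p) (rps a c) x = rps a (ps_derivs (\<lambda>i. if i = k then p else 0) c) x"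
proof -
  have "count_list (replicate p k) = (\<lambda>i. if i = k then p else 0)"
    by (induction p) (auto simp: fun_eq_iff)
  then show ?thesis
    by (simp only: funpow_partial_deriv foldr_partial_deriv_rps[OF assms] foldr_ps_deriv)
qed

lemma ps_conv_in_derivs:
  assumes "ps_conv_in UNIV c \<rho>"
  shows "ps_conv_in UNIV (ps_derivs \<alpha> c) \<rho>"
proof -
  have "count_list (deriv_list \<alpha>) = \<alpha>" by (auto simp: count_deriv_list)
  then show ?thesis using foldr_ps_deriv_conv_in[OF assms, of "deriv_list \<alpha>"] by (simp add: foldr_ps_deriv)
qed

lemma ps_zero:
  assumes "finite I" 
  shows "ps I c (\<lambda>_. 0) = c (\<lambda>i\<in>I. 0)"
proof -
  have "mpow I (\<lambda>_. 0 :: complex) \<beta> = 0" if "\<beta> \<in> multi_indices I - {\<lambda>i\<in>I. 0}" for \<beta>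
  proof -
    have "\<exists>i\<in>I. \<beta> i \<noteq> 0"
    proof (rule ccontr)
      assume "\<not> ?thesis"
      then have "\<beta> = (\<lambda>i\<in>I. 0)" using that by (intro PiE_ext[of _ I "\<lambda>_. UNIV"]) auto
      with that show False by simp
    qed
    then show ?thesis using assms by (auto simp: mpow_def intro!: prod_zero)
  qed
  then have "ps I c (\<lambda>_. 0) = infsum (\<lambda>\<beta>. c \<beta> * mpow I (\<lambda>_. 0) \<beta>) {\<lambda>i\<in>I. 0}"
    unfolding ps_def by (intro infsum_cong_neutral) auto
  then show ?thesis by (simp add: mpow_def)
qed

lemma rps_center: "rps a c a = c (\<lambda>_. 0)"
proof -
  have "(\<lambda>i\<in>UNIV. 0) = (\<lambda>_::'a. 0::nat)" by auto
  then show ?thesis using ps_zero[of "UNIV :: 'a set" c] by (simp add: rps_def)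
qed

text \<open>Each coefficient is, up to the factor \<alpha>!, the value at \<open>a\<close> of a
  derivative of the sum, and derivatives depend only on the values in the neighbourhood
  \<open>V\<close>.\<close>

lemma rps_identity:
  assumes c: "ps_conv_in UNIV c \<rho>" and d: "ps_conv_in UNIV d \<rho>" and V: "open V" "a \<in> V" and "\<And>i. \<rho> i > 0"
    and eq: "\<And>x. x \<in> V \<Longrightarrow> rps a c x = rps a d x"
  shows "c = d"
proof
  fix \<alpha> :: "'a \<Rightarrow> nat"
  have a: "a \<in> obox a \<rho>" using assms by (simp add: obox_def)
  have "multi_deriv \<alpha> (rps a c) a = multi_deriv \<alpha> (rps a d) a"
    by (rule multi_deriv_cong[OF V eq])
  then have "ps_derivs \<alpha> c (\<lambda>_. 0) = ps_derivs \<alpha> d (\<lambda>_. 0)"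
    using multi_deriv_rps[OF c a] multi_deriv_rps[OF d a] by (simp add: rps_center)
  then show "c \<alpha> = d \<alpha>" by (simp add: ps_derivs_def)
qed

lemma rps_recenter:
  assumes "ps_conv UNIV c \<rho>" "\<And>i. \<bar>b $ i - a $ i\<bar> + \<bar>x $ i - b $ i\<bar> \<le> \<rho> i"
  shows "rps b (recenter_coeff UNIV c (\<lambda>i. of_real (b $ i - a $ i))) x = rps a c x"
  unfolding rps_def
  by (subst ps_recenter[OF finite assms(1)]) (use assms(2) in \<open>auto simp flip: of_real_diff of_real_add\<close>)

text \<open>Over the complex numbers unconditional summability is absolute, so a series that merely
  has a sum at the real corner \<open>\<rho>\<close> converges absolutely on the polydisc.\<close>

lemma ps_conv_of_summable:
  assumes "(\<lambda>\<beta>. c \<beta> * mpow I (\<lambda>i. of_real (\<rho> i)) \<beta>) summable_on multi_indices I" "\<And>i. i \<in> I \<Longrightarrow> 0 \<le> \<rho> i"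
  shows "ps_conv I c \<rho>"
proof -
  have "(\<lambda>\<beta>. norm (c \<beta> * mpow I (\<lambda>i. of_real (\<rho> i)) \<beta>)) summable_on multi_indices I"
    by (rule summable_on_iff_abs_summable_on_complex[THEN iffD1, OF assms(1)])
  then show ?thesis
    using assms(2) by (simp add: ps_conv_def norm_mult norm_mpow cong: mpow_cong)
qed

section \<open>Real-analytic functions as power series\<close>

lemma rps_real_analytic:
  assumes "ps_conv_in UNIV c \<rho>" "D \<subseteq> obox a \<rho>"
  shows "rps a c real_analytic_on D"
  unfolding real_analytic_on_def
proof
  fix b assume "b \<in> D"
  then have b: "\<bar>b $ i - a $ i\<bar> < \<rho> i" for i using assms(2) by (auto simp: obox_def)
  obtain s where s: "s > 0" "\<forall>i\<in>UNIV. s \<le> \<rho> i - \<bar>b $ i - a $ i\<bar>"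
    using finite_lower_bound[of UNIV "\<lambda>i. \<rho> i - \<bar>b $ i - a $ i\<bar>"] b by auto
  \<comment> \<open>Half of the slack \<open>s\<close> keeps \<open>\<rho>'\<close> strictly below
    \<open>\<rho>\<close> and still leaves room \<open>s / 2\<close> around \<open>b\<close> for the
    recentred series.\<close>
  define \<rho>' where "\<rho>' i = \<bar>b $ i - a $ i\<bar> + s / 2" for i
  have c: "ps_conv UNIV c \<rho>'"
  proof (rule ps_conv_inD[OF assms(1)])
    fix i
    have "s \<le> \<rho> i - \<bar>b $ i - a $ i\<bar>" using s(2) by simp
    then show "0 \<le> \<rho>' i \<and> \<rho>' i < \<rho> i" using s(1) by (simp add: \<rho>'_def)
  qed
  show "\<exists>r>0. \<exists>d. \<forall>x\<in>D. dist x b < r \<longrightarrow>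
      ((\<lambda>\<beta>. d \<beta> * (\<Prod>i\<in>UNIV. of_real (x $ i - b $ i) ^ \<beta> i)) has_sum rps a c x) UNIV"
  proof (intro exI[of _ "s/2"] exI[of _ "recenter_coeff UNIV c (\<lambda>i. of_real (b $ i - a $ i))"] conjI ballI impI)
    fix x assume "dist x b < s/2"
    then have x: "\<bar>x $ i - b $ i\<bar> \<le> s / 2" for i
      using component_le_norm_cart[of "x - b" i] by (simp add: dist_norm)
    have "((\<lambda>\<gamma>. recenter_coeff UNIV c (\<lambda>i. of_real (b $ i - a $ i)) \<gamma> * mpow UNIV (\<lambda>i. of_real (x $ i - b $ i)) \<gamma>)
       has_sum ps UNIV c (\<lambda>i. of_real (b $ i - a $ i) + of_real (x $ i - b $ i))) (multi_indices UNIV)"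
      by (rule recenter(1)[OF finite c]) (use x in \<open>auto simp: \<rho>'_def simp flip: of_real_diff\<close>)
    then show "((\<lambda>\<beta>. recenter_coeff UNIV c (\<lambda>i. of_real (b $ i - a $ i)) \<beta> * (\<Prod>i\<in>UNIV. of_real (x $ i - b $ i) ^ \<beta> i)) has_sum rps a c x) UNIV"
      by (simp add: rps_def mpow_def)
  qed (use s in auto)
qed

lemma real_analytic_on_local:
  assumes "\<And>a. a \<in> D \<Longrightarrow> \<exists>V h. open V \<and> a \<in> V \<and> h real_analytic_on V \<and> (\<forall>x\<in>V \<inter> D. f x = h x)"
  shows "f real_analytic_on D"
  unfolding real_analytic_on_def
proof
  fix a assume "a \<in> D"
  then obtain V h where V: "open V" "a \<in> V" "h real_analytic_on V" "\<forall>x\<in>V \<inter> D. f x = h x" using assms by blast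
  then obtain r c where r: "r > 0" "\<forall>x\<in>V. dist x a < r \<longrightarrow>
        ((\<lambda>\<beta>. c \<beta> * (\<Prod>i\<in>UNIV. of_real (x $ i - a $ i) ^ \<beta> i)) has_sum h x) UNIV"
    unfolding real_analytic_on_def by blast
  obtain e where e: "e > 0" "ball a e \<subseteq> V" using V openE by blast
  show "\<exists>r>0. \<exists>c. \<forall>x\<in>D. dist x a < r \<longrightarrow>
        ((\<lambda>\<beta>. c \<beta> * (\<Prod>i\<in>UNIV. of_real (x $ i - a $ i) ^ \<beta> i)) has_sum f x) UNIV"
  proof (intro exI[of _ "min r e"] exI[of _ c] conjI ballI impI)
    fix x assume x: "x \<in> D" "dist x a < min r e"
    then have "x \<in> V" using e by (auto simp: dist_commute)
    then show "((\<lambda>\<beta>. c \<beta> * (\<Prod>i\<in>UNIV. of_real (x $ i - a $ i) ^ \<beta> i)) has_sum f x) UNIV"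
      using r(2) x V(4) by auto
  qed (use r e in auto)
qed

lemma real_analytic_on_subset: "f real_analytic_on D \<Longrightarrow> E \<subseteq> D \<Longrightarrow> f real_analytic_on E"
  unfolding real_analytic_on_def by (meson subsetD)

text \<open>The corner of the box of half-width \<open>\<delta>\<close> about \<open>a\<close>; a
  power series about \<open>a\<close> that has a sum there converges absolutely on the box.\<close>

definition diag :: "real ^ 'n::finite \<Rightarrow> real \<Rightarrow> real ^ 'n" where
  "diag a \<delta> = (\<chi> i. a $ i + \<delta>)"

lemma dist_le_of_components:
  fixes x a :: "real ^ 'n::finite"
  assumes "\<And>i. \<bar>x $ i - a $ i\<bar> \<le> \<delta>"
  shows "dist x a \<le> real CARD('n) * \<delta>"
proof -
  have "dist x a \<le> (\<Sum>i\<in>UNIV. \<bar>x $ i - a $ i\<bar>)" using norm_le_l1_cart[of "x - a"] by (simp add: dist_norm)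
  also have "\<dots> \<le> of_nat (card (UNIV :: 'n set)) * \<delta>" by (rule sum_bounded_above) (use assms in auto)
  finally show ?thesis .
qed

text \<open>Analyticity provides sums only at points of \<open>D\<close>. Since \<open>D\<close> is
  open it contains a small closed box with its corner, and the sum at the corner gives the absolute
  convergence that termwise operations require.\<close>

lemma real_analytic_on_open_rps:
  fixes f :: "real ^ 'n::finite \<Rightarrow> complex"
  assumes "f real_analytic_on D" "open D" "a \<in> D"
  obtains \<delta> c where "\<delta> > 0" "ps_conv UNIV c (\<lambda>_. \<delta>)" "\<And>x. (\<And>i. \<bar>x $ i - a $ i\<bar> \<le> \<delta>) \<Longrightarrow> x \<in> D \<and> f x = rps a c x"
proof -
  from assms obtain r c where r: "r > 0" "\<forall>x\<in>D. dist x a < r \<longrightarrow>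
        ((\<lambda>\<beta>. c \<beta> * (\<Prod>i\<in>UNIV. of_real (x $ i - a $ i) ^ \<beta> i)) has_sum f x) UNIV"
    unfolding real_analytic_on_def by blast
  obtain e where e: "e > 0" "ball a e \<subseteq> D" using assms openE by blast
  \<comment> \<open>Distances in the box are at most \<open>CARD('n)\<close> times
    \<open>\<delta>\<close>; the factor 2 makes the bound by the radius strict.\<close>
  define \<delta> where "\<delta> = min r e / (2 * real CARD('n))"
  have \<delta>: "\<delta> > 0" "real CARD('n) * \<delta> < min r e" using r e by (auto simp: \<delta>_def field_simps min_def)
  have close: "dist x a < min r e" if "\<And>i. \<bar>x $ i - a $ i\<bar> \<le> \<delta>" for x
    using dist_le_of_components[OF that] \<delta>(2) by linarith
  have hs: "x \<in> D" "((\<lambda>\<beta>. c \<beta> * mpow UNIV (\<lambda>i. of_real (x $ i - a $ i)) \<beta>) has_sum f x) UNIV"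
    if "\<And>i. \<bar>x $ i - a $ i\<bar> \<le> \<delta>" for x
  proof -
    have "x \<in> ball a e" using close[OF that] by (simp add: dist_commute)
    then show "x \<in> D" using e by auto
    then show "((\<lambda>\<beta>. c \<beta> * mpow UNIV (\<lambda>i. of_real (x $ i - a $ i)) \<beta>) has_sum f x) UNIV"
      using r(2) close[OF that] by (simp add: mpow_def)
  qed
  have "((\<lambda>\<beta>. c \<beta> * mpow UNIV (\<lambda>i. of_real \<delta>) \<beta>) has_sum f (diag a \<delta>)) UNIV"
    using hs(2)[of "diag a \<delta>"] \<delta>(1) by (simp add: diag_def)
  then have "ps_conv UNIV c (\<lambda>_. \<delta>)"
    using \<delta>(1) by (intro ps_conv_of_summable) (auto dest: has_sum_imp_summable)
  moreover have "x \<in> D \<and> f x = rps a c x" if "\<And>i. \<bar>x $ i - a $ i\<bar> \<le> \<delta>" for x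
    using hs[OF that] by (auto simp: rps_def ps_def dest: infsumI)
  ultimately show ?thesis using that \<delta>(1) by blast
qed

lemma real_analytic_smooth_on:
  assumes "f real_analytic_on D" "open D"
  shows "smooth_on D f"
proof (rule smooth_on_local)
  fix a assume "a \<in> D"
  with assms obtain \<delta> c where d: "\<delta> > 0" "ps_conv UNIV c (\<lambda>_. \<delta>)" "\<And>x. (\<And>i. \<bar>x $ i - a $ i\<bar> \<le> \<delta>) \<Longrightarrow> x \<in> D \<and> f x = rps a c x"
    using real_analytic_on_open_rps by blast
  have "smooth_on (obox a (\<lambda>_. \<delta>)) (rps a c)" by (rule smooth_on_rps[OF ps_conv_imp_in[OF d(2)]])
  then have "smooth_on (obox a (\<lambda>_. \<delta>)) f"
    by (rule smooth_on_cong[OF open_obox, rotated]) (use d(3) in \<open>auto simp: obox_def less_imp_le\<close>)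
  moreover have "a \<in> obox a (\<lambda>_. \<delta>)" using d by (simp add: obox_def)
  ultimately show "\<exists>V. open V \<and> a \<in> V \<and> smooth_on V f" using open_obox by blast
qed

section \<open>Nonlinearities analytic in all variables\<close>

text \<open>The sum type indexes the variables of \<open>x\<close> and of the jet together, shifted
  to the centre (a, b); \<open>G\<close> then becomes a single power series over
  \<open>Sum_Type.Plus UNIV J\<close>.\<close>

definition joint_args :: "real ^ 'n::finite \<Rightarrow> ('j \<Rightarrow> complex) \<Rightarrow> real ^ 'n \<Rightarrow> ('j \<Rightarrow> complex) \<Rightarrow> 'n + 'j \<Rightarrow> complex" where
  "joint_args a b x \<xi> = case_sum (\<lambda>i. of_real (x $ i - a $ i)) (\<lambda>j. \<xi> j - b j)"

lemma joint_args_simps [simp]: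
  "joint_args a b x \<xi> (Inl i) = of_real (x $ i - a $ i)"
  "joint_args a b x \<xi> (Inr j) = \<xi> j - b j"
  by (simp_all add: joint_args_def)

text \<open>The pair of exponents is flattened to one multi-index over the sum type by a bijection,
  and evaluation at the corner where every variable deviates by \<open>\<rho>\<close> yields
  absolute convergence. Membership \<open>x \<in> X\<close> can be recorded because the box is
  chosen inside \<open>X\<close>.\<close>

lemma analytic_in_all_variables_ps:
  fixes G :: "real ^ 'n::finite \<Rightarrow> ('j \<Rightarrow> complex) \<Rightarrow> complex"
  assumes X: "open X" and J: "finite J" and G: "analytic_in_all_variables X J G" and a: "a \<in> X" and b: "b \<in> J \<rightarrow>\<^sub>E UNIV"
  obtains \<rho> C where "\<rho> > 0" "ps_conv (Sum_Type.Plus UNIV J) C (\<lambda>_. \<rho>)"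
    "\<And>x \<xi>. (\<And>i. \<bar>x $ i - a $ i\<bar> \<le> \<rho>) \<Longrightarrow> \<xi> \<in> J \<rightarrow>\<^sub>E UNIV \<Longrightarrow> (\<And>j. j \<in> J \<Longrightarrow> norm (\<xi> j - b j) \<le> \<rho>) \<Longrightarrow>
       x \<in> X \<and> G x \<xi> = ps (Sum_Type.Plus UNIV J) C (joint_args a b x \<xi>)"
proof -
  let ?I = "Sum_Type.Plus UNIV J :: ('n + 'j) set"
  from G[unfolded analytic_in_all_variables_def, rule_format, OF a b] obtain r c where r: "r > 0" and hs: "\<And>x \<xi>. x \<in> X \<Longrightarrow> \<xi> \<in> J \<rightarrow>\<^sub>E UNIV \<Longrightarrow> dist x a < r \<and> (\<forall>j\<in>J. dist (\<xi> j) (b j) < r) \<Longrightarrow>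
          ((\<lambda>(\<beta>, \<gamma>). c \<beta> \<gamma> * (\<Prod>i\<in>UNIV. of_real (x $ i - a $ i) ^ \<beta> i)
                           * (\<Prod>j\<in>J. (\<xi> j - b j) ^ \<gamma> j)) has_sum G x \<xi>) (UNIV \<times> (J \<rightarrow>\<^sub>E UNIV))"
    by blast
  obtain e where e: "e > 0" "ball a e \<subseteq> X" using X a openE by blast
  define \<rho> where "\<rho> = min r e / (2 * real CARD('n))"
  have "real CARD('n) \<ge> 1" by (simp add: Suc_leI)
  have \<rho>: "\<rho> > 0" "real CARD('n) * \<rho> < min r e" using r e by (auto simp: \<rho>_def field_simps min_def)
  have \<rho>r: "\<rho> < r"
  proof -
    have "\<rho> \<le> real CARD('n) * \<rho>" using \<open>real CARD('n) \<ge> 1\<close> \<rho>(1) by simp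
    with \<rho>(2) show ?thesis by simp
  qed
  define C where "C \<delta> = c (\<lambda>i. \<delta> (Inl i)) (\<lambda>j\<in>J. \<delta> (Inr j))" for \<delta>
  define \<phi> where "\<phi> \<delta> = (\<lambda>i. \<delta> (Inl i), \<lambda>j\<in>J. \<delta> (Inr j))" for \<delta> :: "'n + 'j \<Rightarrow> nat"
  have bij: "bij_betw \<phi> (multi_indices ?I) (UNIV \<times> multi_indices J)"
    unfolding \<phi>_def
  proof (rule bij_betwI[where g = "\<lambda>(\<beta>, \<gamma>). restrict (case_sum \<beta> \<gamma>) ?I"])
    show "(case (\<lambda>i. \<delta> (Inl i), \<lambda>j\<in>J. \<delta> (Inr j)) of (\<beta>, \<gamma>) \<Rightarrow> restrict (case_sum \<beta> \<gamma>) ?I) = \<delta>"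
      if "\<delta> \<in> multi_indices ?I" for \<delta>
    proof
      fix l :: "'n + 'j"
      show "(case (\<lambda>i. \<delta> (Inl i), \<lambda>j\<in>J. \<delta> (Inr j)) of (\<beta>, \<gamma>) \<Rightarrow> restrict (case_sum \<beta> \<gamma>) ?I) l = \<delta> l"
        using that by (cases l) (auto simp: PiE_iff extensional_def)
    qed
    show "(\<lambda>i. (case p of (\<beta>, \<gamma>) \<Rightarrow> restrict (case_sum \<beta> \<gamma>) ?I) (Inl i),
        \<lambda>j\<in>J. (case p of (\<beta>, \<gamma>) \<Rightarrow> restrict (case_sum \<beta> \<gamma>) ?I) (Inr j)) = p"
      if "p \<in> UNIV \<times> multi_indices J" for p
      using that by (auto simp: PiE_iff extensional_def fun_eq_iff)
  qed auto
  have mp: "mpow ?I (joint_args a b x \<xi>) \<delta> = (\<Prod>i\<in>UNIV. of_real (x $ i - a $ i) ^ \<delta> (Inl i)) * (\<Prod>j\<in>J. (\<xi> j - b j) ^ \<delta> (Inr j))" for x \<xi> \<delta>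
    unfolding mpow_def using J by (subst prod.Plus) (auto simp: o_def)
  have main: "((\<lambda>\<delta>. C \<delta> * mpow ?I (joint_args a b x \<xi>) \<delta>) has_sum G x \<xi>) (multi_indices ?I)" "x \<in> X"
    if x: "\<And>i. \<bar>x $ i - a $ i\<bar> \<le> \<rho>" and \<xi>: "\<xi> \<in> J \<rightarrow>\<^sub>E UNIV" "\<And>j. j \<in> J \<Longrightarrow> norm (\<xi> j - b j) \<le> \<rho>" for x \<xi>
  proof -
    have d: "dist x a < min r e" using dist_le_of_components[OF x] \<rho>(2) by linarith
    then have "x \<in> ball a e" by (simp add: dist_commute)
    with e show "x \<in> X" by auto
    have "\<forall>j\<in>J. dist (\<xi> j) (b j) < r" using \<xi>(2) \<rho>r by (force simp: dist_norm)
    with d have "((\<lambda>(\<beta>, \<gamma>). c \<beta> \<gamma> * (\<Prod>i\<in>UNIV. of_real (x $ i - a $ i) ^ \<beta> i)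
                           * (\<Prod>j\<in>J. (\<xi> j - b j) ^ \<gamma> j)) has_sum G x \<xi>) (UNIV \<times> (J \<rightarrow>\<^sub>E UNIV))"
      by (intro hs \<open>x \<in> X\<close> \<xi>(1)) auto
    then have "((\<lambda>p. (\<lambda>(\<beta>, \<gamma>). c \<beta> \<gamma> * (\<Prod>i\<in>UNIV. of_real (x $ i - a $ i) ^ \<beta> i)
                           * (\<Prod>j\<in>J. (\<xi> j - b j) ^ \<gamma> j)) (\<phi> p)) has_sum G x \<xi>) (multi_indices ?I)"
      by (subst has_sum_reindex_bij_betw[OF bij])
    then show "((\<lambda>\<delta>. C \<delta> * mpow ?I (joint_args a b x \<xi>) \<delta>) has_sum G x \<xi>) (multi_indices ?I)"
      by (simp add: mp C_def \<phi>_def mult.assoc)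
  qed
  have "((\<lambda>\<delta>. C \<delta> * mpow ?I (joint_args a b (diag a \<rho>) (\<lambda>j\<in>J. b j + of_real \<rho>)) \<delta>) has_sum G (diag a \<rho>) (\<lambda>j\<in>J. b j + of_real \<rho>)) (multi_indices ?I)"
    by (rule main(1)) (use \<rho>(1) in \<open>auto simp: diag_def\<close>)
  moreover have "mpow ?I (joint_args a b (diag a \<rho>) (\<lambda>j\<in>J. b j + of_real \<rho>)) = mpow ?I (\<lambda>_. of_real \<rho>)"
    by (intro ext mpow_cong) (auto simp: diag_def)
  ultimately have "ps_conv ?I C (\<lambda>_. \<rho>)"
    using \<rho>(1) by (intro ps_conv_of_summable) (auto dest: has_sum_imp_summable)
  moreover have "x \<in> X \<and> G x \<xi> = ps ?I C (joint_args a b x \<xi>)" 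
    if "\<And>i. \<bar>x $ i - a $ i\<bar> \<le> \<rho>" and "\<xi> \<in> J \<rightarrow>\<^sub>E UNIV" "\<And>j. j \<in> J \<Longrightarrow> norm (\<xi> j - b j) \<le> \<rho>" for x \<xi>
    using main[OF that] by (auto simp: ps_def dest: infsumI)
  ultimately show ?thesis using that \<rho>(1) by blast
qed

text \<open>By continuity the inserted functions stay within \<open>\<rho>\<close> of their values
  \<open>b\<close> at \<open>a\<close> on a neighbourhood \<open>V\<close>, where \<open>G\<close>
  is one power series about (a, b).\<close>

lemma smooth_on_analytic_composition:
  fixes G :: "real ^ 'n::finite \<Rightarrow> ('j \<Rightarrow> complex) \<Rightarrow> complex"
  assumes X: "open X" and J: "finite J" and G: "analytic_in_all_variables X J G"
    and u: "\<And>j. j \<in> J \<Longrightarrow> smooth_on X (u j)"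
  shows "smooth_on X (\<lambda>x. G x (\<lambda>j\<in>J. u j x))"
proof (rule smooth_on_local)
  fix a assume a: "a \<in> X"
  define b where "b = (\<lambda>j\<in>J. u j a)"
  obtain \<rho> C where \<rho>: "\<rho> > 0" and C: "ps_conv (Sum_Type.Plus UNIV J) C (\<lambda>_. \<rho>)"
    and eq: "\<And>x \<xi>. (\<And>i. \<bar>x $ i - a $ i\<bar> \<le> \<rho>) \<Longrightarrow> \<xi> \<in> J \<rightarrow>\<^sub>E UNIV \<Longrightarrow> (\<And>j. j \<in> J \<Longrightarrow> norm (\<xi> j - b j) \<le> \<rho>) \<Longrightarrow>
       x \<in> X \<and> G x \<xi> = ps (Sum_Type.Plus UNIV J) C (joint_args a b x \<xi>)"
    by (rule analytic_in_all_variables_ps[OF X J G a, of b]) (auto simp: b_def)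
  define W where "W = X \<inter> obox a (\<lambda>_. \<rho>)"
  define V where "V = W \<inter> (\<Inter>j\<in>J. {x \<in> W. norm (u j x - b j) < \<rho>})"
  have W: "open W" unfolding W_def by (intro open_Int X open_obox)
  have "open {x \<in> W. norm (u j x - b j) < \<rho>}" if "j \<in> J" for j
  proof -
    have "continuous_on W (u j)"
      using differentiable_imp_continuous_on[OF smooth_on_differentiable[OF u[OF that]]] continuous_on_subset
      unfolding W_def by blast
    then have "continuous_on W (\<lambda>x. norm (u j x - b j))" by (intro continuous_intros)
    then have "open (W \<inter> (\<lambda>x. norm (u j x - b j)) -` {..<\<rho>})"
      using continuous_on_open_vimage[OF W] by (metis open_lessThan Int_commute)
    moreover have "W \<inter> (\<lambda>x. norm (u j x - b j)) -` {..<\<rho>} = {x \<in> W. norm (u j x - b j) < \<rho>}" by auto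
    ultimately show ?thesis by simp
  qed
  then have V: "open V" unfolding V_def using J by (intro open_Int W open_INT) auto
  have aV: "a \<in> V" using a \<rho> by (auto simp: V_def W_def obox_def b_def)
  have VX: "V \<subseteq> X" by (auto simp: V_def W_def)
  have "smooth_on V (\<lambda>x. ps (Sum_Type.Plus UNIV J) C (joint_args a b x (\<lambda>j\<in>J. u j x)))"
  proof (rule smooth_on_ps[OF V _ _ _ ps_conv_imp_in[OF C]])
    show "finite (Sum_Type.Plus (UNIV :: 'n set) J)" using J by simp
    fix l :: "'n + 'j" assume l: "l \<in> Sum_Type.Plus UNIV J"
    show "smooth_on V (\<lambda>x. joint_args a b x (\<lambda>j\<in>J. u j x) l)"
    proof (cases l)
      case (Inl i)
      have "smooth_on V (\<lambda>x. of_real (x $ i) - of_real (a $ i))"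
        by (intro smooth_on_diff smooth_on_coordinate smooth_on_const V)
      then show ?thesis by (simp add: Inl)
    next
      case (Inr j)
      then have "j \<in> J" using l by auto
      have "smooth_on V (\<lambda>x. u j x - b j)"
        by (intro smooth_on_diff smooth_on_const V smooth_on_subset[OF u[OF \<open>j \<in> J\<close>] VX])
      then show ?thesis using \<open>j \<in> J\<close> by (simp add: Inr)
    qed
    show "norm (joint_args a b x (\<lambda>j\<in>J. u j x) l) < \<rho>" if "x \<in> V" for x
      using that l by (cases l) (auto simp: V_def W_def obox_def simp flip: of_real_diff)
  qed
  then have "smooth_on V (\<lambda>x. G x (\<lambda>j\<in>J. u j x))"
  proof (rule smooth_on_cong[OF V, rotated])
    fix x assume "x \<in> V"
    then show "ps (Sum_Type.Plus UNIV J) C (joint_args a b x (\<lambda>j\<in>J. u j x)) = G x (\<lambda>j\<in>J. u j x)"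
      using eq[of x "\<lambda>j\<in>J. u j x"] by (auto simp: V_def W_def obox_def less_imp_le)
  qed
  with V aV show "\<exists>V. open V \<and> a \<in> V \<and> smooth_on V (\<lambda>x. G x (\<lambda>j\<in>J. u j x))" by blast
qed

lemma finite_jet_indices: "finite (jet_indices k m)" for k :: "'n::finite"
proof (rule finite_subset)
  show "jet_indices k m \<subseteq> (PiE UNIV (\<lambda>_. {..m}) :: ('n \<Rightarrow> nat) set)"
  proof
    fix \<alpha> assume "\<alpha> \<in> jet_indices k m"
    then have "sum \<alpha> UNIV \<le> m" by (simp add: jet_indices_def)
    then have "\<alpha> i \<le> m" for i using member_le_sum[of i UNIV \<alpha>] by force
    then show "\<alpha> \<in> PiE UNIV (\<lambda>_. {..m})" by auto
  qed
  show "finite (PiE UNIV (\<lambda>_. {..m}) :: ('n \<Rightarrow> nat) set)" by (intro finite_PiE) auto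
qed

lemma T_op_smooth:
  assumes "open X" "analytic_in_all_variables X (jet_indices k m) G" "u \<in> smooth_functions X"
  shows "T_op X k m G u \<in> smooth_functions X"
proof -
  have u: "smooth_on X u" using assms by (simp add: smooth_functions_iff)
  have "smooth_on X (\<lambda>x. G x (\<lambda>\<alpha>\<in>jet_indices k m. multi_deriv \<alpha> u x))"
    by (rule smooth_on_analytic_composition[OF assms(1) finite_jet_indices assms(2)])
      (simp add: multi_deriv_eq_foldr smooth_on_foldr[OF u])
  moreover have "smooth_on X ((partial_deriv k ^^ m) u)"
    unfolding funpow_partial_deriv by (rule smooth_on_foldr[OF u])
  ultimately have "smooth_on X (\<lambda>x. (partial_deriv k ^^ m) u x - G x (\<lambda>\<alpha>\<in>jet_indices k m. multi_deriv \<alpha> u x))"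
    by (intro smooth_on_diff assms(1))
  then show ?thesis unfolding T_op_def by (rule smooth_on_restrict[OF assms(1)])
qed

section \<open>Smooth cutoff functions\<close>

text \<open>Polynomials in 1 / t times exp (-1 / t), continued by 0. The family is closed under
  differentiation, so smoothness of the case \<open>p = 1\<close> follows by an induction over the
  order in which \<open>p\<close> varies.\<close>

definition flat_exp :: "real poly \<Rightarrow> real \<Rightarrow> real" where
  "flat_exp p t = (if t > 0 then poly p (1 / t) * exp (- (1 / t)) else 0)"

lemma poly_div_exp_tendsto_0:
  fixes p :: "real poly"
  shows "((\<lambda>s. s ^ k * poly p s * exp (- s)) \<longlongrightarrow> 0) at_top"
proof (induction p arbitrary: k)
  case 0
  show ?case by simp
next
  case (pCons a p)
  have "((\<lambda>s::real. a * (s ^ k / exp s) + s ^ Suc k * poly p s * exp (- s)) \<longlongrightarrow> a * 0 + 0) at_top"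
    by (intro tendsto_add tendsto_mult tendsto_const tendsto_power_div_exp_0 pCons)
  then show ?case by (simp add: algebra_simps exp_minus divide_inverse)
qed

text \<open>With s = 1 / t, the derivative of p(s) exp(-s) with respect to t is s^2 (p(s) - p'(s))
  exp(-s); this is the origin of the polynomial.\<close>

lemma flat_exp_deriv:
  "(flat_exp p has_real_derivative flat_exp ([:0, 0, 1:] * (p - pderiv p)) t) (at t)"
proof -
  consider "t > 0" | "t < 0" | "t = 0" by linarith
  then show ?thesis
  proof cases
    case 1
    have "((\<lambda>t. poly p (1 / t) * exp (- (1 / t))) has_real_derivative
        poly p (1 / t) * (exp (- (1 / t)) * (1 / (t * t))) + poly (pderiv p) (1 / t) * (- 1 / (t * t)) * exp (- (1 / t))) (at t)"
      using 1 by (auto intro!: derivative_eq_intros poly_DERIV[THEN DERIV_chain2] simp: power2_eq_square)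
    moreover have "poly p (1 / t) * (exp (- (1 / t)) * (1 / (t * t))) + poly (pderiv p) (1 / t) * (- 1 / (t * t)) * exp (- (1 / t))
        = flat_exp ([:0, 0, 1:] * (p - pderiv p)) t"
      using 1 by (simp add: flat_exp_def field_simps)
    ultimately have "((\<lambda>t. poly p (1 / t) * exp (- (1 / t))) has_real_derivative flat_exp ([:0, 0, 1:] * (p - pderiv p)) t) (at t)"
      by simp
    then show ?thesis
      by (rule has_field_derivative_transform_within_open[where S = "{0<..}"]) (use 1 in \<open>auto simp: flat_exp_def\<close>)
  next
    case 2
    have "((\<lambda>t. 0) has_real_derivative 0) (at t)" by simp
    then have "(flat_exp p has_real_derivative 0) (at t)"
      by (rule has_field_derivative_transform_within_open[where S = "{..<0}"]) (use 2 in \<open>auto simp: flat_exp_def\<close>)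
    then show ?thesis using 2 by (simp add: flat_exp_def)
  next
    case 3
    \<comment> \<open>The difference quotient at 0 from the right is s p(s) exp(-s) with s = 1 /
      h.\<close>
    have "((\<lambda>s. s ^ 1 * poly p s * exp (- s)) \<longlongrightarrow> 0) at_top" by (rule poly_div_exp_tendsto_0)
    then have "((\<lambda>h. (inverse h) ^ 1 * poly p (inverse h) * exp (- inverse h)) \<longlongrightarrow> 0) (at_right 0)"
      by (rule filterlim_compose[OF _ filterlim_inverse_at_top_right])
    then have R: "((\<lambda>h. (flat_exp p h - flat_exp p 0) / (h - 0)) \<longlongrightarrow> 0) (at_right 0)"
      by (rule Lim_transform_eventually)
        (auto simp: eventually_at_right_field flat_exp_def divide_inverse mult_ac intro!: exI[of _ 1])
    have L: "((\<lambda>h. (flat_exp p h - flat_exp p 0) / (h - 0)) \<longlongrightarrow> 0) (at_left 0)"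
      by (rule Lim_transform_eventually[OF tendsto_const])
        (auto simp: eventually_at_left_field flat_exp_def intro!: exI[of _ "-1"])
    have "(flat_exp p has_real_derivative 0) (at 0)"
      unfolding has_field_derivative_iff using L R by (simp add: filterlim_split_at)
    then show ?thesis using 3 by (simp add: flat_exp_def)
  qed
qed

lemma smooth_upto_flat_exp:
  fixes s :: "real ^ 'n::finite \<Rightarrow> real"
  assumes V: "open V" and s': "\<And>x. x \<in> V \<Longrightarrow> (s has_derivative s' x) (at x)"
    and sm: "\<And>i. smooth_on V (\<lambda>x. of_real (s' x (axis i 1)))"
  shows "smooth_upto N V (\<lambda>x. of_real (flat_exp p (s x)))"
proof (induction N arbitrary: p)
  let ?D = "\<lambda>p. [:0, 0, 1:] * (p - pderiv p)"
  have d: "((\<lambda>x. complex_of_real (flat_exp p (s x))) has_derivative (\<lambda>v. of_real (flat_exp (?D p) (s x) * s' x v))) (at x)"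
    if "x \<in> V" for x p
  proof -
    have "(flat_exp p has_derivative (*) (flat_exp (?D p) (s x))) (at (s x))"
      using flat_exp_deriv[of p "s x"] by (simp add: has_field_derivative_def)
    from has_derivative_compose[OF s'[OF that] this] show ?thesis
      by (rule has_derivative_of_real)
  qed
  {
    case 0
    show ?case by (rule smooth_upto_0[OF d])
  next
    case (Suc N)
    show ?case
    proof (rule smooth_upto_SucI[OF V d])
      fix i
      show "smooth_upto N V (\<lambda>x. of_real (flat_exp (?D p) (s x) * s' x (axis i 1)))"
        unfolding of_real_mult by (intro smooth_upto_mult V Suc smooth_on_imp_upto sm)
    qed
  }
qed

lemma smooth_on_flat_exp_quadratic:
  fixes c :: "real ^ 'n::finite"
  shows "smooth_on UNIV (\<lambda>x. of_real (flat_exp p (A + B * (\<Sum>i\<in>UNIV. (x $ i - c $ i)\<^sup>2))))"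
  unfolding smooth_on_iff_upto
proof
  fix N
  let ?s' = "\<lambda>x v. B * (\<Sum>i\<in>UNIV. 2 * (x $ i - c $ i) * v $ i)"
  show "smooth_upto N UNIV (\<lambda>x. of_real (flat_exp p (A + B * (\<Sum>i\<in>UNIV. (x $ i - c $ i)\<^sup>2))))"
  proof (rule smooth_upto_flat_exp[where s' = ?s'])
    fix x :: "real ^ 'n"
    have "((\<lambda>x. x $ i) has_derivative (\<lambda>v. v $ i)) (at x)" for i
      by (intro bounded_linear_imp_has_derivative bounded_linear_vec_nth)
    then show "((\<lambda>x. A + B * (\<Sum>i\<in>UNIV. (x $ i - c $ i)\<^sup>2)) has_derivative ?s' x) (at x)"
      by (auto intro!: derivative_eq_intros sum.cong simp: mult_ac)
    fix i :: 'n
    have eq: "?s' x (axis i 1) = B * (2 * (x $ i - c $ i))" for x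
      by (simp add: axis_def if_distrib[of "\<lambda>t. _ * t"] cong: if_cong)
    have "smooth_on UNIV (\<lambda>x. of_real (2 * B) * (of_real (x $ i) - of_real (c $ i)))"
      by (intro smooth_on_mult smooth_on_const smooth_on_diff smooth_on_coordinate open_UNIV)
    then show "smooth_on UNIV (\<lambda>x. complex_of_real (?s' x (axis i 1)))"
      unfolding eq by (simp add: mult_ac)
  qed simp
qed

text \<open>The form A / (A + B) where, for \<open>r > 0\<close>, A is positive exactly at distance
  less than 2 r and B exactly at distance greater than r. The two ranges cover everything, so the
  denominator does not vanish, and where one of the terms is 0 the quotient is 0 or 1. Squared
  distances keep it smooth at the centre \<open>c\<close>.\<close>

definition bump :: "real ^ 'n::finite \<Rightarrow> real \<Rightarrow> real ^ 'n \<Rightarrow> complex" where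
  "bump c r x =
     of_real (flat_exp 1 (4 * r\<^sup>2 + (-1) * (\<Sum>i\<in>UNIV. (x $ i - c $ i)\<^sup>2))) *
     inverse (of_real (flat_exp 1 (4 * r\<^sup>2 + (-1) * (\<Sum>i\<in>UNIV. (x $ i - c $ i)\<^sup>2))) +
              of_real (flat_exp 1 (- r\<^sup>2 + 1 * (\<Sum>i\<in>UNIV. (x $ i - c $ i)\<^sup>2))))"

lemma flat_exp_pos: "t > 0 \<Longrightarrow> flat_exp 1 t > 0" and flat_exp_eq_0: "t \<le> 0 \<Longrightarrow> flat_exp p t = 0"
  and flat_exp_nonneg: "flat_exp 1 t \<ge> 0"
  by (auto simp: flat_exp_def)

lemma sum_squares_dist: "(\<Sum>i\<in>UNIV. (x $ i - c $ i)\<^sup>2) = (dist x c)\<^sup>2" for x c :: "real ^ 'n::finite"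
  by (simp add: dist_norm norm_vec_def L2_set_def sum_nonneg)

lemma bump_smooth:
  fixes c :: "real ^ 'n::finite"
  assumes "r > 0"
  shows "smooth_on UNIV (bump c r)"
  unfolding bump_def
proof (intro smooth_on_mult smooth_on_inverse smooth_on_add open_UNIV smooth_on_flat_exp_quadratic)
  fix x :: "real ^ 'n"
  let ?A = "flat_exp 1 (4 * r\<^sup>2 + (-1) * (\<Sum>i\<in>UNIV. (x $ i - c $ i)\<^sup>2))" and ?B = "flat_exp 1 (- r\<^sup>2 + 1 * (\<Sum>i\<in>UNIV. (x $ i - c $ i)\<^sup>2))"
  have "?A + ?B > 0"
  proof (cases "(\<Sum>i\<in>UNIV. (x $ i - c $ i)\<^sup>2) > r\<^sup>2")
    case True
    then have "?B > 0" by (intro flat_exp_pos) simp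
    moreover have "?A \<ge> 0" by (rule flat_exp_nonneg)
    ultimately show ?thesis by linarith
  next
    case False
    moreover have "r\<^sup>2 > 0" using assms by simp
    ultimately have "4 * r\<^sup>2 + (-1) * (\<Sum>i\<in>UNIV. (x $ i - c $ i)\<^sup>2) > 0" by linarith
    then have "?A > 0" by (rule flat_exp_pos)
    moreover have "?B \<ge> 0" by (rule flat_exp_nonneg)
    ultimately show ?thesis by linarith
  qed
  then have "complex_of_real (?A + ?B) \<noteq> 0" unfolding of_real_eq_0_iff by simp
  then show "complex_of_real ?A + complex_of_real ?B \<noteq> 0" by simp
qed

lemma bump_eq_1:
  assumes "r > 0" "dist x c \<le> r"
  shows "bump c r x = 1"
proof -
  have "(dist x c)\<^sup>2 \<le> r\<^sup>2" using assms by (intro power_mono) auto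
  moreover have "r\<^sup>2 > 0" using assms by simp
  ultimately have "4 * r\<^sup>2 - (dist x c)\<^sup>2 > 0" "(dist x c)\<^sup>2 - r\<^sup>2 \<le> 0" by linarith+
  then have "flat_exp 1 (4 * r\<^sup>2 - (dist x c)\<^sup>2) > 0" "flat_exp 1 ((dist x c)\<^sup>2 - r\<^sup>2) = 0"
    by (auto intro!: flat_exp_pos flat_exp_eq_0)
  then show ?thesis by (simp add: bump_def sum_squares_dist)
qed

lemma bump_eq_0:
  assumes "r > 0" "dist x c \<ge> 2 * r"
  shows "bump c r x = 0"
proof -
  have "(2 * r)\<^sup>2 \<le> (dist x c)\<^sup>2" using assms by (intro power_mono) auto
  then have "flat_exp 1 (4 * r\<^sup>2 - (dist x c)\<^sup>2) = 0"
    by (intro flat_exp_eq_0) (simp add: power2_eq_square)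
  then show ?thesis by (simp add: bump_def sum_squares_dist)
qed

section \<open>A weighted algebra of power series\<close>

definition below :: "('n \<Rightarrow> nat) \<Rightarrow> ('n \<Rightarrow> nat) set" where
  "below \<alpha> = PiE UNIV (\<lambda>i. {..\<alpha> i})"

lemma below_iff: "\<beta> \<in> below \<alpha> \<longleftrightarrow> (\<forall>i. \<beta> i \<le> \<alpha> i)"
  by (auto simp: below_def)

lemma finite_below: "finite (below \<alpha>)" for \<alpha> :: "'n::finite \<Rightarrow> nat"
  unfolding below_def by (intro finite_PiE) auto

definition cauchy_prod :: "(('n \<Rightarrow> nat) \<Rightarrow> complex) \<Rightarrow> (('n \<Rightarrow> nat) \<Rightarrow> complex) \<Rightarrow> ('n \<Rightarrow> nat) \<Rightarrow> complex" where
  "cauchy_prod c d \<alpha> = (\<Sum>\<beta>\<in>below \<alpha>. c \<beta> * d (\<lambda>i. \<alpha> i - \<beta> i))"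

text \<open>Absolute convergence allows the product to be summed over all pairs and then along the
  fibres \<beta> + \<gamma> = \<alpha>, which are parametrised by the finite sets
  \<open>below \<alpha>\<close>.\<close>

lemma ps_cauchy_prod:
  fixes c d :: "('n::finite \<Rightarrow> nat) \<Rightarrow> complex"
  assumes "ps_conv UNIV c \<rho>" "ps_conv UNIV d \<rho>" "\<And>i. norm (z i) \<le> \<rho> i"
  shows "ps UNIV (cauchy_prod c d) z = ps UNIV c z * ps UNIV d z"
proof -
  let ?A = "\<lambda>\<beta>. c \<beta> * mpow UNIV z \<beta>" and ?B = "\<lambda>\<gamma>. d \<gamma> * mpow UNIV z \<gamma>"
  define f where "f = (\<lambda>(\<beta>, \<gamma>). ?A \<beta> * ?B \<gamma>)"
  have A: "(\<lambda>\<beta>. norm (?A \<beta>)) summable_on UNIV" and B: "(\<lambda>\<beta>. norm (?B \<beta>)) summable_on UNIV"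
    using ps_abs_summable[OF assms(1)] ps_abs_summable[OF assms(2)] assms(3) by simp_all
  have "(\<lambda>p. norm (f p)) summable_on (UNIV \<times> UNIV)"
  proof (subst Infinite_Sum.abs_summable_on_Sigma_iff, intro conjI ballI)
    show "(\<lambda>\<gamma>. norm (f (\<beta>, \<gamma>))) summable_on UNIV" for \<beta>
      unfolding f_def prod.case norm_mult[of "?A \<beta>"] by (rule summable_on_cmult_right[OF B])
    have "(\<lambda>\<beta>. norm (?A \<beta>) * infsum (\<lambda>\<gamma>. norm (?B \<gamma>)) UNIV) summable_on UNIV"
      by (rule summable_on_cmult_left[OF A])
    moreover have "infsum (\<lambda>\<gamma>. norm (f (\<beta>, \<gamma>))) UNIV = norm (?A \<beta>) * infsum (\<lambda>\<gamma>. norm (?B \<gamma>)) UNIV" for \<beta>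
      unfolding f_def prod.case norm_mult[of "?A \<beta>"] by (rule infsum_cmult_right')
    ultimately show "(\<lambda>\<beta>. norm (infsum (\<lambda>\<gamma>. norm (f (\<beta>, \<gamma>))) UNIV)) summable_on UNIV"
      by (simp add: infsum_nonneg abs_mult)
  qed
  then have f: "f summable_on (UNIV \<times> UNIV)" by (rule abs_summable_summable)
  define \<phi> where "\<phi> = (\<lambda>(\<alpha>, \<beta>). (\<beta>, \<lambda>i. \<alpha> i - \<beta> i :: nat) :: ('n \<Rightarrow> nat) \<times> ('n \<Rightarrow> nat))"
  have bij: "bij_betw \<phi> (Sigma UNIV below) (UNIV \<times> UNIV)"
    unfolding \<phi>_def
    by (rule bij_betwI[where g = "\<lambda>(\<beta>, \<gamma>). (\<lambda>i. \<beta> i + \<gamma> i, \<beta>)"]) (auto simp: below_iff)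
  have f\<phi>: "(\<lambda>p. f (\<phi> p)) summable_on (Sigma UNIV below)"
    using f by (subst summable_on_reindex_bij_betw[OF bij])
  have "ps UNIV c z * ps UNIV d z = infsum f (UNIV \<times> UNIV)"
  proof -
    have "infsum f (UNIV \<times> UNIV) = infsum (\<lambda>\<beta>. infsum (\<lambda>\<gamma>. ?A \<beta> * ?B \<gamma>) UNIV) UNIV"
      using infsum_Sigma_banach[OF f] by (simp add: f_def)
    also have "\<dots> = ps UNIV c z * ps UNIV d z"
      unfolding infsum_cmult_right' infsum_cmult_left' by (simp add: ps_def)
    finally show ?thesis by simp
  qed
  also have "\<dots> = infsum (\<lambda>p. f (\<phi> p)) (Sigma UNIV below)"
    by (rule infsum_reindex_bij_betw[OF bij, symmetric])
  also have "\<dots> = infsum (\<lambda>\<alpha>. infsum (\<lambda>\<beta>. f (\<phi> (\<alpha>, \<beta>))) (below \<alpha>)) UNIV"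
    by (rule infsum_Sigma_banach[OF f\<phi>, symmetric])
  also have "\<dots> = infsum (\<lambda>\<alpha>. cauchy_prod c d \<alpha> * mpow UNIV z \<alpha>) UNIV"
  proof (rule infsum_cong)
    fix \<alpha> :: "'n \<Rightarrow> nat"
    have "f (\<phi> (\<alpha>, \<beta>)) = c \<beta> * d (\<lambda>i. \<alpha> i - \<beta> i) * mpow UNIV z \<alpha>" if "\<beta> \<in> below \<alpha>" for \<beta>
    proof -
      have "mpow UNIV z \<beta> * mpow UNIV z (\<lambda>i. \<alpha> i - \<beta> i) = mpow UNIV z \<alpha>"
        using that by (simp add: mpow_def below_iff flip: prod.distrib power_add)
      then show ?thesis by (simp add: f_def \<phi>_def mult_ac)
    qed
    then show "infsum (\<lambda>\<beta>. f (\<phi> (\<alpha>, \<beta>))) (below \<alpha>) = cauchy_prod c d \<alpha> * mpow UNIV z \<alpha>"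
      by (simp add: finite_below cauchy_prod_def sum_distrib_right)
  qed
  finally show ?thesis by (simp add: ps_def)
qed

lemma choose_mult_le: "(m choose a) * (n choose b) \<le> (m + n) choose (a + b)"
proof -
  have "(m choose a) * (n choose (a + b - a)) \<le> (\<Sum>k\<le>a + b. (m choose k) * (n choose (a + b - k)))"
    by (rule member_le_sum) auto
  then show ?thesis by (simp add: vandermonde)
qed

lemma has_sum_finite_sum:
  fixes f :: "'a \<Rightarrow> 'b \<Rightarrow> real"
  assumes "\<And>\<alpha>. \<alpha> \<in> F \<Longrightarrow> f \<alpha> summable_on A"
  shows "((\<lambda>\<delta>. \<Sum>\<alpha>\<in>F. f \<alpha> \<delta>) has_sum (\<Sum>\<alpha>\<in>F. infsum (f \<alpha>) A)) A"
  using assms by (induction F rule: infinite_finite_induct) (auto intro!: has_sum_add)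

text \<open>
  The binomial denominator makes the operator
  \<open>D\<^sub>y D\<^sub>t\<^sup>-\<^sup>1\<close> bounded by \<open>\<tau> / r\<close>, while
  Vandermonde's identity keeps the weight submultiplicative.
\<close>

locale weighted =
  fixes k :: "'n::finite" and \<tau> r :: real
  assumes \<tau>_pos: "0 < \<tau>" and r_pos: "0 < r"
begin

definition rest :: "('n \<Rightarrow> nat) \<Rightarrow> nat" where
  "rest \<alpha> = (\<Sum>i\<in>UNIV - {k}. \<alpha> i)"

definition wt :: "('n \<Rightarrow> nat) \<Rightarrow> real" where
  "wt \<alpha> = \<tau> ^ \<alpha> k * r ^ rest \<alpha> / real ((\<alpha> k + rest \<alpha>) choose \<alpha> k)"

text \<open>Half the scales, because the binomial coefficient in \<open>wt\<close> can only be
  bounded by 2 to the power of the degree; at half the radii each monomial is dominated by its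
  weight.\<close>

definition rad :: "'n \<Rightarrow> real" where
  "rad i = (if i = k then \<tau> / 2 else r / 2)"

text \<open>
  Bounding finite partial sums avoids the junk value \<open>0\<close> of \<open>infsum\<close> on families that are not summable.
\<close>

definition wnorm_le :: "(('n \<Rightarrow> nat) \<Rightarrow> complex) \<Rightarrow> real \<Rightarrow> bool" where
  "wnorm_le c M \<longleftrightarrow> (\<forall>F. finite F \<longrightarrow> (\<Sum>\<alpha>\<in>F. norm (c \<alpha>) * wt \<alpha>) \<le> M)"

definition closed_box :: "real ^ 'n \<Rightarrow> (real ^ 'n) set" where
  "closed_box a = {x. \<forall>i. \<bar>x $ i - a $ i\<bar> \<le> rad i}"

lemma rest_add: "rest (\<lambda>i. \<alpha> i + \<beta> i) = rest \<alpha> + rest \<beta>"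
  by (simp add: rest_def sum.distrib)

lemma degree_split: "(\<Sum>i\<in>UNIV. \<alpha> i) = \<alpha> k + rest \<alpha>"
  by (simp add: rest_def sum.remove[of UNIV k])

lemma wt_pos: "wt \<alpha> > 0"
  using \<tau>_pos r_pos by (simp add: wt_def)

lemma wt_nonneg: "wt \<alpha> \<ge> 0" using wt_pos less_imp_le by blast

lemma wt_add: "wt (\<lambda>i. \<alpha> i + \<beta> i) \<le> wt \<alpha> * wt \<beta>"
proof -
  let ?C1 = "real ((\<alpha> k + rest \<alpha>) choose \<alpha> k)" and ?C2 = "real ((\<beta> k + rest \<beta>) choose \<beta> k)"
  let ?C = "real ((\<alpha> k + \<beta> k + (rest \<alpha> + rest \<beta>)) choose (\<alpha> k + \<beta> k))"
  have "((\<alpha> k + rest \<alpha>) choose \<alpha> k) * ((\<beta> k + rest \<beta>) choose \<beta> k) \<le> (\<alpha> k + \<beta> k + (rest \<alpha> + rest \<beta>)) choose (\<alpha> k + \<beta> k)"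
    using choose_mult_le[of "\<alpha> k + rest \<alpha>" "\<alpha> k" "\<beta> k + rest \<beta>" "\<beta> k"] by (simp add: add_ac)
  then have C: "?C1 * ?C2 \<le> ?C" by (metis of_nat_le_iff of_nat_mult)
  have "\<tau> ^ (\<alpha> k + \<beta> k) * r ^ (rest \<alpha> + rest \<beta>) / ?C \<le> \<tau> ^ (\<alpha> k + \<beta> k) * r ^ (rest \<alpha> + rest \<beta>) / (?C1 * ?C2)"
    by (rule divide_left_mono[OF C]) (use \<tau>_pos r_pos in simp_all)
  then show ?thesis by (simp add: wt_def rest_add power_add mult_ac)
qed

lemma mpow_split: "mpow UNIV z \<alpha> = z k ^ \<alpha> k * (\<Prod>i\<in>UNIV - {k}. z i ^ \<alpha> i)"
  unfolding mpow_def by (subst prod.remove[of UNIV k]) auto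

lemma mpow_rad: "mpow UNIV rad \<alpha> = (\<tau> / 2) ^ \<alpha> k * (r / 2) ^ rest \<alpha>"
proof -
  have "(\<Prod>i\<in>UNIV - {k}. rad i ^ \<alpha> i) = (\<Prod>i\<in>UNIV - {k}. (r / 2) ^ \<alpha> i)"
    by (intro prod.cong) (auto simp: rad_def)
  then show ?thesis unfolding mpow_split rest_def power_sum by (simp add: rad_def)
qed

lemma mpow_rad_le_wt: "mpow UNIV rad \<alpha> \<le> wt \<alpha>"
proof -
  let ?C = "(\<alpha> k + rest \<alpha>) choose \<alpha> k"
  have "real ?C \<le> 2 ^ (\<alpha> k + rest \<alpha>)"
    using binomial_le_pow2[of "\<alpha> k + rest \<alpha>" "\<alpha> k"] by (metis of_nat_le_iff of_nat_numeral of_nat_power)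
  then have "\<tau> ^ \<alpha> k * r ^ rest \<alpha> / 2 ^ (\<alpha> k + rest \<alpha>) \<le> \<tau> ^ \<alpha> k * r ^ rest \<alpha> / real ?C"
    by (intro divide_left_mono) (use \<tau>_pos r_pos in simp_all)
  then show ?thesis by (simp add: mpow_rad wt_def power_divide power_add)
qed

lemma rad_pos: "rad i > 0" using \<tau>_pos r_pos by (simp add: rad_def)

lemma wt_le: "wt \<alpha> \<le> \<tau> ^ \<alpha> k * r ^ rest \<alpha>"
proof -
  have "(1::real) \<le> real ((\<alpha> k + rest \<alpha>) choose \<alpha> k)"
    by (metis One_nat_def Suc_leI le_add1 of_nat_1 of_nat_le_iff zero_less_binomial)
  then have "\<tau> ^ \<alpha> k * r ^ rest \<alpha> / real ((\<alpha> k + rest \<alpha>) choose \<alpha> k) \<le> \<tau> ^ \<alpha> k * r ^ rest \<alpha> / 1"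
    by (intro divide_left_mono) (use \<tau>_pos r_pos in simp_all)
  then show ?thesis by (simp add: wt_def)
qed

lemma wnorm_leD: "wnorm_le c M \<Longrightarrow> finite F \<Longrightarrow> (\<Sum>\<alpha>\<in>F. norm (c \<alpha>) * wt \<alpha>) \<le> M"
  by (simp add: wnorm_le_def)

lemma wnorm_le_nonneg: "wnorm_le c M \<Longrightarrow> 0 \<le> M"
  using wnorm_leD[of c M "{}"] by simp

lemma wnorm_le_mono: "wnorm_le c M \<Longrightarrow> M \<le> N \<Longrightarrow> wnorm_le c N"
  unfolding wnorm_le_def by (meson order_trans)

lemma wnorm_le_single: "wnorm_le c M \<Longrightarrow> norm (c \<alpha>) * wt \<alpha> \<le> M"
  using wnorm_leD[of c M "{\<alpha>}"] by simp

lemma wnorm_le_summable: "wnorm_le c M \<Longrightarrow> (\<lambda>\<alpha>. norm (c \<alpha>) * wt \<alpha>) summable_on UNIV"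
  by (rule nonneg_bdd_above_summable_on) (auto simp: wt_nonneg wnorm_leD intro!: bdd_aboveI2[where M = M])

lemma wnorm_le_add:
  assumes "wnorm_le c M" "wnorm_le d N" shows "wnorm_le (\<lambda>\<alpha>. c \<alpha> + d \<alpha>) (M + N)"
  unfolding wnorm_le_def
proof (intro allI impI)
  fix F :: "('n \<Rightarrow> nat) set" assume F: "finite F"
  have "(\<Sum>\<alpha>\<in>F. norm (c \<alpha> + d \<alpha>) * wt \<alpha>) \<le> (\<Sum>\<alpha>\<in>F. norm (c \<alpha>) * wt \<alpha> + norm (d \<alpha>) * wt \<alpha>)"
    by (intro sum_mono) (simp add: norm_triangle_ineq wt_nonneg mult_right_mono flip: distrib_right)
  also have "\<dots> \<le> M + N" using assms F by (simp add: sum.distrib wnorm_leD add_mono)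
  finally show "(\<Sum>\<alpha>\<in>F. norm (c \<alpha> + d \<alpha>) * wt \<alpha>) \<le> M + N" .
qed

text \<open>The pairs that occur in a finite partial sum are injectively indexed and lie in a finite
  rectangle, over which the sum of products factors into two partial sums. Submultiplicativity of
  \<open>wt\<close> enters once per pair.\<close>

lemma wnorm_le_cauchy_prod:
  assumes c: "wnorm_le c M" and d: "wnorm_le d N" shows "wnorm_le (cauchy_prod c d) (M * N)"
  unfolding wnorm_le_def
proof (intro allI impI)
  fix F :: "('n \<Rightarrow> nat) set" assume F: "finite F"
  define g where "g = (\<lambda>(\<beta>, \<gamma>). (norm (c \<beta>) * wt \<beta>) * (norm (d \<gamma>) * wt \<gamma>))"
  define \<phi> where "\<phi> = (\<lambda>(\<alpha>, \<beta>). (\<beta>, \<lambda>i. \<alpha> i - \<beta> i :: nat) :: ('n \<Rightarrow> nat) \<times> ('n \<Rightarrow> nat))"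
  let ?S = "Sigma F below"
  have S: "finite ?S" using F finite_below by blast
  have inj: "inj_on \<phi> ?S"
    by (rule inj_on_inverseI[where g = "\<lambda>(\<beta>, \<gamma>). (\<lambda>i. \<beta> i + \<gamma> i, \<beta>)"]) (auto simp: \<phi>_def below_iff)
  have "(\<Sum>\<alpha>\<in>F. norm (cauchy_prod c d \<alpha>) * wt \<alpha>) \<le> (\<Sum>\<alpha>\<in>F. \<Sum>\<beta>\<in>below \<alpha>. g (\<phi> (\<alpha>, \<beta>)))"
  proof (rule sum_mono)
    fix \<alpha>
    have "norm (cauchy_prod c d \<alpha>) * wt \<alpha> \<le> (\<Sum>\<beta>\<in>below \<alpha>. norm (c \<beta> * d (\<lambda>i. \<alpha> i - \<beta> i))) * wt \<alpha>"
      unfolding cauchy_prod_def by (intro mult_right_mono norm_sum wt_nonneg)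
    also have "\<dots> \<le> (\<Sum>\<beta>\<in>below \<alpha>. g (\<phi> (\<alpha>, \<beta>)))"
      unfolding sum_distrib_right
    proof (rule sum_mono)
      fix \<beta> assume b: "\<beta> \<in> below \<alpha>"
      have "wt \<alpha> \<le> wt \<beta> * wt (\<lambda>i. \<alpha> i - \<beta> i)"
        using wt_add[of \<beta> "\<lambda>i. \<alpha> i - \<beta> i"] b by (simp add: below_iff)
      then have "norm (c \<beta> * d (\<lambda>i. \<alpha> i - \<beta> i)) * wt \<alpha> \<le> norm (c \<beta> * d (\<lambda>i. \<alpha> i - \<beta> i)) * (wt \<beta> * wt (\<lambda>i. \<alpha> i - \<beta> i))"
        by (intro mult_left_mono) auto
      then show "norm (c \<beta> * d (\<lambda>i. \<alpha> i - \<beta> i)) * wt \<alpha> \<le> g (\<phi> (\<alpha>, \<beta>))"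
        by (simp add: g_def \<phi>_def norm_mult mult_ac)
    qed
    finally show "norm (cauchy_prod c d \<alpha>) * wt \<alpha> \<le> (\<Sum>\<beta>\<in>below \<alpha>. g (\<phi> (\<alpha>, \<beta>)))" .
  qed
  also have "\<dots> = (\<Sum>p\<in>?S. g (\<phi> p))"
    using F finite_below by (subst sum.Sigma) auto
  also have "\<dots> = sum g (\<phi> ` ?S)" by (simp add: sum.reindex[OF inj])
  also have "\<dots> \<le> sum g (fst ` \<phi> ` ?S \<times> snd ` \<phi> ` ?S)"
  proof (rule sum_mono2)
    show "\<phi> ` ?S \<subseteq> fst ` \<phi> ` ?S \<times> snd ` \<phi> ` ?S" by (rule subset_fst_snd)
    show "0 \<le> g p" for p by (cases p) (simp add: g_def wt_nonneg)
  qed (use S in auto)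
  also have "\<dots> = (\<Sum>\<beta>\<in>fst ` \<phi> ` ?S. norm (c \<beta>) * wt \<beta>) * (\<Sum>\<gamma>\<in>snd ` \<phi> ` ?S. norm (d \<gamma>) * wt \<gamma>)"
    unfolding sum_product g_def by (subst sum.cartesian_product) auto
  also have "\<dots> \<le> M * N"
    using S by (intro mult_mono wnorm_leD[OF c] wnorm_leD[OF d] wnorm_le_nonneg[OF c] sum_nonneg) (auto simp: wt_nonneg)
  finally show "(\<Sum>\<alpha>\<in>F. norm (cauchy_prod c d \<alpha>) * wt \<alpha>) \<le> M * N" .
qed

lemma wnorm_le_ps_conv: "wnorm_le c M \<Longrightarrow> ps_conv UNIV c rad"
  unfolding ps_conv_def PiE_UNIV_domain
  by (simp, rule summable_on_le[OF wnorm_le_summable]) (auto intro!: mult_left_mono mult_nonneg_nonneg mpow_rad_le_wt mpow_nonneg less_imp_le[OF rad_pos])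

lemma wnorm_le_infsum_bound:
  assumes "wnorm_le c M" "\<And>i. norm (z i) \<le> rad i"
  shows "infsum (\<lambda>\<beta>. norm (c \<beta> * mpow UNIV z \<beta>)) UNIV \<le> M"
proof (rule infsum_le_finite_sums)
  show "(\<lambda>\<beta>. norm (c \<beta> * mpow UNIV z \<beta>)) summable_on UNIV"
    using ps_abs_summable[OF wnorm_le_ps_conv[OF assms(1)]] assms(2) by simp
  fix F :: "('n \<Rightarrow> nat) set" assume F: "finite F"
  have "(\<Sum>\<beta>\<in>F. norm (c \<beta> * mpow UNIV z \<beta>)) \<le> (\<Sum>\<beta>\<in>F. norm (c \<beta>) * wt \<beta>)"
  proof (rule sum_mono)
    fix \<beta> 
    have "norm (mpow UNIV z \<beta>) \<le> mpow UNIV rad \<beta>"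
      unfolding norm_mpow by (rule mpow_mono) (use assms(2) in auto)
    also have "\<dots> \<le> wt \<beta>" by (rule mpow_rad_le_wt)
    finally show "norm (c \<beta> * mpow UNIV z \<beta>) \<le> norm (c \<beta>) * wt \<beta>"
      by (simp add: norm_mult mult_left_mono)
  qed
  also have "\<dots> \<le> M" by (rule wnorm_leD[OF assms(1) F])
  finally show "(\<Sum>\<beta>\<in>F. norm (c \<beta> * mpow UNIV z \<beta>)) \<le> M" .
qed

lemma closed_box_norm: "x \<in> closed_box a \<Longrightarrow> norm (complex_of_real (x $ i - a $ i)) \<le> rad i"
  unfolding closed_box_def norm_of_real by simp

lemma wnorm_le_norm_rps:
  assumes "wnorm_le c M" "x \<in> closed_box a"
  shows "norm (rps a c x) \<le> M"
proof -
  have "norm (rps a c x) \<le> infsum (\<lambda>\<beta>. norm (c \<beta> * mpow UNIV (\<lambda>i. of_real (x $ i - a $ i)) \<beta>)) UNIV"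
    unfolding rps_def ps_def PiE_UNIV_domain
    using norm_infsum_bound[OF ps_abs_summable[OF wnorm_le_ps_conv[OF assms(1)], of "\<lambda>i. of_real (x $ i - a $ i)"]]
    closed_box_norm[OF assms(2)] by simp
  also have "\<dots> \<le> M" by (rule wnorm_le_infsum_bound[OF assms(1) closed_box_norm[OF assms(2)]])
  finally show ?thesis .
qed

text \<open>
  \<open>jrel\<close> carries the two invariants of the iteration at once: a common bound of the norms (take
  \<open>f = g\<close>) and agreement of the coefficients below order \<open>j\<close> in the variable \<open>x $ k\<close>.
\<close>

definition jrel :: "real ^ 'n \<Rightarrow> nat \<Rightarrow> real \<Rightarrow> (real ^ 'n \<Rightarrow> complex) \<Rightarrow> (real ^ 'n \<Rightarrow> complex) \<Rightarrow> bool" where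
  "jrel a j M f g \<longleftrightarrow> (\<exists>c d. wnorm_le c M \<and> wnorm_le d M \<and> (\<forall>x\<in>closed_box a. f x = rps a c x \<and> g x = rps a d x) \<and>
     (\<forall>\<alpha>. \<alpha> k < j \<longrightarrow> c \<alpha> = d \<alpha>))"

lemma jrelI:
  "wnorm_le c M \<Longrightarrow> wnorm_le d M \<Longrightarrow> (\<And>x. x \<in> closed_box a \<Longrightarrow> f x = rps a c x) \<Longrightarrow> (\<And>x. x \<in> closed_box a \<Longrightarrow> g x = rps a d x) \<Longrightarrow>
   (\<And>\<alpha>. \<alpha> k < j \<Longrightarrow> c \<alpha> = d \<alpha>) \<Longrightarrow> jrel a j M f g"
  unfolding jrel_def by blast

text \<open>A product coefficient at \<open>\<alpha>\<close> involves only coefficients at \<beta>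
  and \<alpha> - \<beta>, of order at most \<open>\<alpha> k\<close> in the distinguished variable,
  so agreement below order \<open>j\<close> survives.\<close>

lemma jrel_mult:
  assumes "jrel a j M f g" "jrel a j N f' g'"
  shows "jrel a j (M * N) (\<lambda>x. f x * f' x) (\<lambda>x. g x * g' x)"
proof -
  obtain c d where c: "wnorm_le c M" "wnorm_le d M" "\<And>x. x \<in> closed_box a \<Longrightarrow> f x = rps a c x \<and> g x = rps a d x"
    "\<And>\<alpha>. \<alpha> k < j \<Longrightarrow> c \<alpha> = d \<alpha>" using assms(1) unfolding jrel_def by blast
  obtain c' d' where c': "wnorm_le c' N" "wnorm_le d' N" "\<And>x. x \<in> closed_box a \<Longrightarrow> f' x = rps a c' x \<and> g' x = rps a d' x"
    "\<And>\<alpha>. \<alpha> k < j \<Longrightarrow> c' \<alpha> = d' \<alpha>" using assms(2) unfolding jrel_def by blast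
  have ev: "rps a (cauchy_prod e e') x = rps a e x * rps a e' x" if "wnorm_le e M" "wnorm_le e' N" "x \<in> closed_box a" for e e' x
    unfolding rps_def by (rule ps_cauchy_prod[OF wnorm_le_ps_conv[OF that(1)] wnorm_le_ps_conv[OF that(2)] closed_box_norm[OF that(3)]])
  have "cauchy_prod c c' \<alpha> = cauchy_prod d d' \<alpha>" if "\<alpha> k < j" for \<alpha>
    unfolding cauchy_prod_def
  proof (rule sum.cong[OF refl])
    fix \<beta> assume "\<beta> \<in> below \<alpha>"
    then have "\<beta> k \<le> \<alpha> k" by (simp add: below_iff)
    with that have "\<beta> k < j" "\<alpha> k - \<beta> k < j" by auto
    then show "c \<beta> * c' (\<lambda>i. \<alpha> i - \<beta> i) = d \<beta> * d' (\<lambda>i. \<alpha> i - \<beta> i)"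
      using c(4) c'(4) by simp
  qed
  then show ?thesis
    by (intro jrelI[of "cauchy_prod c c'" _ "cauchy_prod d d'"] wnorm_le_cauchy_prod c c') (use ev c c' in auto)
qed

lemma wt_0: "wt (\<lambda>_. 0) = 1" by (simp add: wt_def rest_def)

lemma rps_indicator:
  "rps a (\<lambda>\<alpha>. if \<alpha> = \<beta> then s else 0) x = s * mpow UNIV (\<lambda>i. of_real (x $ i - a $ i)) \<beta>"
proof -
  have "rps a (\<lambda>\<alpha>. if \<alpha> = \<beta> then s else 0) x
      = infsum (\<lambda>\<alpha>. (if \<alpha> = \<beta> then s else 0) * mpow UNIV (\<lambda>i. of_real (x $ i - a $ i)) \<alpha>) {\<beta>}"
    unfolding rps_def ps_def by (rule infsum_cong_neutral) auto
  then show ?thesis by simp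
qed

lemma wnorm_le_indicator: "wnorm_le (\<lambda>\<alpha>. if \<alpha> = \<beta> then s else 0) (norm s * wt \<beta>)"
  unfolding wnorm_le_def
proof (intro allI impI)
  fix F :: "('n \<Rightarrow> nat) set" assume F: "finite F"
  have "(\<Sum>\<alpha>\<in>F. norm (if \<alpha> = \<beta> then s else 0) * wt \<alpha>) = (\<Sum>\<alpha>\<in>F. if \<alpha> = \<beta> then norm s * wt \<beta> else 0)"
    by (intro sum.cong) auto
  also have "\<dots> \<le> norm s * wt \<beta>" using F by (simp add: wt_nonneg)
  finally show "(\<Sum>\<alpha>\<in>F. norm (if \<alpha> = \<beta> then s else 0) * wt \<alpha>) \<le> norm s * wt \<beta>" .
qed

lemma jrel_const: "jrel a j (norm s) (\<lambda>_. s) (\<lambda>_. s)"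
  by (rule jrelI[of "\<lambda>\<alpha>. if \<alpha> = (\<lambda>_. 0) then s else 0" _ "\<lambda>\<alpha>. if \<alpha> = (\<lambda>_. 0) then s else 0"])
    (use wnorm_le_indicator[of "\<lambda>_. 0" s] in \<open>auto simp: wt_0 rps_indicator mpow_def\<close>)

lemma jrel_power:
  assumes "jrel a j M f g" shows "jrel a j (M ^ n) (\<lambda>x. f x ^ n) (\<lambda>x. g x ^ n)"
proof (induction n)
  case 0
  show ?case using jrel_const[of a j 1] by simp
next
  case (Suc n)
  then show ?case using jrel_mult[OF assms Suc] by simp
qed

lemma jrel_prod:
  assumes "\<And>l. l \<in> I \<Longrightarrow> jrel a j (M l) (f l) (g l)"
  shows "jrel a j (\<Prod>l\<in>I. M l) (\<lambda>x. \<Prod>l\<in>I. f l x) (\<lambda>x. \<Prod>l\<in>I. g l x)"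
  using assms
proof (induction I rule: infinite_finite_induct)
  case (insert l I)
  then show ?case using jrel_mult[of a j "M l" "f l" "g l"] by simp
qed (use jrel_const[of a j 1] in simp_all)

text \<open>Coefficients are summed over \<open>\<delta>\<close> one by one: the summable bounds
  \<open>M \<delta>\<close> give the existence of these sums, the norm of the total, and the
  interchange that identifies the resulting series with the pointwise sum.\<close>

lemma jrel_infsum:
  assumes rel: "\<And>\<delta>. \<delta> \<in> A \<Longrightarrow> jrel a j (M \<delta>) (f \<delta>) (g \<delta>)" and M: "M summable_on A"
  shows "jrel a j (infsum M A) (\<lambda>x. infsum (\<lambda>\<delta>. f \<delta> x) A) (\<lambda>x. infsum (\<lambda>\<delta>. g \<delta> x) A)"
proof -
  let ?P = "\<lambda>\<delta> c d. wnorm_le c (M \<delta>) \<and> wnorm_le d (M \<delta>) \<and> (\<forall>x\<in>closed_box a. f \<delta> x = rps a c x \<and> g \<delta> x = rps a d x) \<and>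
     (\<forall>\<alpha>. \<alpha> k < j \<longrightarrow> c \<alpha> = d \<alpha>)"
  have "\<forall>\<delta>\<in>A. \<exists>c. \<exists>d. ?P \<delta> c d" using rel unfolding jrel_def by blast
  then obtain c where "\<forall>\<delta>\<in>A. \<exists>d. ?P \<delta> (c \<delta>) d" by (rule bchoice[THEN exE])
  then obtain d where P: "\<forall>\<delta>\<in>A. ?P \<delta> (c \<delta>) (d \<delta>)" by (rule bchoice[THEN exE])
  have main1: "wnorm_le (\<lambda>\<alpha>. infsum (\<lambda>\<delta>. e \<delta> \<alpha>) A) (infsum M A)"
    if e: "\<And>\<delta>. \<delta> \<in> A \<Longrightarrow> wnorm_le (e \<delta>) (M \<delta>)" for e
  proof -
    have s: "(\<lambda>\<delta>. norm (e \<delta> \<alpha>) * wt \<alpha>) summable_on A" for \<alpha>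
      by (rule summable_on_le[OF M]) (use wnorm_le_single[OF e] wt_nonneg in auto)
    have s': "(\<lambda>\<delta>. norm (e \<delta> \<alpha>)) summable_on A" for \<alpha>
      using s[of \<alpha>] wt_pos[of \<alpha>] by (simp add: summable_on_cmult_left')
    show "wnorm_le (\<lambda>\<alpha>. infsum (\<lambda>\<delta>. e \<delta> \<alpha>) A) (infsum M A)"
      unfolding wnorm_le_def
    proof (intro allI impI)
      fix F :: "('n \<Rightarrow> nat) set" assume F: "finite F"
      have "(\<Sum>\<alpha>\<in>F. norm (infsum (\<lambda>\<delta>. e \<delta> \<alpha>) A) * wt \<alpha>) \<le> (\<Sum>\<alpha>\<in>F. infsum (\<lambda>\<delta>. norm (e \<delta> \<alpha>) * wt \<alpha>) A)"
      proof (rule sum_mono)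
        fix \<alpha>
        have "norm (infsum (\<lambda>\<delta>. e \<delta> \<alpha>) A) * wt \<alpha> \<le> infsum (\<lambda>\<delta>. norm (e \<delta> \<alpha>)) A * wt \<alpha>"
          by (intro mult_right_mono norm_infsum_bound s' wt_nonneg)
        then show "norm (infsum (\<lambda>\<delta>. e \<delta> \<alpha>) A) * wt \<alpha> \<le> infsum (\<lambda>\<delta>. norm (e \<delta> \<alpha>) * wt \<alpha>) A"
          by (simp add: infsum_cmult_left')
      qed
      also have "\<dots> = infsum (\<lambda>\<delta>. \<Sum>\<alpha>\<in>F. norm (e \<delta> \<alpha>) * wt \<alpha>) A"
        by (rule infsumI[symmetric, OF has_sum_finite_sum[OF s]])
      also have "\<dots> \<le> infsum M A"
        using F s by (intro infsum_mono M wnorm_leD[OF e] has_sum_imp_summable[OF has_sum_finite_sum]) auto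
      finally show "(\<Sum>\<alpha>\<in>F. norm (infsum (\<lambda>\<delta>. e \<delta> \<alpha>) A) * wt \<alpha>) \<le> infsum M A" .
    qed
  qed
  have main2: "infsum (\<lambda>\<delta>. h \<delta> x) A = rps a (\<lambda>\<alpha>. infsum (\<lambda>\<delta>. e \<delta> \<alpha>) A) x"
    if e: "\<And>\<delta>. \<delta> \<in> A \<Longrightarrow> wnorm_le (e \<delta>) (M \<delta>)" and h: "\<And>\<delta>. \<delta> \<in> A \<Longrightarrow> h \<delta> x = rps a (e \<delta>) x"
      and x: "x \<in> closed_box a" for e h x
  proof -
    let ?z = "\<lambda>i. complex_of_real (x $ i - a $ i)"
    let ?T = "\<lambda>(\<delta>, \<alpha>). e \<delta> \<alpha> * mpow UNIV ?z \<alpha>"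
    have "(\<lambda>p. norm (?T p)) summable_on (A \<times> UNIV)"
    proof (subst Infinite_Sum.abs_summable_on_Sigma_iff, intro conjI ballI)
      show 1: "(\<lambda>\<alpha>. norm (?T (\<delta>, \<alpha>))) summable_on UNIV" if "\<delta> \<in> A" for \<delta>
        using ps_abs_summable[OF wnorm_le_ps_conv[OF e[OF that]], of ?z] closed_box_norm[OF x] by simp
      show "(\<lambda>\<delta>. norm (infsum (\<lambda>\<alpha>. norm (?T (\<delta>, \<alpha>))) UNIV)) summable_on A"
      proof (rule summable_on_le[OF M])
        fix \<delta> assume "\<delta> \<in> A"
        then show "0 \<le> norm (infsum (\<lambda>\<alpha>. norm (?T (\<delta>, \<alpha>))) UNIV) \<and> norm (infsum (\<lambda>\<alpha>. norm (?T (\<delta>, \<alpha>))) UNIV) \<le> M \<delta>"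
          using wnorm_le_infsum_bound[OF e closed_box_norm[OF x], of \<delta>] by (simp add: infsum_nonneg)
      qed
    qed
    then have T: "(\<lambda>(\<delta>, \<alpha>). e \<delta> \<alpha> * mpow UNIV ?z \<alpha>) summable_on (A \<times> UNIV)" by (rule abs_summable_summable)
    have "infsum (\<lambda>\<delta>. h \<delta> x) A = infsum (\<lambda>\<delta>. infsum (\<lambda>\<alpha>. e \<delta> \<alpha> * mpow UNIV ?z \<alpha>) UNIV) A"
      by (intro infsum_cong) (use h x in \<open>simp add: rps_def ps_def\<close>)
    also have "\<dots> = infsum (\<lambda>\<alpha>. infsum (\<lambda>\<delta>. e \<delta> \<alpha> * mpow UNIV ?z \<alpha>) A) UNIV"
      by (rule infsum_swap_banach[OF T])
    also have "\<dots> = rps a (\<lambda>\<alpha>. infsum (\<lambda>\<delta>. e \<delta> \<alpha>) A) x"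
      by (simp add: infsum_cmult_left' rps_def ps_def)
    finally show "infsum (\<lambda>\<delta>. h \<delta> x) A = rps a (\<lambda>\<alpha>. infsum (\<lambda>\<delta>. e \<delta> \<alpha>) A) x" .
  qed
  have eq: "infsum (\<lambda>\<delta>. c \<delta> \<alpha>) A = infsum (\<lambda>\<delta>. d \<delta> \<alpha>) A" if "\<alpha> k < j" for \<alpha>
    by (intro infsum_cong) (use P that in blast)
  show ?thesis
    by (rule jrelI[OF main1[of c] main1[of d] main2[of c f] main2[of d g] eq]) (use P in blast)+
qed

text \<open>Majorant principle: arguments of norm at most \<open>\<rho>\<close> give a value whose
  norm is at most the series of absolute values at \<open>\<rho>\<close>. This bound does not depend
  on the scales \<open>\<tau>\<close> and \<open>r\<close>.\<close>

lemma jrel_compose: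
  assumes I: "finite I" and C: "ps_conv I C (\<lambda>_. \<rho>)" 
    and z: "\<And>l. l \<in> I \<Longrightarrow> jrel a j \<rho> (\<lambda>x. z x l) (\<lambda>x. z' x l)"
  shows "jrel a j (infsum (\<lambda>\<delta>. norm (C \<delta>) * mpow I (\<lambda>_. \<rho>) \<delta>) (multi_indices I)) (\<lambda>x. ps I C (z x)) (\<lambda>x. ps I C (z' x))"
  unfolding ps_def
proof (rule jrel_infsum)
  show "(\<lambda>\<delta>. norm (C \<delta>) * mpow I (\<lambda>_. \<rho>) \<delta>) summable_on multi_indices I" using C by (simp add: ps_conv_def)
  show "jrel a j (norm (C \<delta>) * mpow I (\<lambda>_. \<rho>) \<delta>) (\<lambda>x. C \<delta> * mpow I (z x) \<delta>) (\<lambda>x. C \<delta> * mpow I (z' x) \<delta>)" for \<delta>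
    unfolding mpow_def by (intro jrel_mult jrel_const jrel_prod jrel_power z)
qed

text \<open>Apart from the constant term every index has degree at least 1, so passing from radius
  \<open>R\<close> to \<open>r\<close> gains a factor \<open>r / R\<close>. The constant term gains
  nothing and is removed.\<close>

lemma wnorm_le_small:
  assumes c: "ps_conv UNIV c (\<lambda>_. R)" and "0 < R" "\<tau> \<le> r" "r \<le> R"
  shows "wnorm_le (c((\<lambda>_. 0) := 0)) (r / R * infsum (\<lambda>\<alpha>. norm (c \<alpha>) * R ^ (\<Sum>i\<in>UNIV. \<alpha> i)) UNIV)"
  unfolding wnorm_le_def
proof (intro allI impI)
  fix F :: "('n \<Rightarrow> nat) set" assume F: "finite F"
  have s: "(\<lambda>\<alpha>. norm (c \<alpha>) * R ^ (\<Sum>i\<in>UNIV. \<alpha> i)) summable_on UNIV"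
    using c by (simp add: ps_conv_def mpow_const)
  have "(\<Sum>\<alpha>\<in>F. norm ((c((\<lambda>_. 0) := 0)) \<alpha>) * wt \<alpha>) \<le> (\<Sum>\<alpha>\<in>F. r / R * (norm (c \<alpha>) * R ^ (\<Sum>i\<in>UNIV. \<alpha> i)))"
  proof (rule sum_mono)
    fix \<alpha> :: "'n \<Rightarrow> nat"
    show "norm ((c((\<lambda>_. 0) := 0)) \<alpha>) * wt \<alpha> \<le> r / R * (norm (c \<alpha>) * R ^ (\<Sum>i\<in>UNIV. \<alpha> i))"
    proof (cases "\<alpha> = (\<lambda>_. 0)")
      case True
      then show ?thesis using r_pos \<open>0 < R\<close> by simp
    next
      case False
      then obtain i where "\<alpha> i \<noteq> 0" by auto
      then have deg: "1 \<le> (\<Sum>i\<in>UNIV. \<alpha> i)" using member_le_sum[of i UNIV \<alpha>] by simp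
      have "wt \<alpha> \<le> \<tau> ^ \<alpha> k * r ^ rest \<alpha>" by (rule wt_le)
      also have "\<dots> \<le> r ^ \<alpha> k * r ^ rest \<alpha>"
        using \<tau>_pos r_pos assms(3) by (intro mult_right_mono power_mono) auto
      also have "\<dots> = (r / R) ^ (\<Sum>i\<in>UNIV. \<alpha> i) * R ^ (\<Sum>i\<in>UNIV. \<alpha> i)"
        using \<open>0 < R\<close> by (simp add: degree_split power_divide power_add)
      also have "\<dots> \<le> (r / R) ^ 1 * R ^ (\<Sum>i\<in>UNIV. \<alpha> i)"
        using \<open>0 < R\<close> r_pos assms(4) deg by (intro mult_right_mono power_decreasing) auto
      finally have "norm (c \<alpha>) * wt \<alpha> \<le> norm (c \<alpha>) * (r / R * R ^ (\<Sum>i\<in>UNIV. \<alpha> i))"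
        by (intro mult_left_mono) auto
      with False show ?thesis by (simp add: mult_ac)
    qed
  qed
  also have "\<dots> = r / R * (\<Sum>\<alpha>\<in>F. norm (c \<alpha>) * R ^ (\<Sum>i\<in>UNIV. \<alpha> i))" by (simp add: sum_distrib_left)
  also have "\<dots> \<le> r / R * infsum (\<lambda>\<alpha>. norm (c \<alpha>) * R ^ (\<Sum>i\<in>UNIV. \<alpha> i)) UNIV"
    using r_pos \<open>0 < R\<close> F by (intro mult_left_mono finite_sum_le_infsum[OF s]) auto
  finally show "(\<Sum>\<alpha>\<in>F. norm ((c((\<lambda>_. 0) := 0)) \<alpha>) * wt \<alpha>) \<le> r / R * infsum (\<lambda>\<alpha>. norm (c \<alpha>) * R ^ (\<Sum>i\<in>UNIV. \<alpha> i)) UNIV" .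
qed

end

section \<open>The local Cauchy-Kovalevskaya theorem\<close>

text \<open>The formal m-fold integral in the variable \<open>k\<close>, taken from the centre: its
  first \<open>m\<close> orders are 0, so adding it to a series changes no Cauchy data.\<close>

definition iterated_primitive :: "'n \<Rightarrow> nat \<Rightarrow> (('n \<Rightarrow> nat) \<Rightarrow> complex) \<Rightarrow> ('n \<Rightarrow> nat) \<Rightarrow> complex" where
  "iterated_primitive k m c \<beta> = (if m \<le> \<beta> k then fact (\<beta> k - m) / fact (\<beta> k) * c (\<beta>(k := \<beta> k - m)) else 0)"

abbreviation pure_index :: "'n \<Rightarrow> nat \<Rightarrow> 'n \<Rightarrow> nat" where
  "pure_index k p \<equiv> (\<lambda>i. if i = k then p else 0)"

text \<open>Written as p! times a binomial coefficient, the ratios compare through p! q! \<le> (p +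
  q)! and \<open>choose_mult_le\<close>. Iterated over the coordinates this replaces a multi-index
  by its total degree, which is all that \<open>wt\<close> sees of the y-directions.\<close>

lemma fact_ratio_mult:
  "fact (a + p) / fact a * (fact (b + q) / fact b) \<le> (fact (a + b + (p + q)) / fact (a + b) :: real)"
proof -
  have f: "fact (a + p) = fact p * fact a * ((a + p) choose p)" for a p :: nat
    using binomial_fact_lemma[of p "a + p"] by simp
  have "fact p * fact q \<le> (fact (p + q) :: nat)"
    by (intro dvd_imp_le fact_fact_dvd_fact) simp
  then have "(fact p * fact q) * (((a + p) choose p) * ((b + q) choose q)) \<le> fact (p + q) * (((a + p) + (b + q)) choose (p + q))"
    by (intro mult_le_mono choose_mult_le)
  then have "real ((fact p * fact q) * (((a + p) choose p) * ((b + q) choose q))) \<le> real (fact (p + q) * (((a + b) + (p + q)) choose (p + q)))"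
    unfolding of_nat_le_iff by (simp add: add_ac)
  moreover have g: "fact (a + p) / fact a = (real (fact p * ((a + p) choose p)))" for a p :: nat
  proof -
    have "(fact (a + p) :: real) = real (fact p * fact a * ((a + p) choose p))" using f[of a p] by (metis of_nat_fact)
    then show ?thesis by simp
  qed
  ultimately show ?thesis unfolding g by (simp add: mult_ac)
qed

lemma fact_ratio_prod:
  "finite A \<Longrightarrow> (\<Prod>i\<in>A. fact (\<gamma> i + \<alpha> i) / fact (\<gamma> i)) \<le> (fact (sum \<gamma> A + sum \<alpha> A) / fact (sum \<gamma> A) :: real)"
proof (induction A rule: finite_induct)
  case (insert i A)
  have "(\<Prod>i\<in>insert i A. fact (\<gamma> i + \<alpha> i) / fact (\<gamma> i) :: real) = fact (\<gamma> i + \<alpha> i) / fact (\<gamma> i) * (\<Prod>i\<in>A. fact (\<gamma> i + \<alpha> i) / fact (\<gamma> i))"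
    using insert by simp
  also have "\<dots> \<le> fact (\<gamma> i + \<alpha> i) / fact (\<gamma> i) * (fact (sum \<gamma> A + sum \<alpha> A) / fact (sum \<gamma> A))"
    by (intro mult_left_mono insert.IH) simp
  also have "\<dots> \<le> fact (\<gamma> i + sum \<gamma> A + (\<alpha> i + sum \<alpha> A)) / fact (\<gamma> i + sum \<gamma> A)"
    by (rule fact_ratio_mult)
  finally show ?case using insert by simp
qed simp

lemma ps_derivs_add: "ps_derivs \<alpha> (\<lambda>\<beta>. c \<beta> + d \<beta>) \<gamma> = ps_derivs \<alpha> c \<gamma> + ps_derivs \<alpha> d \<gamma>"
  by (simp add: ps_derivs_def distrib_left)

lemma ps_derivs_zero: "ps_derivs (\<lambda>_. 0) c = c"
  by (simp add: ps_derivs_def fun_eq_iff)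

text \<open>In direction \<open>k\<close> the factorial from differentiating cancels against the one
  from integrating, so differentiating a primitive is a weighted shift of coefficients.\<close>

lemma ps_derivs_primitive:
  fixes \<gamma> :: "'n::finite \<Rightarrow> nat"
  shows "ps_derivs \<alpha> (iterated_primitive k m c) \<gamma> =
    (if m \<le> \<gamma> k + \<alpha> k
     then (\<Prod>i\<in>UNIV - {k}. fact (\<gamma> i + \<alpha> i) / fact (\<gamma> i)) * (fact (\<gamma> k + \<alpha> k - m) / fact (\<gamma> k))
            * c ((\<lambda>i. \<gamma> i + \<alpha> i)(k := \<gamma> k + \<alpha> k - m))
     else 0)"
proof -
  have "(\<Prod>i\<in>UNIV. fact (\<gamma> i + \<alpha> i) / fact (\<gamma> i) :: complex)
      = fact (\<gamma> k + \<alpha> k) / fact (\<gamma> k) * (\<Prod>i\<in>UNIV - {k}. fact (\<gamma> i + \<alpha> i) / fact (\<gamma> i))"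
    by (subst prod.remove[of UNIV k]) auto
  then show ?thesis by (simp add: ps_derivs_def iterated_primitive_def)
qed

lemma ps_derivs_pure_primitive:
  fixes P :: "('n::finite \<Rightarrow> nat) \<Rightarrow> complex"
  assumes "\<And>\<alpha>. m \<le> \<alpha> k \<Longrightarrow> P \<alpha> = 0"
  shows "ps_derivs (pure_index k m) (\<lambda>\<beta>. P \<beta> + iterated_primitive k m c \<beta>) = c"
proof
  fix \<gamma> :: "'n \<Rightarrow> nat"
  have "ps_derivs (pure_index k m) P \<gamma> = 0"
    unfolding ps_derivs_def by (subst assms) auto
  moreover have "(\<lambda>i. \<gamma> i + pure_index k m i)(k := \<gamma> k + pure_index k m k - m) = \<gamma>" by auto
  moreover have "(\<Prod>i\<in>UNIV - {k}. fact (\<gamma> i + pure_index k m i) / fact (\<gamma> i)) = (1::complex)"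
    by (intro prod.neutral) auto
  ultimately show "ps_derivs (pure_index k m) (\<lambda>\<beta>. P \<beta> + iterated_primitive k m c \<beta>) \<gamma> = c \<gamma>"
    unfolding ps_derivs_add ps_derivs_primitive by simp
qed

lemma jet_index_less: "\<alpha> \<in> jet_indices k m \<Longrightarrow> \<alpha> k < m"
  by (simp add: jet_indices_def)

lemma zero_jet_index: "0 < m \<Longrightarrow> (\<lambda>_. 0) \<in> jet_indices k m"
  by (simp add: jet_indices_def)

section \<open>Derivatives of primitives in the weighted norm\<close>

context weighted
begin

lemma wt_fact: "wt \<alpha> = \<tau> ^ \<alpha> k * r ^ rest \<alpha> * (fact (\<alpha> k) * fact (rest \<alpha>)) / fact (\<alpha> k + rest \<alpha>)"
  by (simp add: wt_def binomial_fact)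

text \<open>With l = m - p net integrations and s = |q|, the factorials of D_y^q and of the
  integrations combine with those in \<open>wt \<gamma>\<close>, and it remains to compare \<tau>^l
  / (j + l + b)! with (\<tau> / r) r^s / (j + s + b)!. The factorials compare since s \<le> l, the
  powers since l \<ge> 1 and \<tau> \<le> r \<le> 1. The factor \<tau> / r is the gain that keeps
  the iteration in a ball.\<close>

lemma wt_jet_bound:
  assumes \<alpha>: "\<alpha> \<in> jet_indices k m" and le: "\<tau> \<le> r" "r \<le> 1" and g: "m \<le> \<gamma> k + \<alpha> k"
  shows "(\<Prod>i\<in>UNIV - {k}. fact (\<gamma> i + \<alpha> i) / fact (\<gamma> i)) * (fact (\<gamma> k + \<alpha> k - m) / fact (\<gamma> k)) * wt \<gamma>
    \<le> \<tau> / r * wt ((\<lambda>i. \<gamma> i + \<alpha> i)(k := \<gamma> k + \<alpha> k - m))"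
proof -
  define l where "l = m - \<alpha> k"
  define j where "j = \<gamma> k + \<alpha> k - m"
  define b where "b = rest \<gamma>"
  define s where "s = rest \<alpha>"
  have "\<alpha> k < m" "\<alpha> k + s \<le> m" using \<alpha> by (simp_all add: jet_indices_def degree_split s_def)
  then have l: "1 \<le> l" "s \<le> l" by (auto simp: l_def)
  have jl: "\<gamma> k = j + l" using g \<open>\<alpha> k < m\<close> by (simp add: j_def l_def)
  let ?\<theta> = "(\<lambda>i. \<gamma> i + \<alpha> i)(k := \<gamma> k + \<alpha> k - m)"
  have \<theta>: "?\<theta> k = j" "rest ?\<theta> = b + s"
    by (simp_all add: j_def b_def s_def rest_def flip: sum.distrib)
  have "(\<Prod>i\<in>UNIV - {k}. fact (\<gamma> i + \<alpha> i) / fact (\<gamma> i)) \<le> (fact (b + s) / fact b :: real)"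
    unfolding b_def s_def rest_def by (rule fact_ratio_prod) simp
  then have "(\<Prod>i\<in>UNIV - {k}. fact (\<gamma> i + \<alpha> i) / fact (\<gamma> i)) * (fact j / fact (\<gamma> k)) * wt \<gamma>
     \<le> fact (b + s) / fact b * (fact j / fact (\<gamma> k)) * wt \<gamma>"
    by (intro mult_right_mono wt_nonneg) auto
  also have "\<dots> = (fact (b + s) * fact j * r ^ b * \<tau> ^ j) * (\<tau> ^ l / fact (j + l + b))"
    by (simp add: wt_fact jl b_def[symmetric] power_add field_simps)
  also have "\<tau> ^ l / fact (j + l + b) \<le> (\<tau> / r * r ^ s) / fact (j + (b + s))"
  proof (rule frac_le)
    have "\<tau> ^ l = \<tau> * \<tau> ^ (l - 1)" using l by (cases l) auto
    also have "\<dots> \<le> \<tau> * r ^ (l - 1)" using \<tau>_pos le by (intro mult_left_mono power_mono) auto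
    also have "\<dots> = \<tau> / r * r ^ l" using r_pos l by (cases l) auto
    also have "\<dots> \<le> \<tau> / r * r ^ s" using \<tau>_pos r_pos le l by (intro mult_left_mono power_decreasing) auto
    finally show "\<tau> ^ l \<le> \<tau> / r * r ^ s" .
    show "(fact (j + (b + s)) :: real) \<le> fact (j + l + b)" using l by (intro fact_mono) simp
  qed (use \<tau>_pos r_pos in auto)
  also have "(fact (b + s) * fact j * r ^ b * \<tau> ^ j) * ((\<tau> / r * r ^ s) / fact (j + (b + s))) = \<tau> / r * wt ?\<theta>"
    unfolding wt_fact \<theta> by (simp add: power_add mult_ac)
  finally show ?thesis using \<tau>_pos r_pos by (simp add: j_def mult_left_mono)
qed

text \<open>Coefficients outside \<open>F'\<close> vanish, and on \<open>F'\<close> the shift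
  \<open>\<theta>\<close> of indices is injective, so the estimate for single weights sums to the
  bound for norms.\<close>

lemma wnorm_le_derivs_primitive:
  assumes \<alpha>: "\<alpha> \<in> jet_indices k m" and le: "\<tau> \<le> r" "r \<le> 1" and c: "wnorm_le c M"
  shows "wnorm_le (ps_derivs \<alpha> (iterated_primitive k m c)) (\<tau> / r * M)"
  unfolding wnorm_le_def
proof (intro allI impI)
  fix F :: "('n \<Rightarrow> nat) set" assume F: "finite F"
  define F' where "F' = {\<gamma> \<in> F. m \<le> \<gamma> k + \<alpha> k}"
  define \<theta> where "\<theta> \<gamma> = (\<lambda>i. \<gamma> i + \<alpha> i)(k := \<gamma> k + \<alpha> k - m)" for \<gamma>
  have F': "finite F'" "F' \<subseteq> F" using F by (auto simp: F'_def)
  have inj: "inj_on \<theta> F'"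
  proof (rule inj_onI)
    fix \<gamma> \<gamma>' assume *: "\<gamma> \<in> F'" "\<gamma>' \<in> F'" "\<theta> \<gamma> = \<theta> \<gamma>'"
    show "\<gamma> = \<gamma>'"
    proof
      fix i show "\<gamma> i = \<gamma>' i"
        using fun_cong[OF *(3), of i] *(1,2) by (cases "i = k") (auto simp: \<theta>_def F'_def)
    qed
  qed
  have "(\<Sum>\<gamma>\<in>F. norm (ps_derivs \<alpha> (iterated_primitive k m c) \<gamma>) * wt \<gamma>) = (\<Sum>\<gamma>\<in>F'. norm (ps_derivs \<alpha> (iterated_primitive k m c) \<gamma>) * wt \<gamma>)"
    by (rule sum.mono_neutral_right[OF F F'(2)]) (auto simp: F'_def ps_derivs_primitive)
  also have "\<dots> \<le> (\<Sum>\<gamma>\<in>F'. \<tau> / r * (norm (c (\<theta> \<gamma>)) * wt (\<theta> \<gamma>)))"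
  proof (rule sum_mono)
    fix \<gamma> assume "\<gamma> \<in> F'"
    then have g: "m \<le> \<gamma> k + \<alpha> k" by (simp add: F'_def)
    let ?Q = "(\<Prod>i\<in>UNIV - {k}. fact (\<gamma> i + \<alpha> i) / fact (\<gamma> i)) * (fact (\<gamma> k + \<alpha> k - m) / fact (\<gamma> k)) :: real"
    have "norm (ps_derivs \<alpha> (iterated_primitive k m c) \<gamma>) * wt \<gamma> = norm (c (\<theta> \<gamma>)) * (?Q * wt \<gamma>)"
      using g by (simp add: ps_derivs_primitive \<theta>_def norm_mult norm_divide flip: prod_norm)
    also have "\<dots> \<le> norm (c (\<theta> \<gamma>)) * (\<tau> / r * wt (\<theta> \<gamma>))"
      unfolding \<theta>_def by (intro mult_left_mono wt_jet_bound[where \<gamma> = \<gamma> and \<alpha> = \<alpha> and m = m, OF \<alpha> le g]) auto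
    finally show "norm (ps_derivs \<alpha> (iterated_primitive k m c) \<gamma>) * wt \<gamma> \<le> \<tau> / r * (norm (c (\<theta> \<gamma>)) * wt (\<theta> \<gamma>))"
      by (simp add: mult_ac)
  qed
  also have "\<dots> = \<tau> / r * (\<Sum>\<beta>\<in>\<theta> ` F'. norm (c \<beta>) * wt \<beta>)"
    by (simp add: sum_distrib_left sum.reindex[OF inj])
  also have "\<dots> \<le> \<tau> / r * M"
    using \<tau>_pos r_pos F' by (intro mult_left_mono wnorm_leD[OF c]) auto
  finally show "(\<Sum>\<gamma>\<in>F. norm (ps_derivs \<alpha> (iterated_primitive k m c) \<gamma>) * wt \<gamma>) \<le> \<tau> / r * M" .
qed

text \<open>The coefficient at \<open>\<gamma>\<close> is taken from order
  \<open>\<gamma> k + \<alpha> k - m\<close>, which is less than \<open>\<gamma> k\<close> because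
  \<open>\<alpha> k < m\<close>. This strict gain of one order is what stabilises the
  iteration.\<close>

lemma derivs_primitive_agree:
  assumes "\<alpha> \<in> jet_indices k m" "\<And>\<beta>. \<beta> k < j \<Longrightarrow> c \<beta> = d \<beta>" "\<gamma> k < Suc j"
  shows "ps_derivs \<alpha> (iterated_primitive k m c) \<gamma> = ps_derivs \<alpha> (iterated_primitive k m d) \<gamma>"
  unfolding ps_derivs_primitive using jet_index_less[OF assms(1)] assms(2,3) by auto

lemma rps_add:
  assumes "wnorm_le c M" "wnorm_le d N" "x \<in> closed_box a"
  shows "rps a (\<lambda>\<beta>. c \<beta> + d \<beta>) x = rps a c x + rps a d x"
proof -
  let ?z = "\<lambda>i. complex_of_real (x $ i - a $ i)"
  have "((\<lambda>\<beta>. c \<beta> * mpow UNIV ?z \<beta> + d \<beta> * mpow UNIV ?z \<beta>) has_sum ps UNIV c ?z + ps UNIV d ?z) (multi_indices UNIV)"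
    by (intro has_sum_add ps_has_sum[OF wnorm_le_ps_conv[OF assms(1)]] ps_has_sum[OF wnorm_le_ps_conv[OF assms(2)]] closed_box_norm[OF assms(3)])
  then have "((\<lambda>\<beta>. (c \<beta> + d \<beta>) * mpow UNIV ?z \<beta>) has_sum ps UNIV c ?z + ps UNIV d ?z) (multi_indices UNIV)"
    by (simp add: distrib_right)
  then show ?thesis unfolding rps_def ps_def[of _ "\<lambda>\<beta>. c \<beta> + d \<beta>"] by (rule infsumI)
qed

lemma jrel_coordinate:
  assumes "\<tau> \<le> r" "r \<le> \<rho>"
  shows "jrel a j \<rho> (\<lambda>x. of_real (x $ i - a $ i)) (\<lambda>x. of_real (x $ i - a $ i))"
proof -
  let ?e = "pure_index i 1"
  have "wt ?e \<le> \<tau> ^ ?e k * r ^ rest ?e" by (rule wt_le)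
  also have "\<dots> \<le> \<rho>"
  proof (cases "i = k")
    case True
    then have "rest ?e = 0" by (simp add: rest_def)
    with True show ?thesis using assms by simp
  next
    case False
    then have "rest ?e = 1" by (simp add: rest_def)
    with False show ?thesis using assms by simp
  qed
  finally have wt: "wt ?e \<le> \<rho>" .
  have n: "wnorm_le (\<lambda>\<alpha>. if \<alpha> = ?e then 1 else 0) \<rho>"
    by (rule wnorm_le_mono[OF wnorm_le_indicator]) (use wt in simp)
  have m: "mpow UNIV z ?e = z i" for z :: "'n \<Rightarrow> complex"
  proof -
    have "mpow UNIV z ?e = (\<Prod>l\<in>UNIV. if l = i then z l else 1)"
      unfolding mpow_def by (intro prod.cong) auto
    then show ?thesis by simp
  qed
  show ?thesis by (rule jrelI[OF n n]) (simp_all add: rps_indicator m)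
qed

lemma jrel_cong:
  assumes "jrel a j M f g" "\<And>x. x \<in> closed_box a \<Longrightarrow> f x = f' x" "\<And>x. x \<in> closed_box a \<Longrightarrow> g x = g' x"
  shows "jrel a j M f' g'"
  using assms unfolding jrel_def by metis

text \<open>The weighted norm bounds the values on the box, so the arguments stay where the power
  series represents \<open>G\<close>. Norm bound and agreement then come from
  \<open>jrel_compose\<close>, with a bound fixed by \<open>C\<close> and \<open>\<rho>\<close>
  alone.\<close>

lemma jrel_analytic_composition:
  fixes G :: "real ^ 'n \<Rightarrow> ('j \<Rightarrow> complex) \<Rightarrow> complex"
  assumes J: "finite J" and C: "ps_conv (Sum_Type.Plus UNIV J) C (\<lambda>_. \<rho>)" and le: "\<tau> \<le> r" "r \<le> \<rho>"
    and G: "\<And>x \<xi>. (\<And>i. \<bar>x $ i - a $ i\<bar> \<le> \<rho>) \<Longrightarrow> \<xi> \<in> J \<rightarrow>\<^sub>E UNIV \<Longrightarrow> (\<And>j. j \<in> J \<Longrightarrow> norm (\<xi> j - b j) \<le> \<rho>) \<Longrightarrow>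
       x \<in> X \<and> G x \<xi> = ps (Sum_Type.Plus UNIV J) C (joint_args a b x \<xi>)"
    and v: "\<And>l. l \<in> J \<Longrightarrow> jrel a j \<rho> (\<lambda>x. v l x - b l) (\<lambda>x. v' l x - b l)"
  shows "jrel a j (infsum (\<lambda>\<delta>. norm (C \<delta>) * mpow (Sum_Type.Plus UNIV J) (\<lambda>_. \<rho>) \<delta>) (multi_indices (Sum_Type.Plus UNIV J)))
     (\<lambda>x. G x (\<lambda>l\<in>J. v l x)) (\<lambda>x. G x (\<lambda>l\<in>J. v' l x))"
proof -
  let ?I = "Sum_Type.Plus (UNIV :: 'n set) J"
  have I: "finite ?I" using J by simp
  have z: "jrel a j \<rho> (\<lambda>x. joint_args a b x (\<lambda>l\<in>J. v l x) l) (\<lambda>x. joint_args a b x (\<lambda>l\<in>J. v' l x) l)" if "l \<in> ?I" for l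
  proof (cases l)
    case (Inl i)
    show ?thesis unfolding Inl joint_args_simps by (rule jrel_coordinate[OF le])
  next
    case (Inr i)
    then have "i \<in> J" using that by auto
    then show ?thesis unfolding Inr joint_args_simps using v[of i] by simp
  qed
  have box: "\<bar>x $ i - a $ i\<bar> \<le> \<rho>" if "x \<in> closed_box a" for x i
  proof -
    have "rad i \<le> \<rho>" using le r_pos \<tau>_pos by (auto simp: rad_def)
    moreover have "\<bar>x $ i - a $ i\<bar> \<le> rad i" using that by (simp add: closed_box_def)
    ultimately show ?thesis by linarith
  qed
  have nv: "norm (v l x - b l) \<le> \<rho>" "norm (v' l x - b l) \<le> \<rho>" if l: "l \<in> J" and x: "x \<in> closed_box a" for l x
  proof -
    obtain c d where "wnorm_le c \<rho>" "wnorm_le d \<rho>" "\<forall>x\<in>closed_box a. v l x - b l = rps a c x \<and> v' l x - b l = rps a d x"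
      using v[OF l] unfolding jrel_def by blast
    then show "norm (v l x - b l) \<le> \<rho>" "norm (v' l x - b l) \<le> \<rho>"
      using wnorm_le_norm_rps[OF _ x] x by auto
  qed
  show ?thesis
  proof (rule jrel_cong[OF jrel_compose[OF I C z]])
    fix x assume x: "x \<in> closed_box a"
    show "ps ?I C (joint_args a b x (\<lambda>l\<in>J. v l x)) = G x (\<lambda>l\<in>J. v l x)"
      using G[OF box[OF x], of "\<lambda>l\<in>J. v l x"] nv(1)[OF _ x] by simp
    show "ps ?I C (joint_args a b x (\<lambda>l\<in>J. v' l x)) = G x (\<lambda>l\<in>J. v' l x)"
      using G[OF box[OF x], of "\<lambda>l\<in>J. v' l x"] nv(2)[OF _ x] by simp
  qed
qed

lemma obox_rad_subset: "obox a rad \<subseteq> closed_box a"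
  by (auto simp: obox_def closed_box_def less_imp_le)

lemma wnorm_le_identity:
  assumes "wnorm_le c M" "ps_conv_in UNIV d \<rho>" "\<And>i. \<rho> i > 0" "\<And>x. x \<in> closed_box a \<Longrightarrow> rps a c x = rps a d x"
  shows "c = d"
proof (rule rps_identity[where \<rho> = "\<lambda>i. min (rad i) (\<rho> i)" and a = a])
  show "ps_conv_in UNIV c (\<lambda>i. min (rad i) (\<rho> i))"
    by (rule ps_conv_in_mono[OF ps_conv_imp_in[OF wnorm_le_ps_conv[OF assms(1)]]]) simp
  show "ps_conv_in UNIV d (\<lambda>i. min (rad i) (\<rho> i))"
    by (rule ps_conv_in_mono[OF assms(2)]) simp
  show "a \<in> obox a rad" by (simp add: obox_def rad_pos)
  show "rps a c x = rps a d x" if "x \<in> obox a rad" for x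
    using assms(4) that obox_rad_subset by blast
qed (use rad_pos assms(3) open_obox in auto)

end

section \<open>Local existence and uniqueness\<close>

lemma small_scale:
  fixes K :: "'v \<Rightarrow> real"
  assumes J: "finite J" and "R > 0" "\<rho> > 0" "\<epsilon> > 0"
  obtains r where "0 < r" "r \<le> R" "r \<le> \<epsilon>" "\<And>l. l \<in> J \<Longrightarrow> r / R * K l \<le> \<rho>"
proof -
  obtain S where S: "S > 0" "\<forall>l\<in>J. K l \<le> S" using finite_upper_bound[OF J] by blast
  define r where "r = min R (min \<epsilon> (R * \<rho> / S))"
  have r: "0 < r" using assms S by (simp add: r_def)
  have "r / R * K l \<le> \<rho>" if "l \<in> J" for l
  proof -
    have "r / R * K l \<le> r / R * S" using S that r \<open>R > 0\<close> by (intro mult_left_mono) auto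
    also have "\<dots> \<le> (R * \<rho> / S) / R * S"
      using S \<open>R > 0\<close> by (intro mult_right_mono divide_right_mono) (auto simp: r_def)
    also have "\<dots> = \<rho>" using S \<open>R > 0\<close> by simp
    finally show ?thesis .
  qed
  then show ?thesis using that[of r] r by (simp add: r_def)
qed

text \<open>\<open>P\<close> collects the Cauchy data, one slice for each order below
  \<open>m\<close>; the solution is sought as \<open>P\<close> plus the m-fold primitive of an
  unknown series. Of the radius \<rho> allowed to the arguments of \<open>G\<close>, one half is
  reserved for the data and one half for the primitive.\<close>

theorem local_existence:
  fixes X :: "(real ^ 'n::finite) set"
  assumes X: "open X" and m: "0 < m" and G: "analytic_in_all_variables X (jet_indices k m) G" and a: "a \<in> X"
    and P: "ps_conv UNIV P (\<lambda>_. R)" "R > 0" and P0: "\<And>\<alpha>. m \<le> \<alpha> k \<Longrightarrow> P \<alpha> = 0"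
  shows "\<exists>\<rho>>0. \<exists>c. ps_conv UNIV c (\<lambda>_. \<rho>) \<and> obox a (\<lambda>_. \<rho>) \<subseteq> X \<and>
     (\<forall>x\<in>obox a (\<lambda>_. \<rho>). rps a (ps_derivs (pure_index k m) c) x = G x (\<lambda>\<alpha>\<in>jet_indices k m. rps a (ps_derivs \<alpha> c) x)) \<and>
     (\<forall>\<alpha>. \<alpha> k < m \<longrightarrow> c \<alpha> = P \<alpha>)"
proof -
  let ?J = "jet_indices k m"
  note J = finite_jet_indices[of k m]
  \<comment> \<open>The jet of the data at the centre. The primitive contributes nothing there,
    because every \<open>\<alpha> \<in> ?J\<close> has \<open>\<alpha> k < m\<close>.\<close>
  define b where "b = (\<lambda>\<alpha>\<in>?J. ps_derivs \<alpha> P (\<lambda>_. 0))"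
  obtain \<rho> C where \<rho>: "\<rho> > 0" and C: "ps_conv (Sum_Type.Plus UNIV ?J) C (\<lambda>_. \<rho>)"
    and Geq: "\<And>x \<xi>. (\<And>i. \<bar>x $ i - a $ i\<bar> \<le> \<rho>) \<Longrightarrow> \<xi> \<in> ?J \<rightarrow>\<^sub>E UNIV \<Longrightarrow> (\<And>j. j \<in> ?J \<Longrightarrow> norm (\<xi> j - b j) \<le> \<rho>) \<Longrightarrow>
       x \<in> X \<and> G x \<xi> = ps (Sum_Type.Plus UNIV ?J) C (joint_args a b x \<xi>)"
    by (rule analytic_in_all_variables_ps[OF X J G a, of b]) (auto simp: b_def)
  define M where "M = infsum (\<lambda>\<delta>. norm (C \<delta>) * mpow (Sum_Type.Plus UNIV ?J) (\<lambda>_. \<rho>) \<delta>) (multi_indices (Sum_Type.Plus UNIV ?J))"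
  have M: "M \<ge> 0" unfolding M_def using \<rho> by (intro infsum_nonneg mult_nonneg_nonneg mpow_nonneg) auto
  define K :: "('n \<Rightarrow> nat) \<Rightarrow> real" where "K \<alpha> = infsum (\<lambda>\<gamma>. norm (ps_derivs \<alpha> P \<gamma>) * (R/2) ^ (\<Sum>i\<in>UNIV. \<gamma> i)) UNIV" for \<alpha>
  have PR: "ps_conv UNIV (ps_derivs \<alpha> P) (\<lambda>_. R / 2)" for \<alpha>
    by (rule ps_conv_inD[OF ps_conv_in_derivs[OF ps_conv_imp_in[OF P(1)]]]) (use P(2) in auto)
  obtain r where r: "0 < r" "r \<le> R / 2" "r \<le> min 1 \<rho>" "\<And>\<alpha>. \<alpha> \<in> ?J \<Longrightarrow> r / (R/2) * K \<alpha> \<le> \<rho> / 2"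
    by (rule small_scale[OF J, of "R/2" "\<rho>/2" "min 1 \<rho>" K]) (use P(2) \<rho> in auto)
  \<comment> \<open>\<open>\<tau>\<close> is chosen after \<open>r\<close> and \<open>M\<close>: the
    minimum secures \<open>\<tau> \<le> r\<close>, and \<open>M + 1\<close> avoids division by
    0.\<close>
  define \<tau> where "\<tau> = r * min 1 (\<rho> / (2 * (M + 1)))"
  have \<tau>: "0 < \<tau>" "\<tau> \<le> r" "\<tau> / r * M \<le> \<rho> / 2"
  proof -
    show "0 < \<tau>" using r \<rho> M by (simp add: \<tau>_def)
    show "\<tau> \<le> r" using r by (simp add: \<tau>_def mult_left_le)
    have "\<tau> / r * M = min 1 (\<rho> / (2 * (M + 1))) * M" using r by (simp add: \<tau>_def)
    also have "\<dots> \<le> \<rho> / (2 * (M + 1)) * M" using M by (intro mult_right_mono) auto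
    also have "\<dots> \<le> \<rho> / (2 * (M + 1)) * (M + 1)" using M \<rho> by (intro mult_left_mono) auto
    also have "\<dots> = \<rho> / 2"
    proof -
      have "\<rho> / (2 * N) * N = \<rho> / 2" if "N > 0" for N :: real using that by simp
      from this[of "M + 1"] show ?thesis using M by linarith
    qed
    finally show "\<tau> / r * M \<le> \<rho> / 2" .
  qed
  interpret weighted k \<tau> r by unfold_locales (use \<tau> r in auto)
  \<comment> \<open>The argument with index \<open>\<alpha>\<close>, reduced by its value
    \<open>b \<alpha>\<close> at the centre: the constant term of the data is removed, since only
    the rest becomes small with \<open>r\<close>.\<close>
  define e where "e \<alpha> c \<gamma> = ((ps_derivs \<alpha> P)((\<lambda>_. 0) := 0)) \<gamma> + ps_derivs \<alpha> (iterated_primitive k m c) \<gamma>" for \<alpha> c \<gamma>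
  have nbe: "wnorm_le (e \<alpha> c) \<rho>" if "\<alpha> \<in> ?J" "wnorm_le c M" for \<alpha> c
  proof -
    have "wnorm_le ((ps_derivs \<alpha> P)((\<lambda>_. 0) := 0)) (r / (R/2) * K \<alpha>)"
      unfolding K_def by (rule wnorm_le_small[OF PR]) (use P(2) \<tau> r in auto)
    then have "wnorm_le (e \<alpha> c) (r / (R/2) * K \<alpha> + \<tau> / r * M)"
      unfolding e_def[abs_def] by (rule wnorm_le_add[OF _ wnorm_le_derivs_primitive[OF that(1) _ _ that(2)]]) (use \<tau> r in auto)
    then show ?thesis by (rule wnorm_le_mono) (use r(4)[OF that(1)] \<tau>(3) in linarith)
  qed
  let ?ind = "\<lambda>\<alpha> \<gamma>. if \<gamma> = (\<lambda>_. 0) then b \<alpha> else 0"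
  have de: "ps_derivs \<alpha> (\<lambda>\<beta>. P \<beta> + iterated_primitive k m c \<beta>) = (\<lambda>\<gamma>. e \<alpha> c \<gamma> + ?ind \<alpha> \<gamma>)" if "\<alpha> \<in> ?J" for \<alpha> c
  proof
    fix \<gamma>
    show "ps_derivs \<alpha> (\<lambda>\<beta>. P \<beta> + iterated_primitive k m c \<beta>) \<gamma> = e \<alpha> c \<gamma> + ?ind \<alpha> \<gamma>"
      using that unfolding ps_derivs_add by (simp add: e_def b_def)
  qed
  have rde: "rps a (ps_derivs \<alpha> (\<lambda>\<beta>. P \<beta> + iterated_primitive k m c \<beta>)) x = rps a (e \<alpha> c) x + b \<alpha>"
    if "\<alpha> \<in> ?J" "wnorm_le c M" "x \<in> closed_box a" for \<alpha> c x
    unfolding de[OF that(1)] rps_add[OF nbe[OF that(1,2)] wnorm_le_indicator that(3)] by (simp add: rps_indicator mpow_def)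
  define H where "H c x = G x (\<lambda>\<alpha>\<in>?J. rps a (e \<alpha> c) x + b \<alpha>)" for c x
  have step: "jrel a (Suc j) M (H c) (H c')" if "wnorm_le c M" "wnorm_le c' M" "\<And>\<beta>. \<beta> k < j \<Longrightarrow> c \<beta> = c' \<beta>" for c c' j
    unfolding H_def[abs_def] M_def
  proof (rule jrel_analytic_composition[OF J C _ _ Geq])
    show "\<tau> \<le> r" "r \<le> \<rho>" using \<tau> r by auto
    show "jrel a (Suc j) \<rho> (\<lambda>x. rps a (e l c) x + b l - b l) (\<lambda>x. rps a (e l c') x + b l - b l)" if l: "l \<in> ?J" for l
    proof (rule jrelI[of "e l c" _ "e l c'"])
      show "e l c \<gamma> = e l c' \<gamma>" if "\<gamma> k < Suc j" for \<gamma>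
      proof -
        have "ps_derivs l (iterated_primitive k m c) \<gamma> = ps_derivs l (iterated_primitive k m c') \<gamma>"
          by (rule derivs_primitive_agree[where j = j and \<gamma> = \<gamma>]) (use l that \<open>\<And>\<beta>. \<beta> k < j \<Longrightarrow> c \<beta> = c' \<beta>\<close> in auto)
        then show ?thesis unfolding e_def by simp
      qed
    qed (use nbe[OF l] \<open>wnorm_le c M\<close> \<open>wnorm_le c' M\<close> in auto)
  qed
  define sol where "sol c d \<longleftrightarrow> wnorm_le d M \<and> (\<forall>x\<in>closed_box a. rps a d x = H c x)" for c d
  \<comment> \<open>\<open>\<Phi> c\<close> is a coefficient family of the function
    \<open>H c\<close>. Its existence is \<open>step\<close> applied with \<open>c' = c\<close>, and
    the identity theorem makes it the only one, so the choice is harmless.\<close>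
  define \<Phi> where "\<Phi> c = (SOME d. sol c d)" for c
  have \<Phi>: "sol c (\<Phi> c)" if c: "wnorm_le c M" for c
  proof -
    obtain d where "wnorm_le d M" "\<forall>x\<in>closed_box a. H c x = rps a d x"
      using step[OF c c, of 0] unfolding jrel_def by auto
    then have "sol c d" by (simp add: sol_def)
    then show ?thesis unfolding \<Phi>_def by (rule someI[of "sol c"])
  qed
  \<comment> \<open>\<open>step\<close> yields some coefficient families that agree in the orders up
    to \<open>j\<close>; uniqueness identifies them with the chosen \<open>\<Phi> c\<close> and
    \<open>\<Phi> c'\<close>.\<close>
  have agree: "\<Phi> c \<beta> = \<Phi> c' \<beta>" if as: "wnorm_le c M" "wnorm_le c' M" "\<And>\<beta>. \<beta> k < j \<Longrightarrow> c \<beta> = c' \<beta>" "\<beta> k < Suc j" for c c' j \<beta>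
  proof -
    obtain d d' where d: "wnorm_le d M" "wnorm_le d' M" "\<forall>x\<in>closed_box a. H c x = rps a d x \<and> H c' x = rps a d' x"
      "\<forall>\<alpha>. \<alpha> k < Suc j \<longrightarrow> d \<alpha> = d' \<alpha>"
      using step[OF as(1-3)] unfolding jrel_def by blast
    have "\<Phi> c = d"
      by (rule wnorm_le_identity[where \<rho> = rad and a = a]) (use \<Phi>[OF as(1)] d ps_conv_imp_in[OF wnorm_le_ps_conv[OF d(1)]] rad_pos in \<open>auto simp: sol_def\<close>)
    moreover have "\<Phi> c' = d'"
      by (rule wnorm_le_identity[where \<rho> = rad and a = a]) (use \<Phi>[OF as(2)] d ps_conv_imp_in[OF wnorm_le_ps_conv[OF d(2)]] rad_pos in \<open>auto simp: sol_def\<close>)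
    ultimately show ?thesis using d(4) as(4) by simp
  qed
  define w where "w n = (\<Phi> ^^ n) (\<lambda>_. 0)" for n
  have wS: "w (Suc n) = \<Phi> (w n)" for n by (simp add: w_def)
  have nbw: "wnorm_le (w n) M" for n
  proof (induction n)
    case 0
    show ?case using M by (simp add: w_def wnorm_le_def)
  next
    case (Suc n)
    then show ?case using \<Phi>[OF Suc] by (simp add: wS sol_def)
  qed
  have w1: "w n \<beta> = w (Suc n) \<beta>" if "\<beta> k < n" for n \<beta>
    using that
  proof (induction n arbitrary: \<beta>)
    case (Suc n)
    have "\<Phi> (w n) \<beta> = \<Phi> (w (Suc n)) \<beta>"
      by (rule agree[of "w n" "w (Suc n)" n \<beta>, OF nbw nbw]) (use Suc in auto)
    then show ?case by (simp only: wS)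
  qed simp
  have w2: "w n \<beta> = w n' \<beta>" if "\<beta> k < n" "n \<le> n'" for n n' \<beta>
    using that(2)
  proof (induction n' rule: dec_induct)
    case (step n'')
    then show ?case using w1[of \<beta> n''] that(1) by simp
  qed simp
  \<comment> \<open>A coefficient of order \<open>\<beta> k\<close> is final from the iterate
    \<open>Suc (\<beta> k)\<close> on, so the limit is read off on the diagonal.\<close>
  define u where "u \<beta> = w (Suc (\<beta> k)) \<beta>" for \<beta>
  have uw: "u \<beta> = w n \<beta>" if "\<beta> k < n" for \<beta> n
    unfolding u_def by (rule w2) (use that in auto)
  have nbu: "wnorm_le u M"
    unfolding wnorm_le_def
  proof (intro allI impI)
    fix F :: "('n \<Rightarrow> nat) set" assume F: "finite F"
    \<comment> \<open>A finite set of indices involves only orders below some \<open>N\<close>,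
      where \<open>u\<close> coincides with the single iterate \<open>w N\<close>; the bound of the
      iterates thus passes to \<open>u\<close>.\<close>
    define N where "N = Suc (\<Sum>\<beta>\<in>F. \<beta> k)"
    have "(\<Sum>\<beta>\<in>F. norm (u \<beta>) * wt \<beta>) = (\<Sum>\<beta>\<in>F. norm (w N \<beta>) * wt \<beta>)"
    proof (intro sum.cong refl)
      fix \<beta> assume "\<beta> \<in> F"
      then have "\<beta> k < N" unfolding N_def using member_le_sum[of \<beta> F "\<lambda>\<beta>. \<beta> k"] F by simp
      then show "norm (u \<beta>) * wt \<beta> = norm (w N \<beta>) * wt \<beta>" by (simp add: uw)
    qed
    also have "\<dots> \<le> M" by (rule wnorm_leD[OF nbw F])
    finally show "(\<Sum>\<beta>\<in>F. norm (u \<beta>) * wt \<beta>) \<le> M" .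
  qed
  have fix_u: "\<Phi> u = u"
  proof
    fix \<beta>
    \<comment> \<open>\<open>u\<close> and \<open>w (\<beta> k)\<close> agree below order
      \<open>\<beta> k\<close>, hence their images agree at order \<open>\<beta> k\<close>, and the
      image of \<open>w (\<beta> k)\<close> is the next iterate.\<close>
    have "\<Phi> u \<beta> = \<Phi> (w (\<beta> k)) \<beta>"
      by (rule agree[of u "w (\<beta> k)" "\<beta> k" \<beta>, OF nbu nbw]) (auto simp: uw)
    then show "\<Phi> u \<beta> = u \<beta>" by (simp add: u_def wS)
  qed
  define c where "c \<beta> = P \<beta> + iterated_primitive k m u \<beta>" for \<beta>
  have c: "c = (\<lambda>\<beta>. P \<beta> + iterated_primitive k m u \<beta>)" by (auto simp: c_def)
  \<comment> \<open>Order zero belongs to the jet since \<open>m > 0\<close>, so the norm bound for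
    the arguments of \<open>G\<close>, with the value at the centre added back, bounds
    \<open>c\<close> itself and gives its convergence.\<close>
  have "ps_derivs (\<lambda>_. 0) c = (\<lambda>\<gamma>. e (\<lambda>_. 0) u \<gamma> + ?ind (\<lambda>_. 0) \<gamma>)"
    unfolding c by (rule de[OF zero_jet_index[OF m]])
  then have "wnorm_le c (\<rho> + norm (b (\<lambda>_. 0)) * wt (\<lambda>_. 0))"
    using wnorm_le_add[OF nbe[OF zero_jet_index[OF m] nbu] wnorm_le_indicator[of "\<lambda>_. 0" "b (\<lambda>_. 0)"]] by (simp add: ps_derivs_zero)
  then have conv: "ps_conv UNIV c (\<lambda>_. \<tau> / 2)"
    by (rule ps_conv_mono[OF wnorm_le_ps_conv]) (use \<tau> in \<open>auto simp: rad_def\<close>)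
  have sub: "obox a (\<lambda>_. \<tau> / 2) \<subseteq> closed_box a"
  proof
    fix x assume x: "x \<in> obox a (\<lambda>_. \<tau> / 2)"
    have "\<bar>x $ i - a $ i\<bar> \<le> rad i" for i
    proof -
      have "\<bar>x $ i - a $ i\<bar> < \<tau> / 2" using x by (simp add: obox_def)
      moreover have "\<tau> / 2 \<le> rad i" using \<tau> by (simp add: rad_def)
      ultimately show ?thesis by linarith
    qed
    then show "x \<in> closed_box a" by (simp add: closed_box_def)
  qed
  have subX: "obox a (\<lambda>_. \<tau> / 2) \<subseteq> X"
  proof
    fix x assume x: "x \<in> obox a (\<lambda>_. \<tau> / 2)"
    have "\<bar>x $ i - a $ i\<bar> \<le> \<rho>" for i
    proof -
      have "\<bar>x $ i - a $ i\<bar> < \<tau> / 2" using x by (simp add: obox_def)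
      then show ?thesis using \<tau> r by simp
    qed
    then show "x \<in> X" using Geq[of x b] \<rho> by (simp add: b_def)
  qed
  have pde: "rps a (ps_derivs (pure_index k m) c) x = G x (\<lambda>\<alpha>\<in>?J. rps a (ps_derivs \<alpha> c) x)" if "x \<in> obox a (\<lambda>_. \<tau> / 2)" for x
  proof -
    have x: "x \<in> closed_box a" using that sub by blast
    have "rps a (ps_derivs (pure_index k m) c) x = rps a (\<Phi> u) x"
      unfolding fix_u c by (subst ps_derivs_pure_primitive) (use P0 in auto)
    also have "\<dots> = H u x" using \<Phi>[OF nbu] x by (simp add: sol_def)
    also have "\<dots> = G x (\<lambda>\<alpha>\<in>?J. rps a (ps_derivs \<alpha> c) x)"
      unfolding H_def c using rde[OF _ nbu x] by (intro arg_cong[where f = "G x"]) auto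
    finally show ?thesis .
  qed
  have "\<forall>\<alpha>. \<alpha> k < m \<longrightarrow> c \<alpha> = P \<alpha>" by (simp add: c_def iterated_primitive_def)
  then show ?thesis using conv subX pde \<tau> by (intro exI[of _ "\<tau> / 2"] conjI exI[of _ c]) auto
qed

text \<open>The equation expresses the coefficients of order \<open>m + j\<close> in the
  distinguished variable by those of lower order: up to order \<open>j\<close>, an argument of
  \<open>G\<close> involves orders at most \<open>j + m - 1\<close> of the solution. Induction over
  \<open>j\<close> starts from the equal Cauchy data.\<close>

theorem local_uniqueness:
  fixes X :: "(real ^ 'n::finite) set"
  assumes X: "open X" and m: "0 < m" and G: "analytic_in_all_variables X (jet_indices k m) G" and a: "a \<in> X"
    and c: "ps_conv UNIV c (\<lambda>_. R)" and d: "ps_conv UNIV d (\<lambda>_. R)" and R: "R > 0" and V: "open V" "a \<in> V"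
    and pc: "\<And>x. x \<in> V \<Longrightarrow> rps a (ps_derivs (pure_index k m) c) x = G x (\<lambda>\<alpha>\<in>jet_indices k m. rps a (ps_derivs \<alpha> c) x)"
    and pd: "\<And>x. x \<in> V \<Longrightarrow> rps a (ps_derivs (pure_index k m) d) x = G x (\<lambda>\<alpha>\<in>jet_indices k m. rps a (ps_derivs \<alpha> d) x)"
    and init: "\<And>\<alpha>. \<alpha> k < m \<Longrightarrow> c \<alpha> = d \<alpha>"
  shows "c = d"
proof -
  let ?J = "jet_indices k m"
  note J = finite_jet_indices[of k m]
  define b where "b = (\<lambda>\<alpha>\<in>?J. ps_derivs \<alpha> c (\<lambda>_. 0))"
  have bd: "b \<alpha> = ps_derivs \<alpha> d (\<lambda>_. 0)" if "\<alpha> \<in> ?J" for \<alpha>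
    using that init[of \<alpha>] jet_index_less[OF that] by (simp add: b_def ps_derivs_def)
  obtain \<rho> C where \<rho>: "\<rho> > 0" and C: "ps_conv (Sum_Type.Plus UNIV ?J) C (\<lambda>_. \<rho>)"
    and Geq: "\<And>x \<xi>. (\<And>i. \<bar>x $ i - a $ i\<bar> \<le> \<rho>) \<Longrightarrow> \<xi> \<in> ?J \<rightarrow>\<^sub>E UNIV \<Longrightarrow> (\<And>j. j \<in> ?J \<Longrightarrow> norm (\<xi> j - b j) \<le> \<rho>) \<Longrightarrow>
       x \<in> X \<and> G x \<xi> = ps (Sum_Type.Plus UNIV ?J) C (joint_args a b x \<xi>)"
    by (rule analytic_in_all_variables_ps[OF X J G a, of b]) (auto simp: b_def)
  define K :: "(('n \<Rightarrow> nat) \<Rightarrow> complex) \<Rightarrow> ('n \<Rightarrow> nat) \<Rightarrow> real" where "K c \<alpha> = infsum (\<lambda>\<gamma>. norm (ps_derivs \<alpha> c \<gamma>) * (R/2) ^ (\<Sum>i\<in>UNIV. \<gamma> i)) UNIV" for c \<alpha>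
  have conv: "ps_conv UNIV (ps_derivs \<alpha> c') (\<lambda>_. R / 2)" if "ps_conv UNIV c' (\<lambda>_. R)" for \<alpha> c'
    by (rule ps_conv_inD[OF ps_conv_in_derivs[OF ps_conv_imp_in[OF that]]]) (use R in auto)
  obtain \<epsilon> where \<epsilon>: "\<epsilon> > 0" "ball a \<epsilon> \<subseteq> V" using V openE by blast
  obtain r where r: "0 < r" "r \<le> R / 2" "r \<le> min \<rho> (\<epsilon> / real CARD('n))"
    "\<And>\<alpha>. \<alpha> \<in> ?J \<Longrightarrow> r / (R/2) * (max (K c \<alpha>) (K d \<alpha>)) \<le> \<rho>"
    by (rule small_scale[OF J, of "R/2" "\<rho>" "min \<rho> (\<epsilon> / real CARD('n))" "\<lambda>\<alpha>. max (K c \<alpha>) (K d \<alpha>)"]) (use R \<rho> \<epsilon> in auto)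
  \<comment> \<open>Here agreement of coefficients matters and not the size of primitives, so both
    scales are taken equal.\<close>
  interpret weighted k r r by unfold_locales (use r in auto)
  have boxV: "x \<in> V" if "x \<in> closed_box a" for x
  proof -
    have "\<bar>x $ i - a $ i\<bar> \<le> r / 2" for i using that by (auto simp: closed_box_def rad_def)
    then have "dist x a \<le> real CARD('n) * (r / 2)" by (rule dist_le_of_components)
    also have "\<dots> \<le> \<epsilon> / 2" using r by (simp add: field_simps)
    also have "\<dots> < \<epsilon>" using \<epsilon> by simp
    finally show ?thesis using \<epsilon> by (auto simp: dist_commute)
  qed
  let ?e = "\<lambda>c \<alpha>. (ps_derivs \<alpha> c)((\<lambda>_. 0) := 0)"
  have nbe: "wnorm_le (?e c' \<alpha>) \<rho>" if "\<alpha> \<in> ?J" "ps_conv UNIV c' (\<lambda>_. R)" "K c' \<alpha> \<le> max (K c \<alpha>) (K d \<alpha>)" for c' \<alpha>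
  proof (rule wnorm_le_mono)
    show "wnorm_le (?e c' \<alpha>) (r / (R/2) * K c' \<alpha>)"
      unfolding K_def by (rule wnorm_le_small[OF conv[OF that(2)]]) (use R r in auto)
    have "r / (R/2) * K c' \<alpha> \<le> r / (R/2) * (max (K c \<alpha>) (K d \<alpha>))"
      using r R that(3) by (intro mult_left_mono) auto
    also have "\<dots> \<le> \<rho>" by (rule r(4)[OF that(1)])
    finally show "r / (R/2) * K c' \<alpha> \<le> \<rho>" .
  qed
  have re: "rps a (ps_derivs \<alpha> c') x - b \<alpha> = rps a (?e c' \<alpha>) x" 
    if "wnorm_le (?e c' \<alpha>) \<rho>" "b \<alpha> = ps_derivs \<alpha> c' (\<lambda>_. 0)" "x \<in> closed_box a" for \<alpha> c' x
  proof -
    have "ps_derivs \<alpha> c' = (\<lambda>\<gamma>. ?e c' \<alpha> \<gamma> + (if \<gamma> = (\<lambda>_. 0) then b \<alpha> else 0))" using that(2) by auto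
    then have "rps a (ps_derivs \<alpha> c') x = rps a (\<lambda>\<gamma>. ?e c' \<alpha> \<gamma> + (if \<gamma> = (\<lambda>_. 0) then b \<alpha> else 0)) x" by simp
    also have "\<dots> = rps a (?e c' \<alpha>) x + b \<alpha>"
      unfolding rps_add[OF that(1) wnorm_le_indicator that(3)] by (simp add: rps_indicator mpow_def)
    finally show ?thesis by simp
  qed
  have "\<forall>\<alpha>. \<alpha> k < m + j \<longrightarrow> c \<alpha> = d \<alpha>" for j
  proof (induction j)
    case 0
    then show ?case using init by simp
  next
    case (Suc j)
    obtain M where "jrel a (Suc j) M (\<lambda>x. G x (\<lambda>\<alpha>\<in>?J. rps a (ps_derivs \<alpha> c) x)) (\<lambda>x. G x (\<lambda>\<alpha>\<in>?J. rps a (ps_derivs \<alpha> d) x))"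
    proof (rule that, rule jrel_analytic_composition[OF J C _ _ Geq])
      fix \<alpha> assume \<alpha>: "\<alpha> \<in> ?J"
      show "jrel a (Suc j) \<rho> (\<lambda>x. rps a (ps_derivs \<alpha> c) x - b \<alpha>) (\<lambda>x. rps a (ps_derivs \<alpha> d) x - b \<alpha>)"
      proof (rule jrelI[of "?e c \<alpha>" _ "?e d \<alpha>"])
        show n: "wnorm_le (?e c \<alpha>) \<rho>" "wnorm_le (?e d \<alpha>) \<rho>" by (rule nbe[OF \<alpha>], use c d in auto)+
        show "rps a (ps_derivs \<alpha> c) x - b \<alpha> = rps a (?e c \<alpha>) x" if "x \<in> closed_box a" for x
          by (rule re[OF n(1) _ that]) (use \<alpha> in \<open>simp add: b_def\<close>)
        show "rps a (ps_derivs \<alpha> d) x - b \<alpha> = rps a (?e d \<alpha>) x" if "x \<in> closed_box a" for x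
          by (rule re[OF n(2) bd[OF \<alpha>] that])
        show "?e c \<alpha> \<gamma> = ?e d \<alpha> \<gamma>" if "\<gamma> k < Suc j" for \<gamma>
        proof -
          have "\<gamma> k + \<alpha> k < m + j" using that jet_index_less[OF \<alpha>] by simp
          then show ?thesis using Suc by (simp add: ps_derivs_def)
        qed
      qed
    qed (use r in auto)
    then obtain e e' where e: "wnorm_le e M" "wnorm_le e' M" 
      "\<forall>x\<in>closed_box a. G x (\<lambda>\<alpha>\<in>?J. rps a (ps_derivs \<alpha> c) x) = rps a e x \<and> G x (\<lambda>\<alpha>\<in>?J. rps a (ps_derivs \<alpha> d) x) = rps a e' x"
      "\<forall>\<alpha>. \<alpha> k < Suc j \<longrightarrow> e \<alpha> = e' \<alpha>" unfolding jrel_def by blast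
    \<comment> \<open>By the pointwise equation on the box, the coefficients of the right-hand side
      are those of the highest derivative.\<close>
    have 1: "e = ps_derivs (pure_index k m) c"
      by (rule wnorm_le_identity[OF e(1) ps_conv_in_derivs[OF ps_conv_imp_in[OF c]], of a]) (use R e(3) pc boxV in auto)
    have 2: "e' = ps_derivs (pure_index k m) d"
      by (rule wnorm_le_identity[OF e(2) ps_conv_in_derivs[OF ps_conv_imp_in[OF d]], of a]) (use R e(3) pd boxV in auto)
    show ?case
    proof (intro allI impI)
      fix \<alpha> :: "'n \<Rightarrow> nat" assume \<alpha>: "\<alpha> k < m + Suc j"
      show "c \<alpha> = d \<alpha>"
      proof (cases "\<alpha> k < m")
        case True
        then show ?thesis using init by simp
      next
        case False
        let ?\<gamma> = "\<alpha>(k := \<alpha> k - m)"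
        have g: "(\<lambda>i. ?\<gamma> i + pure_index k m i) = \<alpha>" using False by auto
        have "e ?\<gamma> = e' ?\<gamma>" using e(4) \<alpha> False by simp
        then have "(\<Prod>i\<in>UNIV. fact (?\<gamma> i + pure_index k m i) / fact (?\<gamma> i)) * c \<alpha> = (\<Prod>i\<in>UNIV. fact (?\<gamma> i + pure_index k m i) / fact (?\<gamma> i)) * d \<alpha>"
          unfolding 1 2 ps_derivs_def g .
        moreover have "(\<Prod>i\<in>UNIV. fact (?\<gamma> i + pure_index k m i) / fact (?\<gamma> i)) \<noteq> (0::complex)" by simp
        ultimately show ?thesis using mult_left_cancel by blast
      qed
    qed
  qed
  then have "c \<alpha> = d \<alpha>" for \<alpha> by (metis le_add2 less_Suc_eq_le add_Suc_right)
  then show ?thesis by blast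
qed

section \<open>The ideals\<close>

text \<open>One neighbourhood serves all indices from \<open>l\<close> on, whereas
  \<open>I_ideal\<close> lets it shrink with the index; the category argument closes this gap. Both
  ideals are handled through this one description.\<close>

definition generically_null :: "(real ^ 'n::finite) set \<Rightarrow> (nat \<Rightarrow> real ^ 'n \<Rightarrow> complex) set" where
  "generically_null Y = {w \<in> carrier (smooth_seq_ring Y). \<exists>D. open D \<and> D \<subseteq> Y \<and> Y \<subseteq> closure D \<and>
     (\<forall>x\<in>D. \<exists>l \<Delta>. open \<Delta> \<and> x \<in> \<Delta> \<and> (\<forall>\<mu>\<ge>l. \<forall>z\<in>\<Delta>. w \<mu> z = 0))}"

lemma carrier_smooth_seq_ring: "w \<in> carrier (smooth_seq_ring Y) \<longleftrightarrow> (\<forall>\<nu>. w \<nu> \<in> smooth_functions Y)"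
  by (simp add: smooth_seq_ring_def)

lemma nowhere_dense_in_open:
  fixes N Y :: "'a::topological_space set"
  assumes "open Y" "N \<subseteq> Y"
  shows "nowhere_dense_in (top_of_set Y) N \<longleftrightarrow> (\<forall>V. open V \<and> V \<subseteq> Y \<and> V \<subseteq> closure N \<longrightarrow> V = {})"
proof -
  have "top_of_set Y interior_of (top_of_set Y closure_of N) = \<Union>{V. openin (top_of_set Y) V \<and> V \<subseteq> Y \<inter> closure N}"
    using assms by (simp add: interior_of_def closure_of_subtopology Int_absorb1) blast
  also have "{V. openin (top_of_set Y) V \<and> V \<subseteq> Y \<inter> closure N} = {V. open V \<and> V \<subseteq> Y \<and> V \<subseteq> closure N}"
    using assms by (auto simp: openin_open_eq)
  finally show ?thesis using assms by (auto simp: nowhere_dense_in_def)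
qed

text \<open>The witness \<open>S \<mu>\<close> is the complement of the interior of the set where
  \<open>w\<close> vanishes from index \<open>\<mu>\<close> on. These sets decrease, so their upper
  limit is their intersection, which misses the open dense \<open>D\<close> and is therefore nowhere
  dense.\<close>

lemma generically_null_subset_I_Baire_I:
  assumes Y: "open Y"
  shows "generically_null Y \<subseteq> I_Baire_I Y"
proof
  fix w assume "w \<in> generically_null Y"
  then obtain D where w: "w \<in> carrier (smooth_seq_ring Y)" and D: "open D" "D \<subseteq> Y" "Y \<subseteq> closure D"
    and null: "\<And>x. x \<in> D \<Longrightarrow> \<exists>l \<Delta>. open \<Delta> \<and> x \<in> \<Delta> \<and> (\<forall>\<mu>\<ge>l. \<forall>z\<in>\<Delta>. w \<mu> z = 0)"
    unfolding generically_null_def by blast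
  define E where "E l = {x \<in> Y. \<forall>\<mu>\<ge>l. w \<mu> x = 0}" for l
  define S where "S \<mu> = Y - interior (E \<mu>)" for \<mu>
  have EY: "interior (E l) \<subseteq> Y" for l using interior_subset[of "E l"] by (auto simp: E_def)
  have mono: "interior (E l) \<subseteq> interior (E l')" if "l \<le> l'" for l l'
    by (rule interior_mono) (use that in \<open>auto simp: E_def\<close>)
  have YS: "Y - S \<mu> = interior (E \<mu>)" for \<mu> using EY by (auto simp: S_def)
  have ls: "limsup_set S = Y - (\<Union>l. interior (E l))"
  proof
    show "limsup_set S \<subseteq> Y - (\<Union>l. interior (E l))"
    proof
      fix x assume x: "x \<in> limsup_set S"
      have "x \<notin> interior (E l)" "x \<in> Y" for l
      proof -
        from x obtain \<mu> where "\<mu> \<ge> l" "x \<in> S \<mu>" unfolding limsup_set_def by blast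
        then show "x \<notin> interior (E l)" "x \<in> Y" using mono by (auto simp: S_def)
      qed
      then show "x \<in> Y - (\<Union>l. interior (E l))" by blast
    qed
    show "Y - (\<Union>l. interior (E l)) \<subseteq> limsup_set S" by (auto simp: limsup_set_def S_def)
  qed
  have DE: "D \<subseteq> (\<Union>l. interior (E l))"
  proof
    fix x assume x: "x \<in> D"
    with null obtain l \<Delta> where "open \<Delta>" "x \<in> \<Delta>" "\<forall>\<mu>\<ge>l. \<forall>z\<in>\<Delta>. w \<mu> z = 0" by blast
    then have "x \<in> interior (E l)"
      using D x by (intro interiorI[of "\<Delta> \<inter> D"]) (auto simp: E_def)
    then show "x \<in> (\<Union>l. interior (E l))" by blast
  qed
  have "nowhere_dense_in (top_of_set Y) (limsup_set S)"
    unfolding ls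
  proof (subst nowhere_dense_in_open[OF Y], blast, intro allI impI)
    fix V assume V: "open V \<and> V \<subseteq> Y \<and> V \<subseteq> closure (Y - (\<Union>l. interior (E l)))"
    have "closure (Y - (\<Union>l. interior (E l))) \<inter> D = {}"
    proof -
      have "closure (Y - (\<Union>l. interior (E l))) \<subseteq> - D"
        using DE D(1) by (intro closure_minimal) auto
      then show ?thesis by blast
    qed
    then have "V \<inter> D = {}" using V by blast
    then have "V \<inter> closure D = {}" using V open_Int_closure_eq_empty by blast
    then show "V = {}" using V D by blast
  qed
  then have "limsup_set S \<in> S_Baire_I Y"
    unfolding S_Baire_I_def first_category_in_def by (auto intro!: exI[of _ "\<lambda>_. limsup_set S"])
  moreover have "w \<in> I_ideal Y S"
    unfolding I_ideal_def
  proof (intro CollectI conjI ballI w)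
    fix x assume "x \<in> Y - limsup_set S"
    then obtain l where l: "x \<in> interior (E l)" unfolding ls by blast
    show "\<exists>l. \<forall>\<mu>\<ge>l. \<exists>\<Delta>. open \<Delta> \<and> x \<in> \<Delta> \<and> \<Delta> \<subseteq> Y - S \<mu> \<and> (\<forall>z\<in>\<Delta>. w \<mu> z = 0)"
    proof (intro exI[of _ l] allI impI)
      fix \<mu> assume "l \<le> \<mu>"
      then have "x \<in> interior (E \<mu>)" using mono l by blast
      moreover have "\<forall>z\<in>interior (E \<mu>). w \<mu> z = 0" using interior_subset[of "E \<mu>"] by (auto simp: E_def)
      ultimately show "\<exists>\<Delta>. open \<Delta> \<and> x \<in> \<Delta> \<and> \<Delta> \<subseteq> Y - S \<mu> \<and> (\<forall>z\<in>\<Delta>. w \<mu> z = 0)"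
        unfolding YS by (intro exI[of _ "interior (E \<mu>)"]) auto
    qed
  qed
  moreover have "\<forall>\<mu>. S \<mu> \<subseteq> Y \<and> open (Y - S \<mu>)" unfolding YS by (auto simp: S_def)
  ultimately show "w \<in> I_Baire_I Y" unfolding I_Baire_I_def by blast
qed

lemma multi_deriv_locally_zero:
  assumes "open \<Delta>" "x \<in> \<Delta>" "\<And>z. z \<in> \<Delta> \<Longrightarrow> f z = 0"
  shows "multi_deriv p f x = 0"
proof -
  have "partial_deriv i (\<lambda>_. 0) = (\<lambda>_. 0)" for i :: 'a
    by (rule ext) (simp add: partial_deriv_has_derivative[where f' = "\<lambda>_. 0"])
  then have "foldr partial_deriv js (\<lambda>_. 0) = (\<lambda>_. 0)" for js :: "'a list" by (induction js) auto
  then have "multi_deriv p (\<lambda>_ :: real ^ 'a. 0) x = 0" by (simp add: multi_deriv_eq_foldr)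
  moreover have "multi_deriv p f x = multi_deriv p (\<lambda>_. 0) x" by (rule multi_deriv_cong[OF assms])
  ultimately show ?thesis by simp
qed

lemma I_Baire_I_subset_J_Baire_I: "I_Baire_I Y \<subseteq> J_Baire_I Y"
proof
  fix w assume "w \<in> I_Baire_I Y"
  then obtain S where S: "w \<in> I_ideal Y S" "limsup_set S \<in> S_Baire_I Y" unfolding I_Baire_I_def by blast
  have "w \<in> J_ideal Y (limsup_set S)"
    unfolding J_ideal_def
  proof (intro CollectI conjI ballI)
    show "w \<in> carrier (smooth_seq_ring Y)" using S(1) by (simp add: I_ideal_def)
    fix x assume "x \<in> Y - limsup_set S"
    with S(1) obtain l where "\<forall>\<mu>\<ge>l. \<exists>\<Delta>. open \<Delta> \<and> x \<in> \<Delta> \<and> \<Delta> \<subseteq> Y - S \<mu> \<and> (\<forall>z\<in>\<Delta>. w \<mu> z = 0)"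
      unfolding I_ideal_def by blast
    then have l: "\<And>\<mu>. \<mu> \<ge> l \<Longrightarrow> \<exists>\<Delta>. open \<Delta> \<and> x \<in> \<Delta> \<and> (\<forall>z\<in>\<Delta>. w \<mu> z = 0)" by blast
    show "\<exists>l. \<forall>\<mu>\<ge>l. \<forall>p. multi_deriv p (w \<mu>) x = 0"
    proof (intro exI[of _ l] allI impI)
      fix \<mu> p assume "l \<le> \<mu>"
      with l obtain \<Delta> where \<Delta>: "open \<Delta>" "x \<in> \<Delta>" "\<forall>z\<in>\<Delta>. w \<mu> z = 0" by blast
      show "multi_deriv p (w \<mu>) x = 0"
        by (rule multi_deriv_locally_zero[OF \<Delta>(1,2)]) (use \<Delta>(3) in blast)
    qed
  qed
  with S(2) show "w \<in> J_Baire_I Y" unfolding J_Baire_I_def by blast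
qed

lemma complement_closed_dense:
  "closed A \<Longrightarrow> interior A = {} \<Longrightarrow> openin (top_of_set UNIV) (- A) \<and> UNIV \<subseteq> closure (- A)"
  by (simp add: closure_complement open_Compl)

text \<open>
  Baire's theorem: off a set of first category, \<open>Y\<close> is the union of the closed sets on
  which \<open>w \<mu>\<close> vanishes for all \<open>\<mu> \<ge> l\<close>, so the interiors of these sets are dense.
\<close>

lemma J_Baire_I_subset_generically_null:
  assumes Y: "open Y"
  shows "J_Baire_I Y \<subseteq> generically_null Y"
proof
  fix w assume "w \<in> J_Baire_I Y"
  then obtain \<Sigma> where \<Sigma>: "\<Sigma> \<in> S_Baire_I Y" and w: "w \<in> carrier (smooth_seq_ring Y)"
    and van: "\<And>x. x \<in> Y - \<Sigma> \<Longrightarrow> \<exists>l. \<forall>\<mu>\<ge>l. \<forall>p. multi_deriv p (w \<mu>) x = 0"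
    unfolding J_Baire_I_def J_ideal_def by blast
  obtain N where N: "\<And>i. nowhere_dense_in (top_of_set Y) (N i)" "\<Sigma> = (\<Union>i::nat. N i)"
    using \<Sigma> unfolding S_Baire_I_def first_category_in_def by blast
  have NY: "N i \<subseteq> Y" for i using N(1)[of i] by (simp add: nowhere_dense_in_def)
  define E where "E l = {x \<in> Y. \<forall>\<mu>\<ge>l. w \<mu> x = 0}" for l
  define D where "D = (\<Union>l. interior (E l))"
  have DY: "D \<subseteq> Y" using interior_subset by (fastforce simp: D_def E_def)
  have oD: "open D" by (auto simp: D_def)
  have dense: "Y \<subseteq> closure D"
  proof (rule ccontr)
    assume "\<not> ?thesis"
    then obtain y where y: "y \<in> Y - closure D" by blast
    have "open (Y - closure D)" using Y by auto
    then obtain e where e: "e > 0" "cball y e \<subseteq> Y - closure D" using y open_contains_cball by blast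
    \<comment> \<open>Intersecting with a closed ball inside \<open>Y\<close> makes the sets closed
      in the whole space, although \<open>E l\<close> is only relatively closed in \<open>Y\<close>;
      Baire's theorem can then be applied to their complements in \<open>UNIV\<close>.\<close>
    let ?K = "cball y e"
    let ?T = "range (\<lambda>i. - (closure (N i) \<inter> ?K)) \<union> range (\<lambda>l. - (E l \<inter> ?K))"
    have "UNIV \<subseteq> closure (\<Inter>?T)"
    proof (rule Baire)
      fix T assume "T \<in> ?T"
      then consider i where "T = - (closure (N i) \<inter> ?K)" | l where "T = - (E l \<inter> ?K)" by blast
      then show "openin (top_of_set UNIV) T \<and> UNIV \<subseteq> closure T"
      proof cases
        case 1
        have "interior (closure (N i) \<inter> ?K) = {}"
        proof (rule N(1)[of i, unfolded nowhere_dense_in_open[OF Y NY], rule_format], intro conjI)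
          show "interior (closure (N i) \<inter> ?K) \<subseteq> Y" using interior_subset e by blast
          show "interior (closure (N i) \<inter> ?K) \<subseteq> closure (N i)" using interior_subset by blast
        qed (rule open_interior)
        moreover have "closed (closure (N i) \<inter> ?K)" by auto
        ultimately show ?thesis unfolding 1 by (intro complement_closed_dense)
      next
        case 2
        have cont: "continuous_on ?K (w \<mu>)" for \<mu>
        proof -
          have "smooth_on Y (w \<mu>)" using w by (simp add: carrier_smooth_seq_ring smooth_functions_iff)
          then show ?thesis using differentiable_imp_continuous_on[OF smooth_on_differentiable] e(2) continuous_on_subset by blast
        qed
        have "E l \<inter> ?K = ?K \<inter> (\<Inter>\<mu>\<in>{l..}. {x \<in> ?K. w \<mu> x = 0})" using e(2) by (auto simp: E_def)
        also have "closed \<dots>"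
          by (intro closed_Int closed_cball closed_INT ballI continuous_closed_preimage_constant cont)
        finally have "closed (E l \<inter> ?K)" .
        moreover have "interior (E l \<inter> ?K) = {}"
        proof -
          have "interior (E l \<inter> ?K) \<subseteq> D" unfolding D_def using interior_mono[of "E l \<inter> ?K" "E l"] by blast
          moreover have "interior (E l \<inter> ?K) \<subseteq> - closure D" using interior_subset e(2) by blast
          ultimately show ?thesis using closure_subset by blast
        qed
        ultimately show ?thesis unfolding 2 by (intro complement_closed_dense)
      qed
    qed auto
    moreover have "y \<in> ball y e" using e by simp
    ultimately have "ball y e \<inter> (\<Inter>?T) \<noteq> {}"
      using open_Int_closure_eq_empty[OF open_ball, of y e "\<Inter>?T"] by blast
    then obtain z where z: "z \<in> ball y e" "z \<in> \<Inter>?T" by blast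
    then have zK: "z \<in> ?K" by auto
    have "z \<in> Y" using zK e(2) by blast
    have "z \<notin> N i" for i
    proof -
      have "z \<in> - (closure (N i) \<inter> ?K)" using z(2) by blast
      then show ?thesis using zK closure_subset by blast
    qed
    then have "z \<in> Y - \<Sigma>" using \<open>z \<in> Y\<close> N(2) by blast
    from van[OF this] obtain l where "\<forall>\<mu>\<ge>l. \<forall>p. multi_deriv p (w \<mu>) z = 0" by blast
    then have "\<forall>\<mu>\<ge>l. w \<mu> z = 0" by (metis multi_deriv_0)
    then have "z \<in> E l \<inter> ?K" using \<open>z \<in> Y\<close> zK by (simp add: E_def)
    moreover have "z \<in> - (E l \<inter> ?K)" using z(2) by blast
    ultimately show False by blast
  qed
  have "\<exists>l \<Delta>. open \<Delta> \<and> x \<in> \<Delta> \<and> (\<forall>\<mu>\<ge>l. \<forall>z\<in>\<Delta>. w \<mu> z = 0)" if "x \<in> D" for x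
  proof -
    from that obtain l where "x \<in> interior (E l)" by (auto simp: D_def)
    moreover have "\<forall>\<mu>\<ge>l. \<forall>z\<in>interior (E l). w \<mu> z = 0"
      using interior_subset[of "E l"] by (auto simp: E_def)
    ultimately show ?thesis by (intro exI[of _ l] exI[of _ "interior (E l)"]) auto
  qed
  then show "w \<in> generically_null Y"
    unfolding generically_null_def using w oD DY dense by blast
qed

lemma I_Baire_I_eq: "open Y \<Longrightarrow> I_Baire_I Y = generically_null Y"
  and J_Baire_I_eq: "open Y \<Longrightarrow> J_Baire_I Y = generically_null Y"
  using generically_null_subset_I_Baire_I I_Baire_I_subset_J_Baire_I J_Baire_I_subset_generically_null by blast+

section \<open>Classes of sequences\<close>

text \<open>Equality modulo \<open>generically_null\<close>, stated without subtraction so that a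
  nonlinear local operator visibly preserves it.\<close>

definition generically_equal :: "(real ^ 'n::finite) set \<Rightarrow> (nat \<Rightarrow> real ^ 'n \<Rightarrow> complex) \<Rightarrow> (nat \<Rightarrow> real ^ 'n \<Rightarrow> complex) \<Rightarrow> bool" where
  "generically_equal Y s t \<longleftrightarrow> (\<exists>D. open D \<and> D \<subseteq> Y \<and> Y \<subseteq> closure D \<and>
     (\<forall>x\<in>D. \<exists>l \<Delta>. open \<Delta> \<and> x \<in> \<Delta> \<and> (\<forall>\<mu>\<ge>l. \<forall>z\<in>\<Delta>. s \<mu> z = t \<mu> z)))"

lemma generically_equal_sym: "generically_equal Y s t \<Longrightarrow> generically_equal Y t s"
  unfolding generically_equal_def by metis

lemma dense_Int_open:
  fixes D Y :: "'a::topological_space set"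
  assumes "open D" "Y \<subseteq> closure D" "open D'" "Y \<subseteq> closure D'" "D' \<subseteq> Y"
  shows "Y \<subseteq> closure (D \<inter> D')"
proof -
  have "D' \<subseteq> closure (D \<inter> D')"
  proof -
    have "D' \<inter> closure D \<subseteq> closure (D' \<inter> D)" by (rule open_Int_closure_subset[OF assms(3)])
    then show ?thesis using assms by (auto simp: Int_commute)
  qed
  then have "closure D' \<subseteq> closure (D \<inter> D')" by (simp add: closure_minimal)
  then show ?thesis using assms by blast
qed

lemma generically_equal_trans:
  assumes "generically_equal Y s t" "generically_equal Y t u"
  shows "generically_equal Y s u"
proof -
  obtain D where D: "open D" "D \<subseteq> Y" "Y \<subseteq> closure D"
    "\<And>x. x \<in> D \<Longrightarrow> \<exists>l \<Delta>. open \<Delta> \<and> x \<in> \<Delta> \<and> (\<forall>\<mu>\<ge>l. \<forall>z\<in>\<Delta>. s \<mu> z = t \<mu> z)"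
    using assms(1) unfolding generically_equal_def by blast
  obtain D' where D': "open D'" "D' \<subseteq> Y" "Y \<subseteq> closure D'"
    "\<And>x. x \<in> D' \<Longrightarrow> \<exists>l \<Delta>. open \<Delta> \<and> x \<in> \<Delta> \<and> (\<forall>\<mu>\<ge>l. \<forall>z\<in>\<Delta>. t \<mu> z = u \<mu> z)"
    using assms(2) unfolding generically_equal_def by blast
  show ?thesis
    unfolding generically_equal_def
  proof (intro exI[of _ "D \<inter> D'"] conjI ballI)
    show "Y \<subseteq> closure (D \<inter> D')" by (rule dense_Int_open[OF D(1,3) D'(1,3,2)])
    fix x assume x: "x \<in> D \<inter> D'"
    obtain l \<Delta> where 1: "open \<Delta>" "x \<in> \<Delta>" "\<forall>\<mu>\<ge>l. \<forall>z\<in>\<Delta>. s \<mu> z = t \<mu> z" using D(4)[of x] x by blast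
    obtain l' \<Delta>' where 2: "open \<Delta>'" "x \<in> \<Delta>'" "\<forall>\<mu>\<ge>l'. \<forall>z\<in>\<Delta>'. t \<mu> z = u \<mu> z" using D'(4)[of x] x by blast
    show "\<exists>l \<Delta>. open \<Delta> \<and> x \<in> \<Delta> \<and> (\<forall>\<mu>\<ge>l. \<forall>z\<in>\<Delta>. s \<mu> z = u \<mu> z)"
      using 1 2 by (intro exI[of _ "max l l'"] exI[of _ "\<Delta> \<inter> \<Delta>'"]) auto
  qed (use D D' in auto)
qed

text \<open>Adding \<open>s\<close> and subtracting \<open>s\<close> pass between null sequences and
  sequences generically equal to \<open>s\<close>, both operations preserving smoothness. From here
  on classes are compared by agreement on open sets alone.\<close>

lemma seq_class_eq:
  assumes Y: "open Y" and I: "\<I> Y = generically_null Y" and s: "s \<in> carrier (smooth_seq_ring Y)"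
  shows "seq_class \<I> Y s = {t \<in> carrier (smooth_seq_ring Y). generically_equal Y t s}"
proof -
  have sc: "seq_class \<I> Y s = {(\<lambda>\<nu>. \<lambda>x\<in>Y. h \<nu> x + s \<nu> x) | h. h \<in> generically_null Y}"
    unfolding seq_class_def a_r_coset_def' I by (auto simp: smooth_seq_ring_def)
  have sm: "smooth_on Y (s \<nu>)" "s \<nu> \<in> extensional Y" for \<nu>
    using s by (auto simp: carrier_smooth_seq_ring smooth_functions_iff)
  show ?thesis
  proof (intro equalityI subsetI)
    fix t assume "t \<in> seq_class \<I> Y s"
    then obtain h where h: "h \<in> generically_null Y" "t = (\<lambda>\<nu>. \<lambda>x\<in>Y. h \<nu> x + s \<nu> x)" unfolding sc by blast
    obtain D where D: "open D" "D \<subseteq> Y" "Y \<subseteq> closure D"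
      "\<And>x. x \<in> D \<Longrightarrow> \<exists>l \<Delta>. open \<Delta> \<and> x \<in> \<Delta> \<and> (\<forall>\<mu>\<ge>l. \<forall>z\<in>\<Delta>. h \<mu> z = 0)"
      using h(1) unfolding generically_null_def by blast
    have "smooth_on Y (h \<nu>)" for \<nu>
      using h(1) by (auto simp: generically_null_def carrier_smooth_seq_ring smooth_functions_iff)
    then have "t \<in> carrier (smooth_seq_ring Y)"
      unfolding carrier_smooth_seq_ring h(2) using Y sm by (auto intro!: smooth_on_restrict smooth_on_add)
    moreover have "generically_equal Y t s"
      unfolding generically_equal_def
    proof (intro exI[of _ D] conjI ballI D(1-3))
      fix x assume x: "x \<in> D"
      obtain l \<Delta> where "open \<Delta>" "x \<in> \<Delta>" "\<forall>\<mu>\<ge>l. \<forall>z\<in>\<Delta>. h \<mu> z = 0" using D(4)[OF x] by blast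
      then show "\<exists>l \<Delta>. open \<Delta> \<and> x \<in> \<Delta> \<and> (\<forall>\<mu>\<ge>l. \<forall>z\<in>\<Delta>. t \<mu> z = s \<mu> z)"
        using D x by (intro exI[of _ l] exI[of _ "\<Delta> \<inter> D"]) (auto simp: h(2))
    qed
    ultimately show "t \<in> {t \<in> carrier (smooth_seq_ring Y). generically_equal Y t s}" by simp
  next
    fix t assume "t \<in> {t \<in> carrier (smooth_seq_ring Y). generically_equal Y t s}"
    then have t: "t \<in> carrier (smooth_seq_ring Y)" "generically_equal Y t s" by auto
    have tm: "smooth_on Y (t \<nu>)" "t \<nu> \<in> extensional Y" for \<nu>
      using t(1) by (auto simp: carrier_smooth_seq_ring smooth_functions_iff)
    define h where "h = (\<lambda>\<nu>. \<lambda>x\<in>Y. t \<nu> x - s \<nu> x)"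
    obtain D where D: "open D" "D \<subseteq> Y" "Y \<subseteq> closure D"
      "\<And>x. x \<in> D \<Longrightarrow> \<exists>l \<Delta>. open \<Delta> \<and> x \<in> \<Delta> \<and> (\<forall>\<mu>\<ge>l. \<forall>z\<in>\<Delta>. t \<mu> z = s \<mu> z)"
      using t(2) unfolding generically_equal_def by blast
    have "h \<in> generically_null Y"
      unfolding generically_null_def
    proof (intro CollectI conjI exI[of _ D] ballI D(1-3))
      show "h \<in> carrier (smooth_seq_ring Y)"
        unfolding carrier_smooth_seq_ring h_def using Y sm tm by (auto intro!: smooth_on_restrict smooth_on_diff)
      fix x assume x: "x \<in> D"
      obtain l \<Delta> where "open \<Delta>" "x \<in> \<Delta>" "\<forall>\<mu>\<ge>l. \<forall>z\<in>\<Delta>. t \<mu> z = s \<mu> z" using D(4)[OF x] by blast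
      then show "\<exists>l \<Delta>. open \<Delta> \<and> x \<in> \<Delta> \<and> (\<forall>\<mu>\<ge>l. \<forall>z\<in>\<Delta>. h \<mu> z = 0)"
        using D x by (intro exI[of _ l] exI[of _ "\<Delta> \<inter> D"]) (auto simp: h_def)
    qed
    moreover have "t = (\<lambda>\<nu>. \<lambda>x\<in>Y. h \<nu> x + s \<nu> x)"
      using tm(2) by (auto simp: h_def fun_eq_iff extensional_def)
    ultimately show "t \<in> seq_class \<I> Y s" unfolding sc by blast
  qed
qed

lemma seq_class_cong:
  assumes "open Y" "\<I> Y = generically_null Y" "s \<in> carrier (smooth_seq_ring Y)" "t \<in> carrier (smooth_seq_ring Y)"
    and st: "generically_equal Y s t"
  shows "seq_class \<I> Y s = seq_class \<I> Y t"
  unfolding seq_class_eq[where \<I> = \<I>, OF assms(1-3)] seq_class_eq[where \<I> = \<I>, OF assms(1,2,4)]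
  using st generically_equal_trans generically_equal_sym by blast

text \<open>Locality does the work: where two representatives agree on an open set from some index
  on, so do their images. All representatives thus give one coset, and the union in
  \<open>lift_class\<close> collapses. The lemma covers the operator, with \<open>Y = X\<close>, and
  restriction to a smaller \<open>Y\<close>.\<close>

lemma lift_class_seq_class:
  assumes X: "open X" "\<I> X = generically_null X" and Y: "open Y" "\<I> Y = generically_null Y" "Y \<subseteq> X"
    and s: "s \<in> carrier (smooth_seq_ring X)"
    and F: "\<And>f. f \<in> smooth_functions X \<Longrightarrow> F f \<in> smooth_functions Y"
    and loc: "\<And>f g \<Delta> z. open \<Delta> \<Longrightarrow> \<Delta> \<subseteq> Y \<Longrightarrow> (\<And>z. z \<in> \<Delta> \<Longrightarrow> f z = g z) \<Longrightarrow> z \<in> \<Delta> \<Longrightarrow> F f z = F g z"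
  shows "lift_class \<I> Y F (seq_class \<I> X s) = seq_class \<I> Y (\<lambda>\<nu>. F (s \<nu>))"
proof -
  have car: "(\<lambda>\<nu>. F (t \<nu>)) \<in> carrier (smooth_seq_ring Y)" if "t \<in> carrier (smooth_seq_ring X)" for t
    using that unfolding carrier_smooth_seq_ring by (intro allI F) blast
  have eq: "seq_class \<I> Y (\<lambda>\<nu>. F (t \<nu>)) = seq_class \<I> Y (\<lambda>\<nu>. F (s \<nu>))"
    if t: "t \<in> carrier (smooth_seq_ring X)" "generically_equal X t s" for t
  proof (rule seq_class_cong[where \<I> = \<I>, OF Y(1,2) car[OF t(1)] car[OF s]])
    obtain D where D: "open D" "D \<subseteq> X" "X \<subseteq> closure D"
      "\<And>x. x \<in> D \<Longrightarrow> \<exists>l \<Delta>. open \<Delta> \<and> x \<in> \<Delta> \<and> (\<forall>\<mu>\<ge>l. \<forall>z\<in>\<Delta>. t \<mu> z = s \<mu> z)"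
      using t(2) unfolding generically_equal_def by blast
    show "generically_equal Y (\<lambda>\<nu>. F (t \<nu>)) (\<lambda>\<nu>. F (s \<nu>))"
      unfolding generically_equal_def
    proof (intro exI[of _ "Y \<inter> D"] conjI ballI)
      have "Y \<inter> closure D \<subseteq> closure (Y \<inter> D)" by (rule open_Int_closure_subset[OF Y(1)])
      then show "Y \<subseteq> closure (Y \<inter> D)" using Y(3) D(3) by blast
      fix x assume x: "x \<in> Y \<inter> D"
      then obtain l \<Delta> where \<Delta>: "open \<Delta>" "x \<in> \<Delta>" "\<forall>\<mu>\<ge>l. \<forall>z\<in>\<Delta>. t \<mu> z = s \<mu> z" using D(4) by blast
      have "F (t \<mu>) z = F (s \<mu>) z" if "\<mu> \<ge> l" "z \<in> \<Delta> \<inter> Y" for \<mu> z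
        by (rule loc[of "\<Delta> \<inter> Y"]) (use \<Delta> Y that in auto)
      then show "\<exists>l \<Delta>. open \<Delta> \<and> x \<in> \<Delta> \<and> (\<forall>\<mu>\<ge>l. \<forall>z\<in>\<Delta>. F (t \<mu>) z = F (s \<mu>) z)"
        using \<Delta> Y x by (intro exI[of _ l] exI[of _ "\<Delta> \<inter> Y"]) auto
    qed (use Y D in auto)
  qed
  have "generically_equal X s s" unfolding generically_equal_def
    by (intro exI[of _ X]) (use X closure_subset in auto)
  then have "s \<in> seq_class \<I> X s" unfolding seq_class_eq[where \<I> = \<I>, OF X s] using s by simp
  moreover have "seq_class \<I> Y (\<lambda>\<nu>. F (t \<nu>)) = seq_class \<I> Y (\<lambda>\<nu>. F (s \<nu>))" if "t \<in> seq_class \<I> X s" for t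
    using that eq unfolding seq_class_eq[where \<I> = \<I>, OF X s] by blast
  ultimately show ?thesis unfolding lift_class_def by blast
qed

lemma T_op_local:
  assumes "open \<Delta>" "\<Delta> \<subseteq> X" "\<And>z. z \<in> \<Delta> \<Longrightarrow> f z = g z" "z \<in> \<Delta>"
  shows "T_op X k m G f z = T_op X k m G g z"
proof -
  have "multi_deriv \<alpha> f z = multi_deriv \<alpha> g z" for \<alpha> by (rule multi_deriv_cong[OF assms(1,4,3)])
  moreover have "(partial_deriv k ^^ m) f z = (partial_deriv k ^^ m) g z"
    unfolding funpow_partial_deriv by (rule foldr_partial_deriv_cong[OF assms(1,4,3)])
  ultimately show ?thesis using assms by (auto simp: T_op_def)
qed

text \<open>The doubled closed balls still lie in \<open>D\<close>, which leaves room for cutoffs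
  equal to 1 on the ball and vanishing outside the doubled one. Lindelof's theorem makes the family
  countable.\<close>

lemma countable_ball_cover:
  fixes D :: "'a::euclidean_space set"
  assumes "open D" "D \<noteq> {}"
  obtains r and c :: "nat \<Rightarrow> 'a" where "\<forall>n. r n > 0 \<and> cball (c n) (2 * r n) \<subseteq> D" "D = (\<Union>n. ball (c n) (r n))"
proof -
  define P where "P = {p :: 'a \<times> real. snd p > 0 \<and> cball (fst p) (2 * snd p) \<subseteq> D}"
  have PD: "D = (\<Union>p\<in>P. ball (fst p) (snd p))"
  proof
    show "D \<subseteq> (\<Union>p\<in>P. ball (fst p) (snd p))"
    proof
      fix x assume "x \<in> D"
      then obtain e where "e > 0" "cball x e \<subseteq> D" using assms(1) open_contains_cball by blast
      then have "(x, e / 2) \<in> P" "x \<in> ball x (e / 2)" by (auto simp: P_def)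
      then show "x \<in> (\<Union>p\<in>P. ball (fst p) (snd p))" by force
    qed
    show "(\<Union>p\<in>P. ball (fst p) (snd p)) \<subseteq> D"
    proof
      fix x assume "x \<in> (\<Union>p\<in>P. ball (fst p) (snd p))"
      then obtain p where p: "p \<in> P" "x \<in> ball (fst p) (snd p)" by blast
      then have "x \<in> cball (fst p) (2 * snd p)" by (auto simp: P_def)
      then show "x \<in> D" using p by (auto simp: P_def)
    qed
  qed
  obtain \<F> where \<F>: "\<F> \<subseteq> (\<lambda>p. ball (fst p) (snd p)) ` P" "countable \<F>" "\<Union>\<F> = \<Union>((\<lambda>p. ball (fst p) (snd p)) ` P)"
    by (rule Lindelof[of "(\<lambda>p. ball (fst p) (snd p)) ` P"]) auto
  obtain Q where Q: "countable Q" "Q \<subseteq> P" "\<F> = (\<lambda>p. ball (fst p) (snd p)) ` Q"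
    using \<F>(1,2) countable_subset_image[of \<F> "\<lambda>p. ball (fst p) (snd p)" P] by blast
  have QD: "D = (\<Union>p\<in>Q. ball (fst p) (snd p))" using PD \<F>(3) Q(3) by blast
  then have "Q \<noteq> {}" using assms(2) by blast
  define q where "q = from_nat_into Q"
  have rq: "range q = Q" unfolding q_def by (rule range_from_nat_into[OF \<open>Q \<noteq> {}\<close> Q(1)])
  then have qP: "q n \<in> P" for n using Q(2) by blast
  show ?thesis
  proof (rule that[of "\<lambda>n. snd (q n)" "\<lambda>n. fst (q n)"])
    show "\<forall>n. snd (q n) > 0 \<and> cball (fst (q n)) (2 * snd (q n)) \<subseteq> D" using qP by (auto simp: P_def)
    show "D = (\<Union>n. ball (fst (q n)) (snd (q n)))" unfolding QD rq[symmetric] by blast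
  qed
qed

theorem generalized_solution_of_classical:
  fixes X :: "(real ^ 'n::finite) set"
  assumes X: "open X" "X \<noteq> {}" and G: "analytic_in_all_variables X (jet_indices k m) G"
    and \<Sigma>: "open (X - \<Sigma>)" "X \<subseteq> closure (X - \<Sigma>)" "\<Sigma> \<inter> initial_surface X k t0 = {}"
    and \<psi>: "smooth_on (X - \<Sigma>) \<psi>"
    and pde: "\<And>x. x \<in> X - \<Sigma> \<Longrightarrow> (partial_deriv k ^^ m) \<psi> x = G x (\<lambda>\<alpha>\<in>jet_indices k m. multi_deriv \<alpha> \<psi> x)"
    and init: "\<And>p x. p < m \<Longrightarrow> x \<in> initial_surface X k t0 \<Longrightarrow> (partial_deriv k ^^ p) \<psi> x = g p x"
    and I: "\<And>Y. open Y \<Longrightarrow> \<I> Y = generically_null Y"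
  shows "\<exists>U \<in> carrier (smooth_seq_ring X Quot \<I> X). is_generalized_solution \<I> X k m G t0 g \<Sigma> \<psi> U"
proof -
  let ?D = "X - \<Sigma>"
  have ne: "?D \<noteq> {}"
  proof
    assume "?D = {}"
    then have "X \<subseteq> closure {}" using \<Sigma>(2) by (simp only:)
    then show False using X(2) by simp
  qed
  obtain r and c :: "nat \<Rightarrow> real ^ 'n" where
    cr': "\<forall>n. r n > 0 \<and> cball (c n) (2 * r n) \<subseteq> ?D" and D: "?D = (\<Union>n. ball (c n) (r n))"
    by (rule countable_ball_cover[OF \<Sigma>(1) ne])
  from cr' D have cr: "\<And>n. r n > 0" "\<And>n. cball (c n) (2 * r n) \<subseteq> ?D" "?D = (\<Union>n. ball (c n) (r n))"
    by blast+
  \<comment> \<open>One minus a product: equal to 1 as soon as one of the bumps is 1, and 0 where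
    all of them vanish.\<close>
  define cut where "cut \<nu> x = 1 - (\<Prod>n\<le>\<nu>. 1 - bump (c n) (r n) x)" for \<nu> x
  have cut_smooth: "smooth_on UNIV (cut \<nu>)" for \<nu>
    unfolding cut_def by (intro smooth_on_diff smooth_on_const smooth_on_prod bump_smooth cr(1) open_UNIV)
  have cut1: "cut \<nu> x = 1" if "n \<le> \<nu>" "x \<in> ball (c n) (r n)" for n \<nu> x
  proof -
    have "bump (c n) (r n) x = 1" by (rule bump_eq_1) (use that cr(1) in \<open>auto simp: dist_commute less_imp_le\<close>)
    then have "(\<Prod>n\<le>\<nu>. 1 - bump (c n) (r n) x) = 0" using that(1) by (intro prod_zero) auto
    then show ?thesis by (simp add: cut_def)
  qed
  \<comment> \<open>A finite union of closed balls is closed and lies in \<open>?D\<close>; on its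
    complement in \<open>X\<close> the function \<open>s \<nu>\<close> vanishes, which makes the
    continuation by 0 smooth across \<Sigma>.\<close>
  define K where "K \<nu> = (\<Union>n\<le>\<nu>. cball (c n) (2 * r n))" for \<nu>
  have cut0: "cut \<nu> x = 0" if "x \<notin> K \<nu>" for \<nu> x
  proof -
    have "bump (c n) (r n) x = 0" if "n \<le> \<nu>" for n
      by (rule bump_eq_0) (use that cr(1) \<open>x \<notin> K \<nu>\<close> in \<open>auto simp: K_def dist_commute not_le less_imp_le\<close>)
    then show ?thesis by (simp add: cut_def)
  qed
  have K: "closed (K \<nu>)" "K \<nu> \<subseteq> ?D" for \<nu> using cr(2) by (auto simp: K_def)
  define s where "s \<nu> = (\<lambda>x\<in>X. if x \<in> ?D then cut \<nu> x * \<psi> x else 0)" for \<nu>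
  have s_smooth: "s \<nu> \<in> smooth_functions X" for \<nu>
    unfolding smooth_functions_iff
  proof
    show "s \<nu> \<in> extensional X" by (simp add: s_def)
    show "smooth_on X (s \<nu>)"
    proof (rule smooth_on_local)
      fix x assume x: "x \<in> X"
      show "\<exists>V. open V \<and> x \<in> V \<and> smooth_on V (s \<nu>)"
      proof (cases "x \<in> ?D")
        case True
        have "smooth_on ?D (\<lambda>x. cut \<nu> x * \<psi> x)"
          by (intro smooth_on_mult \<Sigma>(1) \<psi> smooth_on_subset[OF cut_smooth]) auto
        then have "smooth_on ?D (s \<nu>)" by (rule smooth_on_cong[OF \<Sigma>(1), rotated]) (simp add: s_def)
        with True \<Sigma>(1) show ?thesis by blast
      next
        case False
        let ?V = "X \<inter> - K \<nu>"
        have V: "open ?V" using X K by (intro open_Int open_Compl)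
        have "smooth_on ?V (s \<nu>)"
          by (rule smooth_on_cong[OF V _ smooth_on_const[OF V, of 0]]) (auto simp: s_def cut0)
        moreover have "x \<in> ?V" using False x K(2) by auto
        ultimately show ?thesis using V by blast
      qed
    qed
  qed
  have s_car: "s \<in> carrier (smooth_seq_ring X)" by (simp add: carrier_smooth_seq_ring s_smooth)
  have s\<psi>: "s \<mu> z = \<psi> z" if "\<mu> \<ge> n" "z \<in> ball (c n) (r n)" for \<mu> n z
  proof -
    have "z \<in> ?D" using that cr(3) by blast
    then show ?thesis using cut1[OF that] by (simp add: s_def)
  qed
  define U where "U = seq_class \<I> X s"
  have "U \<in> carrier (smooth_seq_ring X Quot \<I> X)"
    using s_car by (auto simp: U_def seq_class_def FactRing_def A_RCOSETS_def')
  moreover have "is_generalized_solution \<I> X k m G t0 g \<Sigma> \<psi> U"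
    unfolding is_generalized_solution_def
  proof (intro conjI)
    let ?F = "T_op X k m G"
    have "lift_class \<I> X ?F U = seq_class \<I> X (\<lambda>\<nu>. ?F (s \<nu>))"
      unfolding U_def
      by (rule lift_class_seq_class[where \<I> = \<I>, OF X(1) I[OF X(1)] X(1) I[OF X(1)] order_refl s_car T_op_smooth[OF X(1) G] T_op_local])
    also have "\<dots> = {t \<in> carrier (smooth_seq_ring X). generically_equal X t (\<lambda>\<nu>. ?F (s \<nu>))}"
      by (rule seq_class_eq[where \<I> = \<I>, OF X(1) I[OF X(1)]]) (simp add: carrier_smooth_seq_ring T_op_smooth[OF X(1) G] s_smooth)
    \<comment> \<open>On the ball with number \<open>n\<close> all \<open>s \<mu>\<close> with
      \<open>\<mu> \<ge> n\<close> equal \<open>\<psi>\<close>, so locality and the classical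
      equation give 0. The zero sequence is compared on open subsets of \<open>X\<close> only, so it
      may be written without restriction to \<open>X\<close>.\<close>
    also have "\<dots> = {t \<in> carrier (smooth_seq_ring X). generically_equal X t (\<lambda>_ _. 0)}"
    proof -
      have "generically_equal X (\<lambda>\<nu>. ?F (s \<nu>)) (\<lambda>_ _. 0)"
        unfolding generically_equal_def
      proof (intro exI[of _ ?D] conjI ballI \<Sigma>(1,2))
        fix x assume "x \<in> ?D"
        then obtain n where n: "x \<in> ball (c n) (r n)" using cr(3) by blast
        have nD: "ball (c n) (r n) \<subseteq> ?D" using cr(3) by blast
        have "?F (s \<mu>) z = 0" if "\<mu> \<ge> n" "z \<in> ball (c n) (r n)" for \<mu> z
        proof -
          have "?F (s \<mu>) z = ?F \<psi> z"
            by (rule T_op_local[of "ball (c n) (r n)"]) (use nD that s\<psi> in auto)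
          also have "\<dots> = 0" using pde[of z] nD that by (auto simp: T_op_def)
          finally show ?thesis .
        qed
        then show "\<exists>l \<Delta>. open \<Delta> \<and> x \<in> \<Delta> \<and> (\<forall>\<mu>\<ge>l. \<forall>z\<in>\<Delta>. ?F (s \<mu>) z = 0)"
          using n by (intro exI[of _ n] exI[of _ "ball (c n) (r n)"]) auto
      qed auto
      then show ?thesis using generically_equal_trans generically_equal_sym by blast
    qed
    also have "\<dots> = generically_null X"
      by (simp add: generically_null_def generically_equal_def)
    also have "\<dots> = \<zero>\<^bsub>smooth_seq_ring X Quot \<I> X\<^esub>"
      using I[OF X(1)] by (simp add: FactRing_def)
    finally show "lift_class \<I> X ?F U = \<zero>\<^bsub>smooth_seq_ring X Quot \<I> X\<^esub>" .
    have rs: "restrict f ?D \<in> smooth_functions ?D" if "f \<in> smooth_functions X" for f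
      by (rule smooth_on_restrict[OF \<Sigma>(1) smooth_on_subset[of X f]]) (use that in \<open>auto simp: smooth_functions_iff\<close>)
    have "restrict_class \<I> ?D U = seq_class \<I> ?D (\<lambda>\<nu>. restrict (s \<nu>) ?D)"
      unfolding U_def restrict_class_def
      by (rule lift_class_seq_class[where \<I> = \<I>, OF X(1) I[OF X(1)] \<Sigma>(1) I[OF \<Sigma>(1)] _ s_car rs]) auto
    also have "\<dots> = const_class \<I> ?D \<psi>"
      unfolding const_class_def
    proof (rule seq_class_cong[where \<I> = \<I>, OF \<Sigma>(1) I[OF \<Sigma>(1)]])
      show "(\<lambda>\<nu>. restrict (s \<nu>) ?D) \<in> carrier (smooth_seq_ring ?D)"
        by (simp add: carrier_smooth_seq_ring rs[OF s_smooth])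
      show "(\<lambda>\<nu>. restrict \<psi> ?D) \<in> carrier (smooth_seq_ring ?D)"
        by (simp add: carrier_smooth_seq_ring smooth_on_restrict[OF \<Sigma>(1) \<psi>])
      show "generically_equal ?D (\<lambda>\<nu>. restrict (s \<nu>) ?D) (\<lambda>\<nu>. restrict \<psi> ?D)"
        unfolding generically_equal_def
      proof (intro exI[of _ ?D] conjI ballI \<Sigma>(1))
        fix x assume "x \<in> ?D"
        then obtain n where n: "x \<in> ball (c n) (r n)" using cr(3) by blast
        then show "\<exists>l \<Delta>. open \<Delta> \<and> x \<in> \<Delta> \<and> (\<forall>\<mu>\<ge>l. \<forall>z\<in>\<Delta>. restrict (s \<mu>) ?D z = restrict \<psi> ?D z)"
          using s\<psi> by (intro exI[of _ n] exI[of _ "ball (c n) (r n)"]) (auto simp: restrict_def)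
      qed (auto intro: closure_subset[THEN subsetD])
    qed
    finally show "restrict_class \<I> ?D U = const_class \<I> ?D \<psi>" .
  qed (use \<Sigma>(3) init in auto)
  ultimately show ?thesis by blast
qed

section \<open>Classical solutions off a closed null set\<close>

definition solves_on :: "(real ^ 'n::finite) set \<Rightarrow> 'n \<Rightarrow> nat \<Rightarrow> (real ^ 'n \<Rightarrow> (('n \<Rightarrow> nat) \<Rightarrow> complex) \<Rightarrow> complex) \<Rightarrow> (real ^ 'n \<Rightarrow> complex) \<Rightarrow> bool" where
  "solves_on V k m G u \<longleftrightarrow> (\<forall>x\<in>V. (partial_deriv k ^^ m) u x = G x (\<lambda>\<alpha>\<in>jet_indices k m. multi_deriv \<alpha> u x))"

lemma solves_on_cong:
  assumes "open V" "\<And>x. x \<in> V \<Longrightarrow> u x = v x" "solves_on V k m G u"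
  shows "solves_on V k m G v"
  unfolding solves_on_def
proof
  fix x assume x: "x \<in> V"
  have "multi_deriv \<alpha> u x = multi_deriv \<alpha> v x" for \<alpha> by (rule multi_deriv_cong[OF assms(1) x assms(2)])
  moreover have "(partial_deriv k ^^ m) u x = (partial_deriv k ^^ m) v x"
    unfolding funpow_partial_deriv by (rule foldr_partial_deriv_cong[OF assms(1) x assms(2)])
  ultimately show "(partial_deriv k ^^ m) v x = G x (\<lambda>\<alpha>\<in>jet_indices k m. multi_deriv \<alpha> v x)"
    using assms(3) x by (simp add: solves_on_def)
qed

lemma solves_on_subset: "solves_on V k m G u \<Longrightarrow> W \<subseteq> V \<Longrightarrow> solves_on W k m G u"
  unfolding solves_on_def by blast

lemma solves_on_rps:
  assumes "ps_conv_in UNIV c \<rho>" "V \<subseteq> obox a \<rho>"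
  shows "solves_on V k m G (rps a c) \<longleftrightarrow>
    (\<forall>x\<in>V. rps a (ps_derivs (pure_index k m) c) x = G x (\<lambda>\<alpha>\<in>jet_indices k m. rps a (ps_derivs \<alpha> c) x))"
  unfolding solves_on_def
proof (rule ball_cong[OF refl])
  fix x assume "x \<in> V"
  then have x: "x \<in> obox a \<rho>" using assms(2) by blast
  show "((partial_deriv k ^^ m) (rps a c) x = G x (\<lambda>\<alpha>\<in>jet_indices k m. multi_deriv \<alpha> (rps a c) x)) =
     (rps a (ps_derivs (pure_index k m) c) x = G x (\<lambda>\<alpha>\<in>jet_indices k m. rps a (ps_derivs \<alpha> c) x))"
    by (simp only: funpow_partial_deriv_rps[OF assms(1) x] multi_deriv_rps[OF assms(1) x])
qed

lemma center_in_obox: "(\<And>i. 0 < \<rho> i) \<Longrightarrow> a \<in> obox a \<rho>"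
  by (simp add: obox_def)

lemma obox_mono: "(\<And>i. \<rho>' i \<le> \<rho> i) \<Longrightarrow> obox a \<rho>' \<subseteq> obox a \<rho>"
  unfolding obox_def by (auto intro: less_le_trans)

text \<open>Discarding all terms that contain the variable \<open>k\<close> amounts to projecting
  the argument to the hyperplane through the centre.\<close>

lemma rps_initial_part:
  "rps s (\<lambda>\<gamma>. if \<gamma> k = 0 then f \<gamma> else 0) y = rps s f (\<chi> i. if i = k then s $ k else y $ i)"
  unfolding rps_def ps_def
proof (rule infsum_cong)
  fix \<gamma> :: "'a \<Rightarrow> nat"
  let ?z = "\<lambda>i. complex_of_real (y $ i - s $ i)"
  let ?z' = "\<lambda>i. complex_of_real ((\<chi> i. if i = k then s $ k else y $ i) $ i - s $ i)"
  have "mpow UNIV ?z' \<gamma> = 0" if "\<gamma> k \<noteq> 0"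
    unfolding mpow_def by (rule prod_zero) (use that in auto)
  moreover have "mpow UNIV ?z' \<gamma> = mpow UNIV ?z \<gamma>" if "\<gamma> k = 0"
    unfolding mpow_def by (rule prod.cong) (use that in auto)
  ultimately show "(if \<gamma> k = 0 then f \<gamma> else 0) * mpow UNIV ?z \<gamma> = f \<gamma> * mpow UNIV ?z' \<gamma>" by auto
qed

lemma ps_conv_in_dominated:
  assumes "ps_conv_in I c \<rho>" "\<And>\<beta>. norm (d \<beta>) \<le> norm (c \<beta>)"
  shows "ps_conv_in I d \<rho>"
  unfolding ps_conv_in_def
proof (intro allI impI)
  fix \<rho>' assume r: "\<forall>i\<in>I. 0 \<le> \<rho>' i \<and> \<rho>' i < \<rho> i"
  then have "ps_conv I c \<rho>'" by (intro ps_conv_inD[OF assms(1)]) auto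
  then show "ps_conv I d \<rho>'" unfolding ps_conv_def
    by (rule summable_on_le) (use assms(2) r in \<open>auto intro!: mult_right_mono mult_nonneg_nonneg mpow_nonneg\<close>)
qed

lemma ps_derivs_pure_initial:
  fixes c :: "('n::finite \<Rightarrow> nat) \<Rightarrow> complex"
  assumes "\<gamma> k = 0"
  shows "ps_derivs (pure_index k p) c \<gamma> = fact p * c (\<gamma>(k := p))"
proof -
  have "(\<lambda>i. \<gamma> i + pure_index k p i) = \<gamma>(k := p)" using assms by auto
  moreover have "(\<Prod>i\<in>UNIV. fact (\<gamma> i + pure_index k p i) / fact (\<gamma> i)) = (\<Prod>i\<in>UNIV. if i = k then fact p else (1::complex))"
    using assms by (intro prod.cong) auto
  ultimately show ?thesis by (simp add: ps_derivs_def)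
qed

text \<open>On the hyperplane the derivative of order \<open>p\<close> shows only the slice
  \<open>\<alpha> k = p\<close>, multiplied by p!. Made constant in direction \<open>k\<close>, the
  two restrictions agree on a full box, where the identity theorem applies.\<close>

lemma initial_coefficients_unique:
  fixes c d :: "('n::finite \<Rightarrow> nat) \<Rightarrow> complex"
  assumes c: "ps_conv_in UNIV c (\<lambda>_. R)" and d: "ps_conv_in UNIV d (\<lambda>_. R)" and R: "R > 0"
    and eq: "\<And>y. y \<in> obox s (\<lambda>_. R) \<Longrightarrow> y $ k = s $ k \<Longrightarrow> (partial_deriv k ^^ p) (rps s c) y = (partial_deriv k ^^ p) (rps s d) y"
    and \<alpha>: "\<alpha> k = p"
  shows "c \<alpha> = d \<alpha>"
proof -
  define e where "e c \<gamma> = (if \<gamma> k = 0 then ps_derivs (pure_index k p) c \<gamma> else 0)" for c and \<gamma> :: "'n \<Rightarrow> nat"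
  have conv: "ps_conv_in UNIV (e c') (\<lambda>_. R)" if "ps_conv_in UNIV c' (\<lambda>_. R)" for c'
    by (rule ps_conv_in_dominated[OF ps_conv_in_derivs[OF that, of "pure_index k p"]]) (simp add: e_def)
  have "e c = e d"
  proof (rule rps_identity[OF conv[OF c] conv[OF d] open_obox[of s "\<lambda>_. R"] center_in_obox])
    fix x assume x: "x \<in> obox s (\<lambda>_. R)"
    let ?y = "\<chi> i. if i = k then s $ k else x $ i"
    have y: "?y \<in> obox s (\<lambda>_. R)" "?y $ k = s $ k" using x R by (auto simp: obox_def)
    have "rps s (e c) x = rps s (ps_derivs (pure_index k p) c) ?y" unfolding e_def by (rule rps_initial_part)
    also have "\<dots> = (partial_deriv k ^^ p) (rps s c) ?y" by (rule funpow_partial_deriv_rps[OF c y(1), symmetric])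
    also have "\<dots> = (partial_deriv k ^^ p) (rps s d) ?y" by (rule eq[OF y])
    also have "\<dots> = rps s (ps_derivs (pure_index k p) d) ?y" by (rule funpow_partial_deriv_rps[OF d y(1)])
    also have "\<dots> = rps s (e d) x" unfolding e_def by (rule rps_initial_part[symmetric])
    finally show "rps s (e c) x = rps s (e d) x" .
  qed (use R in auto)
  then have "e c (\<alpha>(k := 0)) = e d (\<alpha>(k := 0))" by simp
  moreover have "\<alpha>(k := p) = \<alpha>" using \<alpha> by auto
  ultimately show ?thesis by (simp add: e_def ps_derivs_pure_initial)
qed

section \<open>Patches along the initial surface\<close>

locale cauchy_problem =
  fixes X :: "(real ^ 'n::finite) set" and k :: 'n and m :: nat
    and G :: "real ^ 'n \<Rightarrow> (('n \<Rightarrow> nat) \<Rightarrow> complex) \<Rightarrow> complex"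
    and t0 :: real and g :: "nat \<Rightarrow> real ^ 'n \<Rightarrow> complex"
  assumes X: "open X" and m: "0 < m"
    and G: "analytic_in_all_variables X (jet_indices k m) G"
    and g: "\<And>p. p < m \<Longrightarrow> g p real_analytic_on initial_surface X k t0"
begin

lemma local_solution:
  assumes a: "a \<in> X" and P: "ps_conv UNIV P (\<lambda>_. R)" "R > 0" and P0: "\<And>\<alpha>. m \<le> \<alpha> k \<Longrightarrow> P \<alpha> = 0"
  obtains \<rho> c where "\<rho> > 0" "ps_conv UNIV c (\<lambda>_. \<rho>)" "obox a (\<lambda>_. \<rho>) \<subseteq> X"
    "solves_on (obox a (\<lambda>_. \<rho>)) k m G (rps a c)" "\<And>\<alpha>. \<alpha> k < m \<Longrightarrow> c \<alpha> = P \<alpha>"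
proof -
  obtain \<rho> c where *: "\<rho> > 0" "ps_conv UNIV c (\<lambda>_. \<rho>)" "obox a (\<lambda>_. \<rho>) \<subseteq> X"
     "\<forall>x\<in>obox a (\<lambda>_. \<rho>). rps a (ps_derivs (pure_index k m) c) x = G x (\<lambda>\<alpha>\<in>jet_indices k m. rps a (ps_derivs \<alpha> c) x)"
     "\<forall>\<alpha>. \<alpha> k < m \<longrightarrow> c \<alpha> = P \<alpha>"
    using local_existence[where P = P, OF X m G a P P0] by metis
  have "solves_on (obox a (\<lambda>_. \<rho>)) k m G (rps a c)"
    using *(4) by (simp add: solves_on_rps[OF ps_conv_imp_in[OF *(2)]])
  then show ?thesis using that[of \<rho> c] * by blast
qed

text \<open>Zero data on the hyperplane through \<open>a\<close> are as good as any: away from the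
  initial surface the local solution is not prescribed.\<close>

lemma local_solution_ball:
  assumes a: "a \<in> X"
  shows "\<exists>r>0. \<exists>u. u real_analytic_on ball a r \<and> solves_on (ball a r) k m G u"
proof -
  have P: "ps_conv UNIV (\<lambda>_. 0) (\<lambda>_ :: 'n. 1)" by (simp add: ps_conv_def)
  obtain \<rho> c where *: "\<rho> > 0" "ps_conv UNIV c (\<lambda>_. \<rho>)" "obox a (\<lambda>_. \<rho>) \<subseteq> X"
    "solves_on (obox a (\<lambda>_. \<rho>)) k m G (rps a c)"
    by (rule local_solution[OF a P]) auto
  have sub: "ball a \<rho> \<subseteq> obox a (\<lambda>_. \<rho>)"
  proof
    fix x assume "x \<in> ball a \<rho>"
    then have "\<bar>x $ i - a $ i\<bar> < \<rho>" for i
      using component_le_norm_cart[of "x - a" i] by (simp add: dist_norm norm_minus_commute)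
    then show "x \<in> obox a (\<lambda>_. \<rho>)" by (simp add: obox_def)
  qed
  show ?thesis
    using * rps_real_analytic[OF ps_conv_imp_in[OF *(2)] sub] solves_on_subset[OF *(4) sub] by blast
qed

definition cauchy_patch :: "real ^ 'n \<Rightarrow> real \<Rightarrow> (('n \<Rightarrow> nat) \<Rightarrow> complex) \<Rightarrow> bool" where
  "cauchy_patch a \<rho> c \<longleftrightarrow> \<rho> > 0 \<and> ps_conv UNIV c (\<lambda>_. \<rho>) \<and> obox a (\<lambda>_. \<rho>) \<subseteq> X \<and>
     solves_on (obox a (\<lambda>_. \<rho>)) k m G (rps a c) \<and>
     (\<forall>x\<in>obox a (\<lambda>_. \<rho>). x $ k = t0 \<longrightarrow> (\<forall>p<m. (partial_deriv k ^^ p) (rps a c) x = g p x))"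

text \<open>Monomials containing the variable \<open>k\<close> vanish on the surface, so analyticity
  there does not determine their coefficients; the series is restricted to
  \<open>\<beta> k = 0\<close>. One radius is taken for the finitely many \<open>p\<close>.\<close>

lemma initial_data_series:
  assumes a: "a \<in> initial_surface X k t0"
  obtains R h where "R > 0" "\<forall>p<m. (\<lambda>\<beta>. norm (h p \<beta>) * R ^ (\<Sum>i\<in>UNIV. \<beta> i)) summable_on {\<beta>. \<beta> k = 0}"
    "\<forall>p<m. \<forall>x. (\<forall>i. \<bar>x $ i - a $ i\<bar> \<le> R) \<and> x $ k = t0 \<longrightarrow>
       ((\<lambda>\<beta>. h p \<beta> * mpow UNIV (\<lambda>i. of_real (x $ i - a $ i)) \<beta>) has_sum g p x) {\<beta>. \<beta> k = 0}"
proof -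
  let ?S = "initial_surface X k t0"
  have aX: "a \<in> X" "a $ k = t0" using a by (auto simp: initial_surface_def)
  let ?Q = "\<lambda>p r h. r > 0 \<and> (\<forall>x\<in>?S. dist x a < r \<longrightarrow>
        ((\<lambda>\<beta>. h \<beta> * (\<Prod>i\<in>UNIV. of_real (x $ i - a $ i) ^ \<beta> i)) has_sum g p x) UNIV)"
  have "\<forall>p\<in>{..<m}. \<exists>r. \<exists>h. ?Q p r h"
    using g a unfolding real_analytic_on_def by blast
  then obtain r where "\<forall>p\<in>{..<m}. \<exists>h. ?Q p (r p) h" by (rule bchoice[THEN exE])
  then obtain h where Q: "\<forall>p\<in>{..<m}. ?Q p (r p) (h p)" by (rule bchoice[THEN exE])
  obtain r0 where r0: "r0 > 0" "\<forall>p\<in>{..<m}. r0 \<le> r p"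
    using finite_lower_bound[of "{..<m}" r] Q by blast
  obtain e where e: "e > 0" "ball a e \<subseteq> X" using X aX openE by blast
  define R where "R = min r0 e / (2 * real CARD('n))"
  have R: "R > 0" "real CARD('n) * R < min r0 e" using r0 e by (auto simp: R_def field_simps min_def)
  have hs: "((\<lambda>\<beta>. h p \<beta> * mpow UNIV (\<lambda>i. of_real (x $ i - a $ i)) \<beta>) has_sum g p x) {\<beta>. \<beta> k = 0}"
    if p: "p < m" and x: "\<And>i. \<bar>x $ i - a $ i\<bar> \<le> R" "x $ k = t0" for p x
  proof -
    have d: "dist x a < min r0 e" using dist_le_of_components[OF x(1)] R(2) by linarith
    then have "x \<in> ball a e" by (simp add: dist_commute)
    then have "x \<in> ?S" using e x(2) by (auto simp: initial_surface_def)
    moreover have "r0 \<le> r p" using r0(2) p by auto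
    ultimately have "((\<lambda>\<beta>. h p \<beta> * mpow UNIV (\<lambda>i. of_real (x $ i - a $ i)) \<beta>) has_sum g p x) UNIV"
      using Q p d by (auto simp: mpow_def)
    moreover have "mpow UNIV (\<lambda>i. complex_of_real (x $ i - a $ i)) \<beta> = 0" if "\<beta> k \<noteq> 0" for \<beta>
      unfolding mpow_def by (rule prod_zero[OF finite bexI[of _ k]]) (use that x(2) aX(2) in auto)
    ultimately show ?thesis
      by (subst has_sum_cong_neutral[where T = UNIV and g = "\<lambda>\<beta>. h p \<beta> * mpow UNIV (\<lambda>i. complex_of_real (x $ i - a $ i)) \<beta>"]) auto
  qed
  have "(\<lambda>\<beta>. norm (h p \<beta>) * R ^ (\<Sum>i\<in>UNIV. \<beta> i)) summable_on {\<beta>. \<beta> k = 0}" if "p < m" for p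
  proof -
    \<comment> \<open>The corner of the box inside the hyperplane: coordinate \<open>k\<close> stays
      at \<open>t0\<close>, and only its power with exponent 0 occurs.\<close>
    let ?x = "(\<chi> i. if i = k then t0 else a $ i + R) :: real ^ 'n"
    let ?z = "\<lambda>i. complex_of_real (?x $ i - a $ i)"
    have "((\<lambda>\<beta>. h p \<beta> * mpow UNIV ?z \<beta>) has_sum g p ?x) {\<beta>. \<beta> k = 0}"
      by (rule hs[OF that]) (use R(1) aX in auto)
    then have "(\<lambda>\<beta>. norm (h p \<beta> * mpow UNIV ?z \<beta>)) summable_on {\<beta>. \<beta> k = 0}"
      by (intro summable_on_iff_abs_summable_on_complex[THEN iffD1]) (rule has_sum_imp_summable)
    moreover have "norm (h p \<beta> * mpow UNIV ?z \<beta>) = norm (h p \<beta>) * R ^ (\<Sum>i\<in>UNIV. \<beta> i)" if "\<beta> k = 0" for \<beta>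
    proof -
      have "mpow UNIV (\<lambda>i. norm (?z i)) \<beta> = mpow UNIV (\<lambda>_. R) \<beta>"
        unfolding mpow_def by (rule prod.cong) (use that R(1) in auto)
      then show ?thesis by (simp only: norm_mult norm_mpow mpow_const)
    qed
    ultimately show ?thesis
      using summable_on_cong[of "{\<beta>. \<beta> k = 0}" "\<lambda>\<beta>. norm (h p \<beta> * mpow UNIV ?z \<beta>)" "\<lambda>\<beta>. norm (h p \<beta>) * R ^ (\<Sum>i\<in>UNIV. \<beta> i)"]
      by simp
  qed
  then show ?thesis by (intro that[of R h]) (use R(1) hs in auto)
qed

lemma cauchy_patch_exists:
  assumes a: "a \<in> initial_surface X k t0"
  shows "\<exists>\<rho> c. cauchy_patch a \<rho> c"
proof -
  have aX: "a \<in> X" "a $ k = t0" using a by (auto simp: initial_surface_def)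
  obtain R h where R: "R > 0" and sm': "\<forall>p<m. (\<lambda>\<beta>. norm (h p \<beta>) * R ^ (\<Sum>i\<in>UNIV. \<beta> i)) summable_on {\<beta>. \<beta> k = 0}"
    and hs': "\<forall>p<m. \<forall>x. (\<forall>i. \<bar>x $ i - a $ i\<bar> \<le> R) \<and> x $ k = t0 \<longrightarrow>
       ((\<lambda>\<beta>. h p \<beta> * mpow UNIV (\<lambda>i. of_real (x $ i - a $ i)) \<beta>) has_sum g p x) {\<beta>. \<beta> k = 0}"
    by (rule initial_data_series[OF a])
  have sm: "(\<lambda>\<beta>. norm (h p \<beta>) * R ^ (\<Sum>i\<in>UNIV. \<beta> i)) summable_on {\<beta>. \<beta> k = 0}" if "p < m" for p
    using sm' that by simp
  have hs: "((\<lambda>\<beta>. h p \<beta> * mpow UNIV (\<lambda>i. of_real (x $ i - a $ i)) \<beta>) has_sum g p x) {\<beta>. \<beta> k = 0}"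
    if "p < m" "\<And>i. \<bar>x $ i - a $ i\<bar> \<le> R" "x $ k = t0" for p x
    using hs' that by simp
  \<comment> \<open>The slice of order \<open>p\<close> carries the series of \<open>g p\<close>
    divided by p!, which cancels the factor produced by
    \<open>ps_derivs_pure_initial\<close>.\<close>
  define P where "P \<alpha> = (if \<alpha> k < m then h (\<alpha> k) (\<alpha>(k := 0)) / fact (\<alpha> k) else 0)" for \<alpha>
  \<comment> \<open>Each slice is a copy of the indices with \<open>\<beta> k = 0\<close>, and only
    the finitely many slices below \<open>m\<close> are nonzero, so \<open>P\<close> converges at
    the same radius as the data.\<close>
  have part: "(\<lambda>\<alpha>. norm (P \<alpha>) * R ^ (\<Sum>i\<in>UNIV. \<alpha> i)) summable_on {\<alpha>. \<alpha> k = p}" if p: "p < m" for p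
  proof -
    have im: "{\<alpha>. \<alpha> k = p} = (\<lambda>\<beta>. \<beta>(k := p)) ` {\<beta> :: 'n \<Rightarrow> nat. \<beta> k = 0}"
    proof (intro equalityI subsetI)
      fix \<alpha> :: "'n \<Rightarrow> nat" assume "\<alpha> \<in> {\<alpha>. \<alpha> k = p}"
      then show "\<alpha> \<in> (\<lambda>\<beta>. \<beta>(k := p)) ` {\<beta>. \<beta> k = 0}" by (intro image_eqI[of _ _ "\<alpha>(k := 0)"]) auto
    qed auto
    have inj: "inj_on (\<lambda>\<beta>. \<beta>(k := p)) {\<beta> :: 'n \<Rightarrow> nat. \<beta> k = 0}"
      by (rule inj_on_inverseI[where g = "\<lambda>\<beta>. \<beta>(k := 0)"]) (auto simp: fun_upd_idem)
    have "(\<lambda>\<beta>. norm (h p \<beta>) * R ^ (\<Sum>i\<in>UNIV. \<beta> i) * (R ^ p / fact p)) summable_on {\<beta>. \<beta> k = 0}"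
      by (rule summable_on_cmult_left[OF sm[OF p]])
    moreover have "norm (P (\<beta>(k := p))) * R ^ (\<Sum>i\<in>UNIV. (\<beta>(k := p)) i) = norm (h p \<beta>) * R ^ (\<Sum>i\<in>UNIV. \<beta> i) * (R ^ p / fact p)"
      if "\<beta> k = 0" for \<beta>
    proof -
      have "(\<Sum>i\<in>UNIV. (\<beta>(k := p)) i) = p + (\<Sum>i\<in>UNIV - {k}. \<beta> i)"
        by (simp add: sum.remove[of UNIV k])
      moreover have "(\<Sum>i\<in>UNIV. \<beta> i) = (\<Sum>i\<in>UNIV - {k}. \<beta> i)" using that by (simp add: sum.remove[of UNIV k])
      moreover have "\<beta>(k := 0) = \<beta>" using that by auto
      ultimately show ?thesis using p by (simp add: P_def norm_divide power_add)
    qed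
    ultimately show ?thesis
      unfolding im summable_on_reindex[OF inj] o_def
      using summable_on_cong[of "{\<beta>. \<beta> k = 0}" "\<lambda>\<beta>. norm (P (\<beta>(k := p))) * R ^ (\<Sum>i\<in>UNIV. (\<beta>(k := p)) i)"
          "\<lambda>\<beta>. norm (h p \<beta>) * R ^ (\<Sum>i\<in>UNIV. \<beta> i) * (R ^ p / fact p)"] by simp
  qed
  have "(\<lambda>\<alpha>. norm (P \<alpha>) * R ^ (\<Sum>i\<in>UNIV. \<alpha> i)) summable_on (\<Union>p\<in>{..<m}. {\<alpha>. \<alpha> k = p})"
    by (rule summable_on_finite_union_disjoint) (use part in auto)
  then have "(\<lambda>\<alpha>. norm (P \<alpha>) * R ^ (\<Sum>i\<in>UNIV. \<alpha> i)) summable_on UNIV"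
    by (subst summable_on_cong_neutral[where T = "\<Union>p\<in>{..<m}. {\<alpha>. \<alpha> k = p}" and g = "\<lambda>\<alpha>. norm (P \<alpha>) * R ^ (\<Sum>i\<in>UNIV. \<alpha> i)"])
      (auto simp: P_def)
  then have P: "ps_conv UNIV P (\<lambda>_. R)" by (simp add: ps_conv_def mpow_const)
  obtain \<rho> c where c: "\<rho> > 0" "ps_conv UNIV c (\<lambda>_. \<rho>)" "obox a (\<lambda>_. \<rho>) \<subseteq> X"
    "solves_on (obox a (\<lambda>_. \<rho>)) k m G (rps a c)" "\<And>\<alpha>. \<alpha> k < m \<Longrightarrow> c \<alpha> = P \<alpha>"
    by (rule local_solution[OF aX(1) P R]) (auto simp: P_def)
  define \<rho>' where "\<rho>' = min \<rho> R"
  have \<rho>': "\<rho>' > 0" "\<rho>' \<le> \<rho>" "\<rho>' \<le> R" using c R by (auto simp: \<rho>'_def)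
  have conv: "ps_conv UNIV c (\<lambda>_. \<rho>')" by (rule ps_conv_mono[OF c(2)]) (use \<rho>' in auto)
  have sub: "obox a (\<lambda>_. \<rho>') \<subseteq> obox a (\<lambda>_. \<rho>)" using \<rho>' by (intro obox_mono)
  have "(partial_deriv k ^^ p) (rps a c) x = g p x" if x: "x \<in> obox a (\<lambda>_. \<rho>')" "x $ k = t0" and p: "p < m" for x p
  proof -
    have xR: "\<bar>x $ i - a $ i\<bar> \<le> R" for i
    proof -
      have "\<bar>x $ i - a $ i\<bar> < \<rho>'" using x(1) by (simp add: obox_def)
      then show ?thesis using \<rho>' by simp
    qed
    have x': "(\<chi> i. if i = k then a $ k else x $ i) = x" using x(2) aX(2) by (simp add: vec_eq_iff)
    have "(partial_deriv k ^^ p) (rps a c) x = rps a (ps_derivs (pure_index k p) c) x"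
      by (rule funpow_partial_deriv_rps[OF ps_conv_imp_in[OF conv] x(1)])
    also have "\<dots> = rps a (\<lambda>\<gamma>. if \<gamma> k = 0 then ps_derivs (pure_index k p) c \<gamma> else 0) x"
      unfolding rps_initial_part x' ..
    also have "\<dots> = rps a (\<lambda>\<gamma>. if \<gamma> k = 0 then h p \<gamma> else 0) x"
    proof -
      have "ps_derivs (pure_index k p) c \<gamma> = h p \<gamma>" if "\<gamma> k = 0" for \<gamma>
      proof -
        have "\<gamma>(k := 0) = \<gamma>" using that by auto
        then show ?thesis using ps_derivs_pure_initial[where k = k and \<gamma> = \<gamma>, OF that, of p c] c(5)[of "\<gamma>(k := p)"] p by (simp add: P_def)
      qed
      then have "(\<lambda>\<gamma>. if \<gamma> k = 0 then ps_derivs (pure_index k p) c \<gamma> else 0) = (\<lambda>\<gamma>. if \<gamma> k = 0 then h p \<gamma> else 0)" by auto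
      then show ?thesis by simp
    qed
    also have "\<dots> = infsum (\<lambda>\<beta>. h p \<beta> * mpow UNIV (\<lambda>i. of_real (x $ i - a $ i)) \<beta>) {\<beta>. \<beta> k = 0}"
      unfolding rps_def ps_def by (rule infsum_cong_neutral) auto
    also have "\<dots> = g p x" by (rule infsumI[OF hs[OF p xR x(2)]])
    finally show ?thesis .
  qed
  then have "cauchy_patch a \<rho>' c"
    using \<rho>' conv sub c(3) solves_on_subset[OF c(4) sub] by (auto simp: cauchy_patch_def)
  then show ?thesis by blast
qed

text \<open>The projection \<open>s\<close> of \<open>x\<close> to the initial hyperplane lies in
  both boxes, and local uniqueness applies to the two series recentred at \<open>s\<close>. In every
  coordinate either \<open>x\<close> and \<open>s\<close> or \<open>s\<close> and the centre
  coincide, so the recentred series still represent the two patches at \<open>x\<close>, even if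
  \<open>x\<close> lies outside the small box about \<open>s\<close> on which uniqueness was
  used.\<close>

lemma cauchy_patch_agree:
  assumes 1: "cauchy_patch a \<rho> c" and 2: "cauchy_patch a' \<rho>' c'" and t: "a $ k = t0" "a' $ k = t0"
    and x: "x \<in> obox a (\<lambda>_. \<rho>)" "x \<in> obox a' (\<lambda>_. \<rho>')"
  shows "rps a c x = rps a' c' x"
proof -
  define s where "s = (\<chi> i. if i = k then t0 else x $ i)"
  have s: "s \<in> obox a (\<lambda>_. \<rho>)" "s \<in> obox a' (\<lambda>_. \<rho>')" "s $ k = t0"
    using x t 1 2 by (auto simp: s_def obox_def cauchy_patch_def)
  have sX: "s \<in> X" using s(1) 1 by (auto simp: cauchy_patch_def)
  define d where "d = recenter_coeff UNIV c (\<lambda>i. of_real (s $ i - a $ i))"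
  define d' where "d' = recenter_coeff UNIV c' (\<lambda>i. of_real (s $ i - a' $ i))"
  obtain R1 where R1: "R1 > 0" "\<forall>i\<in>UNIV. R1 \<le> \<rho> - \<bar>s $ i - a $ i\<bar>"
    using finite_lower_bound[of UNIV "\<lambda>i. \<rho> - \<bar>s $ i - a $ i\<bar>"] s(1) by (auto simp: obox_def)
  obtain R2 where R2: "R2 > 0" "\<forall>i\<in>UNIV. R2 \<le> \<rho>' - \<bar>s $ i - a' $ i\<bar>"
    using finite_lower_bound[of UNIV "\<lambda>i. \<rho>' - \<bar>s $ i - a' $ i\<bar>"] s(2) by (auto simp: obox_def)
  define R where "R = min R1 R2"
  have R: "R > 0" using R1 R2 by (simp add: R_def)
  have conv: "ps_conv UNIV (recenter_coeff UNIV e (\<lambda>i. of_real (s $ i - b $ i))) (\<lambda>_. R)"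
    and eq: "\<And>y. y \<in> obox s (\<lambda>_. R) \<Longrightarrow> rps s (recenter_coeff UNIV e (\<lambda>i. of_real (s $ i - b $ i))) y = rps b e y"
    and eqx: "rps s (recenter_coeff UNIV e (\<lambda>i. of_real (s $ i - b $ i))) x = rps b e x"
    and sub: "obox s (\<lambda>_. R) \<subseteq> obox b (\<lambda>_. r)"
    if p: "cauchy_patch b r e" and Rr: "\<forall>i\<in>UNIV. R \<le> r - \<bar>s $ i - b $ i\<bar>" and sb: "s \<in> obox b (\<lambda>_. r)"
      and xb: "x \<in> obox b (\<lambda>_. r)" and tb: "b $ k = t0" for b e r
  proof -
    have e: "ps_conv UNIV e (\<lambda>_. r)" using p by (simp add: cauchy_patch_def)
    have sbi: "\<bar>s $ i - b $ i\<bar> < r" for i using sb by (simp add: obox_def)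
    have n: "norm (complex_of_real (s $ i - b $ i)) = \<bar>s $ i - b $ i\<bar>" for i by (rule norm_of_real)
    have "ps_conv UNIV (recenter_coeff UNIV e (\<lambda>i. of_real (s $ i - b $ i))) (\<lambda>i. r - norm (complex_of_real (s $ i - b $ i)))"
      by (rule ps_conv_recenter[OF finite e]) (use sbi in \<open>simp only: n less_imp_le\<close>)
    then show "ps_conv UNIV (recenter_coeff UNIV e (\<lambda>i. of_real (s $ i - b $ i))) (\<lambda>_. R)"
      by (rule ps_conv_mono) (use Rr R in \<open>simp only: n, simp\<close>)
    show "rps s (recenter_coeff UNIV e (\<lambda>i. of_real (s $ i - b $ i))) y = rps b e y" if y: "y \<in> obox s (\<lambda>_. R)" for y
    proof (rule rps_recenter[OF e])
      fix i
      have "\<bar>y $ i - s $ i\<bar> < R" using y by (simp add: obox_def)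
      moreover have "R \<le> r - \<bar>s $ i - b $ i\<bar>" using Rr by simp
      ultimately show "\<bar>s $ i - b $ i\<bar> + \<bar>y $ i - s $ i\<bar> \<le> r" by linarith
    qed
    show "rps s (recenter_coeff UNIV e (\<lambda>i. of_real (s $ i - b $ i))) x = rps b e x"
    proof (rule rps_recenter[OF e])
      fix i
      have "\<bar>x $ i - b $ i\<bar> < r" using xb by (simp add: obox_def)
      then show "\<bar>s $ i - b $ i\<bar> + \<bar>x $ i - s $ i\<bar> \<le> r" using tb by (cases "i = k") (auto simp: s_def)
    qed
    show "obox s (\<lambda>_. R) \<subseteq> obox b (\<lambda>_. r)"
    proof
      fix y assume y: "y \<in> obox s (\<lambda>_. R)"
      have "\<bar>y $ i - b $ i\<bar> < r" for i
      proof -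
        have "\<bar>y $ i - s $ i\<bar> < R" using y by (simp add: obox_def)
        moreover have "R \<le> r - \<bar>s $ i - b $ i\<bar>" using Rr by simp
        ultimately show ?thesis by linarith
      qed
      then show "y \<in> obox b (\<lambda>_. r)" by (simp add: obox_def)
    qed
  qed
  have Rr1: "\<forall>i\<in>UNIV. R \<le> \<rho> - \<bar>s $ i - a $ i\<bar>"
    and Rr2: "\<forall>i\<in>UNIV. R \<le> \<rho>' - \<bar>s $ i - a' $ i\<bar>"
    using R1(2) R2(2) by (auto simp: R_def min_le_iff_disj)
  note D1 = conv[OF 1 Rr1 s(1) x(1) t(1), folded d_def] eq[OF 1 Rr1 s(1) x(1) t(1), folded d_def]
    eqx[OF 1 Rr1 s(1) x(1) t(1), folded d_def] sub[OF 1 Rr1 s(1) x(1) t(1)]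
  note D2 = conv[OF 2 Rr2 s(2) x(2) t(2), folded d'_def] eq[OF 2 Rr2 s(2) x(2) t(2), folded d'_def]
    eqx[OF 2 Rr2 s(2) x(2) t(2), folded d'_def] sub[OF 2 Rr2 s(2) x(2) t(2)]
  have sol1: "solves_on (obox s (\<lambda>_. R)) k m G (rps s d)"
    by (rule solves_on_cong[OF open_obox D1(2)[symmetric]])
      (use 1 D1(4) solves_on_subset in \<open>auto simp: cauchy_patch_def\<close>)
  have sol2: "solves_on (obox s (\<lambda>_. R)) k m G (rps s d')"
    by (rule solves_on_cong[OF open_obox D2(2)[symmetric]])
      (use 2 D2(4) solves_on_subset in \<open>auto simp: cauchy_patch_def\<close>)
  have init1: "(partial_deriv k ^^ p) (rps s d) y = g p y" if "p < m" "y \<in> obox s (\<lambda>_. R)" "y $ k = t0" for p y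
  proof -
    have "(partial_deriv k ^^ p) (rps s d) y = (partial_deriv k ^^ p) (rps a c) y"
      unfolding funpow_partial_deriv by (rule foldr_partial_deriv_cong[OF open_obox that(2) D1(2)])
    then show ?thesis using 1 D1(4) that by (auto simp: cauchy_patch_def)
  qed
  have init2: "(partial_deriv k ^^ p) (rps s d') y = g p y" if "p < m" "y \<in> obox s (\<lambda>_. R)" "y $ k = t0" for p y
  proof -
    have "(partial_deriv k ^^ p) (rps s d') y = (partial_deriv k ^^ p) (rps a' c') y"
      unfolding funpow_partial_deriv by (rule foldr_partial_deriv_cong[OF open_obox that(2) D2(2)])
    then show ?thesis using 2 D2(4) that by (auto simp: cauchy_patch_def)
  qed
  have "d = d'"
  proof (rule local_uniqueness[OF X m G sX D1(1) D2(1) R open_obox[of s "\<lambda>_. R"] center_in_obox])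
    show "rps s (ps_derivs (pure_index k m) d) y = G y (\<lambda>\<alpha>\<in>jet_indices k m. rps s (ps_derivs \<alpha> d) y)"
      if "y \<in> obox s (\<lambda>_. R)" for y
      using sol1 that by (simp add: solves_on_rps[OF ps_conv_imp_in[OF D1(1)]])
    show "rps s (ps_derivs (pure_index k m) d') y = G y (\<lambda>\<alpha>\<in>jet_indices k m. rps s (ps_derivs \<alpha> d') y)"
      if "y \<in> obox s (\<lambda>_. R)" for y
      using sol2 that by (simp add: solves_on_rps[OF ps_conv_imp_in[OF D2(1)]])
    show "d \<alpha> = d' \<alpha>" if "\<alpha> k < m" for \<alpha>
      by (rule initial_coefficients_unique[where k = k and s = s and p = "\<alpha> k" and \<alpha> = \<alpha>, OF ps_conv_imp_in[OF D1(1)] ps_conv_imp_in[OF D2(1)] R])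
        (use init1 init2 that s(3) in simp_all)
  qed (use R in simp)
  then show ?thesis using D1(3) D2(3) by simp
qed

lemma solution_near_initial_surface:
  obtains N u where "open N" "N \<subseteq> X" "initial_surface X k t0 \<subseteq> N" "u real_analytic_on N" "solves_on N k m G u"
    "\<forall>p<m. \<forall>x\<in>initial_surface X k t0. (partial_deriv k ^^ p) u x = g p x"
proof -
  let ?S = "initial_surface X k t0"
  have "\<forall>a\<in>?S. \<exists>\<rho>. \<exists>c. cauchy_patch a \<rho> c" using cauchy_patch_exists by blast
  then obtain \<rho> where "\<forall>a\<in>?S. \<exists>c. cauchy_patch a (\<rho> a) c" by (rule bchoice[THEN exE])
  then obtain c where cp: "\<forall>a\<in>?S. cauchy_patch a (\<rho> a) (c a)" by (rule bchoice[THEN exE])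
  define B where "B a = obox a (\<lambda>_. \<rho> a)" for a
  define N where "N = (\<Union>a\<in>?S. B a)"
  \<comment> \<open>Any patch that contains \<open>x\<close> gives the same value by
    \<open>cauchy_patch_agree\<close>, so the choice is immaterial.\<close>
  define u where "u x = (let a = (SOME a. a \<in> ?S \<and> x \<in> B a) in rps a (c a) x)" for x
  have u: "u x = rps a (c a) x" if a: "a \<in> ?S" "x \<in> B a" for a x
  proof -
    let ?b = "SOME a. a \<in> ?S \<and> x \<in> B a"
    have b: "?b \<in> ?S \<and> x \<in> B ?b" by (rule someI[where P = "\<lambda>a. a \<in> ?S \<and> x \<in> B a"]) (use a in blast)
    have "rps ?b (c ?b) x = rps a (c a) x"
      by (rule cauchy_patch_agree[of _ "\<rho> ?b" _ _ "\<rho> a"]) (use a b cp in \<open>auto simp: B_def initial_surface_def\<close>)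
    then show ?thesis by (simp add: u_def Let_def)
  qed
  have oB: "open (B a)" for a unfolding B_def by (rule open_obox)
  have BX: "B a \<subseteq> X" "a \<in> B a" "solves_on (B a) k m G (rps a (c a))" "rps a (c a) real_analytic_on B a" if "a \<in> ?S" for a
  proof -
    have p: "cauchy_patch a (\<rho> a) (c a)" using cp that by blast
    then show "B a \<subseteq> X" "a \<in> B a" "solves_on (B a) k m G (rps a (c a))"
      by (auto simp: B_def cauchy_patch_def intro: center_in_obox)
    show "rps a (c a) real_analytic_on B a"
      unfolding B_def by (rule rps_real_analytic[OF ps_conv_imp_in order_refl]) (use p in \<open>simp add: cauchy_patch_def\<close>)
  qed
  show ?thesis
  proof (rule that[of N u])
    show "open N" unfolding N_def using oB by blast
    show "N \<subseteq> X" "?S \<subseteq> N" unfolding N_def using BX by blast+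
    show "u real_analytic_on N"
    proof (rule real_analytic_on_local)
      fix x assume "x \<in> N"
      then obtain a where a: "a \<in> ?S" "x \<in> B a" by (auto simp: N_def)
      then show "\<exists>V h. open V \<and> x \<in> V \<and> h real_analytic_on V \<and> (\<forall>x\<in>V \<inter> N. u x = h x)"
        using oB BX(4) u by (intro exI[of _ "B a"] exI[of _ "rps a (c a)"]) auto
    qed
    have sol: "solves_on (B a) k m G u" if "a \<in> ?S" for a
      by (rule solves_on_cong[OF oB u[OF that, symmetric] BX(3)[OF that]])
    then show "solves_on N k m G u" unfolding N_def solves_on_def by blast
    show "\<forall>p<m. \<forall>x\<in>?S. (partial_deriv k ^^ p) u x = g p x"
    proof (intro allI impI ballI)
      fix p x assume that: "p < m" "x \<in> ?S"
      have "(partial_deriv k ^^ p) u x = (partial_deriv k ^^ p) (rps x (c x)) x"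
        unfolding funpow_partial_deriv by (rule foldr_partial_deriv_cong[OF oB BX(2)[OF that(2)] u[OF that(2)]])
      then show "(partial_deriv k ^^ p) u x = g p x"
        using cp that BX(2)[OF that(2)] by (auto simp: cauchy_patch_def B_def initial_surface_def)
    qed
  qed
qed

end

section \<open>Separation by a null level set and filling by balls\<close>

text \<open>Level sets for different values are disjoint, so a finite measure charges at most
  countably many of them, and the interval contains further values. Lebesgue measure is made finite
  by restriction to balls of radius \<open>n\<close>; the exceptional values for all
  \<open>n\<close> together are still countable.\<close>

lemma null_level_set:
  fixes f :: "'a::euclidean_space \<Rightarrow> real"
  assumes X: "open X" and f: "continuous_on X f" and "a < b"
  shows "\<exists>c. a < c \<and> c < b \<and> {x \<in> X. f x = c} \<in> null_sets lebesgue"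
proof -
  define M where "M n = distr (restrict_space lborel (X \<inter> cball 0 (real n))) borel f" for n :: nat
  have meas: "f \<in> borel_measurable (restrict_space lborel (X \<inter> cball 0 (real n)))" for n
  proof -
    have "f \<in> borel_measurable (restrict_space borel (X \<inter> cball 0 (real n)))"
      by (intro borel_measurable_continuous_on_restrict continuous_on_subset[OF f]) auto
    then show ?thesis by (simp cong: measurable_cong_sets add: sets_restrict_space)
  qed
  have B: "X \<inter> cball 0 (real n) \<in> sets lborel" for n
    using X by (simp add: borel_open borel_closed sets.Int)
  have fin: "finite_measure (M n)" for n
    unfolding M_def
  proof (intro finite_measure.finite_measure_distr meas)
    have "emeasure lborel (X \<inter> cball 0 (real n)) \<le> emeasure lborel (cball (0 :: 'a) (real n))"
      by (intro emeasure_mono) auto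
    also have "\<dots> < \<infinity>" by (rule emeasure_bounded_finite) simp
    finally show "finite_measure (restrict_space lborel (X \<inter> cball 0 (real n)))"
      using B by (intro finite_measureI) (auto simp: emeasure_restrict_space space_restrict_space)
  qed
  have "countable (\<Union>n. {c. measure (M n) {c} \<noteq> 0})"
    by (intro countable_UN finite_measure.countable_support fin) simp
  moreover have "uncountable {a<..<b}" using \<open>a < b\<close> by (rule uncountable_open_interval[THEN iffD2])
  ultimately obtain c where c: "c \<in> {a<..<b}" "c \<notin> (\<Union>n. {c. measure (M n) {c} \<noteq> 0})"
    by (metis countable_subset subsetI)
  have "{x \<in> X. f x = c} \<in> null_sets lborel"
  proof -
    have "{x \<in> X \<inter> cball 0 (real n). f x = c} \<in> null_sets lborel" for n
    proof -
      let ?R = "restrict_space lborel (X \<inter> cball 0 (real n))"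
      have sp: "space ?R = X \<inter> cball 0 (real n)" by (simp add: space_restrict_space)
      have eq: "f -` {c} \<inter> space ?R = {x \<in> X \<inter> cball 0 (real n). f x = c}" unfolding sp by auto
      have "emeasure (M n) {c} = 0"
        using c(2) finite_measure.emeasure_eq_measure[OF fin] by simp
      then have 0: "emeasure ?R {x \<in> X \<inter> cball 0 (real n). f x = c} = 0"
        unfolding M_def by (subst (asm) emeasure_distr[OF meas]) (simp_all add: eq)
      have "f -` {c} \<inter> space ?R \<in> sets ?R" by (rule measurable_sets[OF meas]) simp
      then have s: "{x \<in> X \<inter> cball 0 (real n). f x = c} \<in> sets ?R" unfolding eq .
      then have "{x \<in> X \<inter> cball 0 (real n). f x = c} \<in> sets lborel"
        using B by (auto simp: sets_restrict_space)
      moreover have "emeasure lborel {x \<in> X \<inter> cball 0 (real n). f x = c} = 0"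
        using 0 B by (subst (asm) emeasure_restrict_space) auto
      ultimately show ?thesis by (rule null_setsI[rotated])
    qed
    then have "(\<Union>n. {x \<in> X \<inter> cball 0 (real n). f x = c}) \<in> null_sets lborel" by (rule null_sets_UN)
    moreover have "(\<Union>n. {x \<in> X \<inter> cball 0 (real n). f x = c}) = {x \<in> X. f x = c}"
      using real_arch_simple by auto
    ultimately show ?thesis by simp
  qed
  then have "{x \<in> X. f x = c} \<in> null_sets lebesgue" by (rule null_sets_completionI)
  with c(1) show ?thesis by auto
qed

context cauchy_problem
begin

theorem classical_solution:
  obtains \<Sigma> \<psi> where "\<Sigma> \<subseteq> X" "open (X - \<Sigma>)" "\<Sigma> \<in> null_sets lebesgue" "X \<subseteq> closure (X - \<Sigma>)" "\<Sigma> \<inter> initial_surface X k t0 = {}"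
    "\<psi> real_analytic_on (X - \<Sigma>)" "solves_on (X - \<Sigma>) k m G \<psi>"
    "\<forall>p<m. \<forall>x\<in>initial_surface X k t0. (partial_deriv k ^^ p) \<psi> x = g p x"
proof -
  let ?S = "initial_surface X k t0"
  obtain N u where N: "open N" "N \<subseteq> X" "?S \<subseteq> N" "u real_analytic_on N" "solves_on N k m G u"
    and init: "\<forall>p<m. \<forall>x\<in>?S. (partial_deriv k ^^ p) u x = g p x"
    by (rule solution_near_initial_surface)
  have "?S = X \<inter> {x. x $ k = t0}" by (auto simp: initial_surface_def)
  moreover have "closed {x :: real ^ 'n. x $ k = t0}" by (intro closed_Collect_eq continuous_intros)
  ultimately have cS: "closedin (top_of_set X) ?S" by (auto simp: closedin_closed)
  have "X - N = X \<inter> - N" by auto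
  then have cN: "closedin (top_of_set X) (X - N)" using N(1) by (auto simp: closedin_closed)
  have "?S \<inter> (X - N) = {}" using N(3) by blast
  then obtain f :: "real ^ 'n \<Rightarrow> real" where f: "continuous_on X f" "\<And>x. x \<in> ?S \<Longrightarrow> f x = 0" "\<And>x. x \<in> X - N \<Longrightarrow> f x = 1"
    using Urysohn_local[OF cS cN, of 0 "1::real"] by metis
  obtain c where c: "0 < c" "c < 1" "{x \<in> X. f x = c} \<in> null_sets lebesgue"
    using null_level_set[OF X f(1), of 0 1] by auto
  define W0 where "W0 = {x \<in> X. f x < c}"
  define W1 where "W1 = {x \<in> X. c < f x}"
  have "open (X \<inter> f -` {..<c})" "open (X \<inter> f -` {c<..})"
    using continuous_on_open_vimage[OF X, of f] f(1) by (metis Int_commute open_lessThan open_greaterThan)+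
  moreover have "X \<inter> f -` {..<c} = W0" "X \<inter> f -` {c<..} = W1" by (auto simp: W0_def W1_def)
  ultimately have oW: "open W0" "open W1" by simp_all
  have W0N: "W0 \<subseteq> N" using f(3) c by (force simp: W0_def)
  have SW0: "?S \<subseteq> W0" using f(2) c by (auto simp: W0_def initial_surface_def)
  \<comment> \<open>Balls, as pairs of centre and radius, that lie beyond the level set and carry a
    solution. Solutions restrict to smaller balls, so every point of \<open>W1\<close> has such
    balls of arbitrarily small radius, as Vitali's theorem demands.\<close>
  define K where "K = {p :: (real ^ 'n) \<times> real. ball (fst p) (snd p) \<subseteq> W1 \<and>
     (\<exists>v. v real_analytic_on ball (fst p) (snd p) \<and> solves_on (ball (fst p) (snd p)) k m G v)}"
  have "\<exists>p. p \<in> K \<and> x \<in> ball (fst p) (snd p) \<and> snd p < d" if x: "x \<in> W1" and d: "0 < d" for x d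
  proof -
    obtain e where e: "e > 0" "ball x e \<subseteq> W1" using oW x openE by blast
    have "x \<in> X" using x by (simp add: W1_def)
    then obtain r v where r: "r > 0" "v real_analytic_on ball x r" "solves_on (ball x r) k m G v"
      using local_solution_ball by blast
    define q where "q = min r (min e (d / 2))"
    have q: "q > 0" "q < d" "ball x q \<subseteq> ball x r" "ball x q \<subseteq> ball x e" using r e d by (auto simp: q_def)
    have "(x, q) \<in> K"
      using q e r real_analytic_on_subset[OF r(2) q(3)] solves_on_subset[OF r(3) q(3)] by (auto simp: K_def)
    then show ?thesis using q by (intro exI[of _ "(x, q)"]) auto
  qed
  then obtain C where C: "countable C" "C \<subseteq> K"
     "pairwise (\<lambda>i j. disjnt (ball (fst i) (snd i)) (ball (fst j) (snd j))) C"
     "negligible (W1 - (\<Union>i\<in>C. ball (fst i) (snd i)))"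
    using Vitali_covering_theorem_balls[of W1 K fst snd] by blast
  let ?B = "\<lambda>p :: (real ^ 'n) \<times> real. ball (fst p) (snd p)"
  have "\<forall>p\<in>C. \<exists>v. v real_analytic_on ?B p \<and> solves_on (?B p) k m G v" using C(2) by (auto simp: K_def)
  then obtain v where v: "\<forall>p\<in>C. v p real_analytic_on ?B p \<and> solves_on (?B p) k m G (v p)" by (rule bchoice[THEN exE])
  have BW1: "?B p \<subseteq> W1" if "p \<in> C" for p using that C(2) by (auto simp: K_def)
  have W01: "W0 \<inter> W1 = {}" by (auto simp: W0_def W1_def)
  define D where "D = W0 \<union> (\<Union>p\<in>C. ?B p)"
  define \<Sigma> where "\<Sigma> = X - D"
  have DX: "D \<subseteq> X" using BW1 by (auto simp: D_def W0_def W1_def)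
  then have X\<Sigma>: "X - \<Sigma> = D" by (auto simp: \<Sigma>_def)
  have oD: "open D" unfolding D_def using oW by blast
  \<comment> \<open>The pieces are open and pairwise disjoint, so the solutions on them do not have
    to match, and a point of a ball determines that ball.\<close>
  define \<psi> where "\<psi> x = (if x \<in> W0 then u x else v (SOME p. p \<in> C \<and> x \<in> ?B p) x)" for x
  have \<psi>0: "\<psi> x = u x" if "x \<in> W0" for x using that by (simp add: \<psi>_def)
  have \<psi>1: "\<psi> x = v p x" if p: "p \<in> C" "x \<in> ?B p" for p x
  proof -
    let ?q = "SOME p. p \<in> C \<and> x \<in> ?B p"
    have q: "?q \<in> C \<and> x \<in> ?B ?q" by (rule someI[where P = "\<lambda>p. p \<in> C \<and> x \<in> ?B p"]) (use p in blast)
    have "?q = p"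
    proof (rule ccontr)
      assume "?q \<noteq> p"
      then have "disjnt (?B ?q) (?B p)" using C(3) q p(1) by (auto simp: pairwise_def)
      then show False using q p(2) by (auto simp: disjnt_def)
    qed
    moreover have "x \<notin> W0" using p BW1 W01 by blast
    ultimately show ?thesis by (simp add: \<psi>_def)
  qed
  \<comment> \<open>Everything outside the pieces is either on the level set or in the part of
    \<open>W1\<close> missed by the balls.\<close>
  have "\<Sigma> \<subseteq> {x \<in> X. f x = c} \<union> (W1 - (\<Union>p\<in>C. ?B p))"
    by (auto simp: \<Sigma>_def D_def W0_def W1_def)
  moreover have "negligible ({x \<in> X. f x = c} \<union> (W1 - (\<Union>p\<in>C. ?B p)))"
    using C(4) c(3) by (auto simp: negligible_iff_null_sets)
  ultimately have neg: "negligible \<Sigma>" by (rule negligible_subset[rotated])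
  show ?thesis
  proof (rule that[of \<Sigma> \<psi>], unfold X\<Sigma>)
    show "\<Sigma> \<subseteq> X" by (auto simp: \<Sigma>_def)
    show "open D" by (rule oD)
    show "\<Sigma> \<in> null_sets lebesgue" using neg by (simp add: negligible_iff_null_sets)
    show "X \<subseteq> closure D"
    proof (rule ccontr)
      assume "\<not> ?thesis"
      \<comment> \<open>A nonempty open set inside \<Sigma> would not be null; density of
        \<open>D\<close> is thus a consequence of the measure statement.\<close>
      then have "X - closure D \<noteq> {}" by blast
      moreover have "open (X - closure D)" using X by auto
      ultimately have "\<not> negligible (X - closure D)" using open_not_negligible by blast
      moreover have "X - closure D \<subseteq> \<Sigma>" using closure_subset by (auto simp: \<Sigma>_def)
      ultimately show False using neg negligible_subset by blast
    qed
    show "\<Sigma> \<inter> ?S = {}" using SW0 by (auto simp: \<Sigma>_def D_def)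
    show "\<psi> real_analytic_on D"
    proof (rule real_analytic_on_local)
      fix x assume "x \<in> D"
      then consider "x \<in> W0" | p where "p \<in> C" "x \<in> ?B p" unfolding D_def by blast
      then show "\<exists>V h. open V \<and> x \<in> V \<and> h real_analytic_on V \<and> (\<forall>x\<in>V \<inter> D. \<psi> x = h x)"
      proof cases
        case 1
        then show ?thesis using oW \<psi>0 real_analytic_on_subset[OF N(4) W0N] by (intro exI[of _ W0] exI[of _ u]) auto
      next
        case 2
        then show ?thesis using v \<psi>1 by (intro exI[of _ "?B p"] exI[of _ "v p"]) auto
      qed
    qed
    have "solves_on W0 k m G \<psi>"
      by (rule solves_on_cong[OF oW(1) \<psi>0[symmetric] solves_on_subset[OF N(5) W0N]])
    moreover have "solves_on (?B p) k m G \<psi>" if "p \<in> C" for p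
      by (rule solves_on_cong[OF open_ball \<psi>1[OF that, symmetric]]) (use v that in auto)
    ultimately show "solves_on D k m G \<psi>" unfolding D_def solves_on_def by blast
    show "\<forall>p<m. \<forall>x\<in>?S. (partial_deriv k ^^ p) \<psi> x = g p x"
    proof (intro allI impI ballI)
      fix p x assume that: "p < m" "x \<in> ?S"
      have "(partial_deriv k ^^ p) \<psi> x = (partial_deriv k ^^ p) u x"
        unfolding funpow_partial_deriv
        by (rule foldr_partial_deriv_cong[OF oW(1) subsetD[OF SW0 that(2)] \<psi>0])
      then show "(partial_deriv k ^^ p) \<psi> x = g p x" using init that by simp
    qed
  qed
qed

end

theorem theorem1:
  fixes X :: "(real ^ 'n::finite) set"
    and k :: 'n
    and m :: nat
    and G :: "real ^ 'n \<Rightarrow> (('n \<Rightarrow> nat) \<Rightarrow> complex) \<Rightarrow> complex"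
    and t0 :: real
    and g :: "nat \<Rightarrow> real ^ 'n \<Rightarrow> complex"
  assumes "open X" and "X \<noteq> {}" and "m \<ge> 1"
    and "analytic_in_all_variables X (jet_indices k m) G"
    and "\<And>p. p < m \<Longrightarrow> g p real_analytic_on initial_surface X k t0"
  shows "(\<exists>U \<in> carrier (A_Baire_I X). \<exists>\<Sigma> \<psi>.
            closedin (top_of_set X) \<Sigma> \<and> nowhere_dense_in (top_of_set X) \<Sigma> \<and>
            \<Sigma> \<in> null_sets lebesgue \<and>
            \<psi> real_analytic_on (X - \<Sigma>) \<and>
            is_generalized_solution I_Baire_I X k m G t0 g \<Sigma> \<psi> U)
       \<and> (\<exists>U \<in> carrier (B_Baire_I X). \<exists>\<Sigma> \<psi>.
            closedin (top_of_set X) \<Sigma> \<and> nowhere_dense_in (top_of_set X) \<Sigma> \<and>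
            \<Sigma> \<in> null_sets lebesgue \<and>
            \<psi> real_analytic_on (X - \<Sigma>) \<and>
            is_generalized_solution J_Baire_I X k m G t0 g \<Sigma> \<psi> U)"
proof -
  interpret cauchy_problem X k m G t0 g
    by unfold_locales (use assms in auto)
  obtain \<Sigma> \<psi> where S: "\<Sigma> \<subseteq> X" "open (X - \<Sigma>)" "\<Sigma> \<in> null_sets lebesgue" "X \<subseteq> closure (X - \<Sigma>)" "\<Sigma> \<inter> initial_surface X k t0 = {}"
    and an: "\<psi> real_analytic_on (X - \<Sigma>)" and sol: "solves_on (X - \<Sigma>) k m G \<psi>"
    and init': "\<forall>p<m. \<forall>x\<in>initial_surface X k t0. (partial_deriv k ^^ p) \<psi> x = g p x"
    by (rule classical_solution)
  have init: "(partial_deriv k ^^ p) \<psi> x = g p x" if "p < m" "x \<in> initial_surface X k t0" for p x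
    using init' that by blast
  have "X - (X - \<Sigma>) = \<Sigma>" using S(1) by blast
  moreover have "closedin (top_of_set X) (X - (X - \<Sigma>))"
    by (rule closedin_diff) (auto simp: S(2) assms(1) openin_open_eq)
  ultimately have cl: "closedin (top_of_set X) \<Sigma>" by simp
  have nd: "nowhere_dense_in (top_of_set X) \<Sigma>"
  proof (subst nowhere_dense_in_open[OF assms(1) S(1)], intro allI impI)
    fix V assume V: "open V \<and> V \<subseteq> X \<and> V \<subseteq> closure \<Sigma>"
    have "closure \<Sigma> \<subseteq> - (X - \<Sigma>)" using S(2) by (intro closure_minimal closed_Compl) auto
    then have "V \<inter> (X - \<Sigma>) = {}" using V by blast
    then have "V \<inter> closure (X - \<Sigma>) = {}" using V open_Int_closure_eq_empty by blast
    then show "V = {}" using V S(4) by blast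
  qed
  have pde: "(partial_deriv k ^^ m) \<psi> x = G x (\<lambda>\<alpha>\<in>jet_indices k m. multi_deriv \<alpha> \<psi> x)" if "x \<in> X - \<Sigma>" for x
    using sol that by (simp add: solves_on_def)
  \<comment> \<open>The same \<Sigma> and \<psi> serve both algebras: \<open>main\<close> leaves the
    ideal open, and all that enters of it is that it equals \<open>generically_null\<close> on open
    sets.\<close>
  note main = generalized_solution_of_classical[OF assms(1,2,4) S(2,4,5) real_analytic_smooth_on[OF an S(2)] pde init]
  have "\<exists>U\<in>carrier (smooth_seq_ring X Quot I_Baire_I X). is_generalized_solution I_Baire_I X k m G t0 g \<Sigma> \<psi> U"
    by (rule main, assumption+, rule I_Baire_I_eq)
  moreover have "\<exists>U\<in>carrier (smooth_seq_ring X Quot J_Baire_I X). is_generalized_solution J_Baire_I X k m G t0 g \<Sigma> \<psi> U"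
    by (rule main, assumption+, rule J_Baire_I_eq)
  ultimately show ?thesis
    unfolding A_Baire_I_def B_Baire_I_def using cl nd S(3) an by blast
qed

end
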